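(* Let $(\mathcal U,\rho)$ be a complete metric space. Suppose that $\{T_j\}\in\mathfrak M^{(W)}(\mathbf R)$ and $f_j\in W(\mathbf R,\mathcal U)$ for $j\in\mathbf N$. Then $$\sum_j f_j(\cdot)\chi_{T_j}(\cdot)\in W(\mathbf R,\mathcal U)$$ and $$\mathrm{Mod}\,\sum_j f_j(\cdot)\chi_{T_j}(\cdot)\subset \sum_j\mathrm{Mod}\, f_j+\sum_j\mathrm{Mod}\, T_j .$$
   Context: Below $(X,d)$ denotes a complete metric space (e.g. $\mathcal U$ with $\rho$, or $\mathbf R$ with $|x-y|$). $\mathrm{meas}$ is Lebesgue measure on $\mathbf R$, and measurable sets are Lebesgue measurable. A function $f:\mathbf R\to X$ is elementary if there are points $x_j\in X$ and pairwise disjoint measurable sets $T_j\subset\mathbf R$, $j\in\mathbf N$, with $\mathrm{meas}(\mathbf R\setminus\bigcup_jT_j)=0$ and $f(t)=x_j$ for $t\in T_j$. A function $f:\mathbf R\to X$ is measurable if for every $\epsilon>0$ there is an elementary function $f_\epsilon$ with $\mathrm{ess\,sup}_{t\in\mathbf R}\,d(f(t),f_\epsilon(t))<\epsilon$; $M(\mathbf R,X)$ is the class of measurable functions, functions equal almost everywhere being identified. Put $d'(x,y)=\min\{1,d(x,y)\}$ and, for $l>0$, $D^{(d)}_l(f,g)=\sup_{\xi\in\mathbf R}\frac1l\int_\xi^{\xi+l}d'(f(t),g(t))\,dt$. A set $T\subset\mathbf R$ is relatively dense if there is $a>0$ with $[\xi,\xi+a]\cap T\ne\emptyset$ for all $\xi\in\mathbf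 R$. $W(\mathbf R,X)$ (equi-Weyl almost periodic functions) is the set of $f\in M(\mathbf R,X)$ such that for every $\epsilon>0$ there is $l>0$ for which the set of $\tau\in\mathbf R$ with $D^{(d)}_l(f(\cdot),f(\cdot+\tau))<\epsilon$ is relatively dense. For $f\in W(\mathbf R,X)$, a sequence $\tau_j\in\mathbf R$, $j\in\mathbf N$, is $f$-returning if for every $\epsilon>0$ there are $l>0$ and $j_0\in\mathbf N$ with $D^{(d)}_l(f(\cdot),f(\cdot+\tau_j))<\epsilon$ for all $j\ge j_0$. $\mathrm{Mod}\,f$ is the set of $\lambda\in\mathbf R$ such that $e^{i\lambda\tau_j}\to1$ for all $f$-returning sequences $\{\tau_j\}$; it is an additive subgroup (module) of $\mathbf R$. $\chi_T$ is the characteristic function of $T\subset\mathbf R$. $W(\mathbf R)$ is the collection of measurable sets $T\subset\mathbf R$ with $\chi_T\in W(\mathbf R,\mathbf R)$, and $\mathrm{Mod}\,T=\mathrm{Mod}\,\chi_T$ for $T\in W(\mathbf R)$. For bounded measurable $h:\mathbf R\to\mathbf R$, $\|h\|_1=\lim_{l\to+\infty}\sup_{\xi\in\mathbf R}\frac1l\int_\xi^{\xi+l}|h(t)|\,dt$. For an additive subgroup (module) $\Lambda\subset\mathbf R$, $\mathfrak M^{(W)}(\Lambda)$ is the set of sequences $\{T_j\}_{j\in\mathbf N}$ of pairwise disjoint sets $T_j\in W(\mathbf R)$ such that $\mathrm{Mod}\,T_j\subset\Lambda$ for all $j$, $\mathrm{meas}(\mathbf R\setminus\bigcup_jT_j)=0$,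 and $\|\chi_{\mathbf R\setminus\bigcup_{j\le N}T_j}\|_1\to0$ as $N\to+\infty$ (finite sequences are included, being completed by empty sets). $\sum_jf_j(\cdot)\chi_{T_j}(\cdot)$ is the function coinciding with $f_j$ on $T_j$ for each $j$ (no linear structure on $\mathcal U$ is used). Sums of modules: $\sum_j\Lambda_j$ (and $\Lambda_1+\Lambda_2$) is the smallest additive subgroup of $\mathbf R$ containing all $\Lambda_j$. *)

theory Defs
  imports
    "HOL-Analysis.Analysis"
    "HOL-Probability.Essential_Supremum"
    "HOL-Computational_Algebra.Group_Closure"
begin

text \<open>
  Classes of functions modulo almost everywhere equality are represented by predicates and sets
  on the functions themselves. Integrals are Lebesgue integrals with respect to
  \<^term>\<open>lebesgue\<close>, not \<^term>\<open>lborel\<close>: the integrands are only Lebesgue measurable,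
  and the Bochner integral of a non-measurable function is \<open>0\<close> by convention.
\<close>

definition elementary :: "(real \<Rightarrow> 'a) \<Rightarrow> bool" where
  "elementary f \<longleftrightarrow>
    (\<exists>(x :: nat \<Rightarrow> 'a) (T :: nat \<Rightarrow> real set).
      disjoint_family T \<and> (\<forall>j. T j \<in> sets lebesgue) \<and>
      UNIV - (\<Union>j. T j) \<in> null_sets lebesgue \<and>
      (\<forall>j. \<forall>t\<in>T j. f t = x j))"

text \<open>
  The library's \<^term>\<open>esssup\<close> takes the value \<open>\<infinity>\<close> on non-measurable functions. This excludes
  nothing here: if, for every \<open>\<epsilon>\<close>, \<open>f\<close> is within \<open>\<epsilon>\<close> of an elementary function outside a null
  set, then \<open>f\<close> is an almost everywhere limit of elementary functions, so that the
  distance of \<open>f\<close> to any elementary function is Lebesgue measurable.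
\<close>

definition M_class :: "(real \<Rightarrow> 'a::complete_space) set" where
  "M_class = {f. \<forall>\<epsilon>>0. \<exists>g. elementary g \<and>
      esssup lebesgue (\<lambda>t. ereal (dist (f t) (g t))) < ereal \<epsilon>}"

definition dist_trunc :: "'a::metric_space \<Rightarrow> 'a \<Rightarrow> real" where
  "dist_trunc x y = min 1 (dist x y)"

definition D_dist :: "real \<Rightarrow> (real \<Rightarrow> 'a::metric_space) \<Rightarrow> (real \<Rightarrow> 'a) \<Rightarrow> real" where
  "D_dist l f g =
    (SUP \<xi>\<in>UNIV. 1 / l * (LINT t:{\<xi>..\<xi> + l}|lebesgue. dist_trunc (f t) (g t)))"

definition relatively_dense :: "real set \<Rightarrow> bool" where
  "relatively_dense T \<longleftrightarrow> (\<exists>a>0. \<forall>\<xi>. {\<xi>..\<xi> + a} \<inter> T \<noteq> {})"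

definition W_class :: "(real \<Rightarrow> 'a::complete_space) set" where
  "W_class = {f \<in> M_class. \<forall>\<epsilon>>0. \<exists>l>0.
      relatively_dense {\<tau>. D_dist l f (\<lambda>t. f (t + \<tau>)) < \<epsilon>}}"

definition returning :: "(real \<Rightarrow> 'a::metric_space) \<Rightarrow> (nat \<Rightarrow> real) \<Rightarrow> bool" where
  "returning f \<tau> \<longleftrightarrow>
    (\<forall>\<epsilon>>0. \<exists>l>0. \<exists>j0. \<forall>j\<ge>j0. D_dist l f (\<lambda>t. f (t + \<tau> j)) < \<epsilon>)"

definition Mod :: "(real \<Rightarrow> 'a::metric_space) \<Rightarrow> real set" where
  "Mod f = {\<mu>. \<forall>\<tau>. returning f \<tau> \<longrightarrow>
      (\<lambda>j. exp (\<i> * complex_of_real (\<mu> * \<tau> j))) \<longlonglongrightarrow> 1}"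

definition W_sets :: "real set set" where
  "W_sets = {T \<in> sets lebesgue. (indicator T :: real \<Rightarrow> real) \<in> W_class}"

definition Mod_set :: "real set \<Rightarrow> real set" where
  "Mod_set T = Mod (indicator T :: real \<Rightarrow> real)"

text \<open>For bounded measurable functions the suprema are finite and the limit exists.\<close>

definition norm1 :: "(real \<Rightarrow> real) \<Rightarrow> real" where
  "norm1 h = Lim at_top
    (\<lambda>l. SUP \<xi>\<in>UNIV. 1 / l * (LINT t:{\<xi>..\<xi> + l}|lebesgue. \<bar>h t\<bar>))"

definition MW :: "real set \<Rightarrow> (nat \<Rightarrow> real set) set" where
  "MW \<Lambda> = {T. disjoint_family T \<and> (\<forall>j. T j \<in> W_sets) \<and> (\<forall>j. Mod_set (T j) \<subseteq> \<Lambda>) \<and>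
      UNIV - (\<Union>j. T j) \<in> null_sets lebesgue \<and>
      (\<lambda>N. norm1 (indicator (UNIV - (\<Union>j\<le>N. T j)))) \<longlonglongrightarrow> 0}"

text \<open>
  \<^term>\<open>group_closure S\<close> is the smallest additive subgroup containing \<open>S\<close>.
\<close>

definition module_plus :: "real set \<Rightarrow> real set \<Rightarrow> real set" where
  "module_plus \<Lambda>1 \<Lambda>2 = group_closure (\<Lambda>1 \<union> \<Lambda>2)"

definition module_Sum :: "(nat \<Rightarrow> real set) \<Rightarrow> real set" where
  "module_Sum \<Lambda> = group_closure (\<Union>j. \<Lambda> j)"

text \<open>
  \<open>F\<close> is a representative of \<open>\<Sum>\<^sub>j f\<^sub>j \<chi>\<^bsub>T j\<^esub>\<close>: almost everywhere, it coincides with \<open>f j\<close> on \<open>T j\<close>.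
  When the sets \<open>T j\<close> are pairwise disjoint and cover the line up to a null set, such an \<open>F\<close>
  exists and is unique up to almost everywhere equality.
\<close>

definition piecewise_sum ::
  "(nat \<Rightarrow> real \<Rightarrow> 'a) \<Rightarrow> (nat \<Rightarrow> real set) \<Rightarrow> (real \<Rightarrow> 'a) \<Rightarrow> bool" where
  "piecewise_sum f T F \<longleftrightarrow> (AE t in lebesgue. \<forall>j. t \<in> T j \<longrightarrow> F t = f j t)"

end

theory Submission
  imports Defs "HOL-Real_Asymp.Real_Asymp"
begin

text \<open>
  For a measurable \<open>f\<close> let \<open>N\<^sub>f \<tau>\<close> be the infimum over \<open>l > 0\<close> of the distance \<open>D_dist l\<close> between
  \<open>f\<close> and its translate by \<open>\<tau>\<close>. This is a translation invariant seminorm on the line, bounded by \<open>1\<close>,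
  and \<open>f\<close> is equi-Weyl almost periodic only if \<open>N\<^sub>f\<close> is continuous at \<open>0\<close> and all its balls are
  relatively dense (\<open>weyl_seminorm_ap_seminorm\<close>). The infimum is approached uniformly: if \<open>N\<^sub>f \<tau>\<close> is small,
  then \<open>D_dist l\<close> is small for all large \<open>l\<close>, with bounds that do not depend on \<open>\<tau>\<close>
  (\<open>weyl_seminorm_uniform\<close>). Hence the \<open>f\<close>-returning sequences are those along which \<open>N\<^sub>f\<close> tends to \<open>0\<close>, and
  \<open>Mod f\<close> is the group of the frequencies of the characters that are continuous for \<open>N\<^sub>f\<close>.

  Let \<open>F\<close> be the piecewise function. The point \<open>t\<close> and its translate \<open>t + \<tau>\<close> either lie in the same \<open>T j\<close> with \<open>j \<le> n\<close>, or
  are separated by the indicator function of some \<open>T j\<close> with \<open>j \<le> n\<close>, or \<open>t\<close> lies in none of these sets. So the distance from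
  \<open>F\<close> to its translate is at most the sum of the distances for the \<open>f j\<close> and for the indicator functions of \<open>T j\<close>,
  \<open>j \<le> n\<close>, plus the density of the exceptional set, which is small for large \<open>n\<close>
  (\<open>shift_dist_piecewise_sum_le\<close>). Thus finitely many of the seminorms \<open>N k\<close> of the pieces control \<open>F\<close>
  (\<open>shift_dist_piecewise_sum_small\<close>).
  Two facts about a sequence of almost periodic seminorms \<open>N k\<close> remain: the balls of finitely many of
  them intersect in a relatively dense set, and a character that tends to \<open>1\<close> along every sequence along which all \<open>N k\<close>
  tend to \<open>0\<close> is a product of characters each of which is continuous for one \<open>N k\<close>.

  In the language of compact groups the second fact says that characters extend from a closed subgroup of a product
  of compact abelian groups to the product. Here it is proved on the line, in three steps. First, a ball of an almost
  periodic seminorm contains a Bohr set: this is Bogolyubov's theorem, proved by a Fourier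
  argument in the cyclic groups of order \<open>4 K\<close> and a passage to the limit in the frequencies
  (\<open>bogolyubov_int\<close>, \<open>ball_contains_bohr_set\<close>). The frequencies found in this way can be arbitrary.
  Second, by averaging the seminorm against a Fejer kernel
  that is concentrated on the Bohr set one approximates it by a trigonometric polynomial whose frequencies are Fourier exponents of the
  seminorm, and these belong to continuous characters (\<open>ball_contains_char_bohr_set\<close>). Third, if a character is near
  \<open>1\<close> on the Bohr set of a finite set \<open>I\<close>, its product with a Fejer kernel for \<open>I\<close> has a positive mean,
  and so its frequency lies in the group generated by \<open>I\<close>
  (\<open>char_near_one_on_bohr_set_in_group_closure\<close>). The mean of a Fejer kernel also shows that Bohr sets are relatively
  dense.
\<close>

section \<open>Mean values of trigonometric sums and Fejer kernels\<close>

lemma integral_cis_bound: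
  fixes \<nu> \<xi> T :: real
  assumes "\<nu> \<noteq> 0" "T \<ge> 0"
  shows "norm (integral {\<xi>..\<xi>+T} (\<lambda>t. cis (\<nu> * t))) \<le> 2 / \<bar>\<nu>\<bar>"
proof -
  define G where "G t = cis (\<nu> * t) / (\<i> * of_real \<nu>)" for t
  have "((\<lambda>t. cis (\<nu> * t)) has_integral (G (\<xi>+T) - G \<xi>)) {\<xi>..\<xi>+T}"
  proof (rule fundamental_theorem_of_calculus)
    fix t assume "t \<in> {\<xi>..\<xi>+T}"
    have "((\<lambda>t. exp (\<i> * of_real \<nu> * of_real t) / (\<i> * of_real \<nu>)) has_vector_derivative
             exp (\<i> * of_real \<nu> * of_real t)) (at t within {\<xi>..\<xi>+T})"
      using assms
      by (auto intro!: derivative_eq_intros has_vector_derivative_real_field simp: field_simps)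
    then show "(G has_vector_derivative cis (\<nu> * t)) (at t within {\<xi>..\<xi>+T})"
      by (simp add: G_def[abs_def] cis_conv_exp mult.assoc)
  qed (use assms in simp)
  then have "integral {\<xi>..\<xi>+T} (\<lambda>t. cis (\<nu> * t)) = G (\<xi>+T) - G \<xi>"
    by (rule integral_unique)
  also have "norm \<dots> \<le> norm (G (\<xi>+T)) + norm (G \<xi>)"
    by (rule norm_triangle_ineq4)
  also have "\<dots> = 2 / \<bar>\<nu>\<bar>"
    by (simp add: G_def norm_divide norm_mult)
  finally show ?thesis .
qed

text \<open>The mean exists uniformly in the position of the interval, at rate \<open>1 / T\<close>. The frequencies \<open>\<nu>\<close> may repeat,
  so the mean collects all indices with \<open>\<nu> g = 0\<close>.\<close>
lemma trig_sum_mean: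
  fixes c :: "'i \<Rightarrow> complex" and \<nu> :: "'i \<Rightarrow> real"
  assumes "finite J"
  obtains C where "C \<ge> 0" "\<And>\<xi> T. T > 0 \<Longrightarrow>
     norm (integral {\<xi>..\<xi>+T} (\<lambda>t. \<Sum>g\<in>J. c g * cis (\<nu> g * t)) /\<^sub>R T - (\<Sum>g | g \<in> J \<and> \<nu> g = 0. c g)) \<le> C / T"
proof
  define C where "C = (\<Sum>g\<in>J. norm (c g) * (2 / \<bar>\<nu> g\<bar>))"
  show "C \<ge> 0" unfolding C_def by (intro sum_nonneg) auto
  fix \<xi> T :: real assume T: "T > 0"
  have "integral {\<xi>..\<xi>+T} (\<lambda>t. \<Sum>g\<in>J. c g * cis (\<nu> g * t)) =
        (\<Sum>g\<in>J. c g * integral {\<xi>..\<xi>+T} (\<lambda>t. cis (\<nu> g * t)))"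
    by (subst integral_sum) (auto intro!: integrable_continuous_real continuous_intros assms)
  then have "integral {\<xi>..\<xi>+T} (\<lambda>t. \<Sum>g\<in>J. c g * cis (\<nu> g * t)) /\<^sub>R T - (\<Sum>g | g \<in> J \<and> \<nu> g = 0. c g)
    = (\<Sum>g\<in>J. c g * (integral {\<xi>..\<xi>+T} (\<lambda>t. cis (\<nu> g * t)) /\<^sub>R T - (if \<nu> g = 0 then 1 else 0)))"
    using assms by (simp add: right_diff_distrib sum_subtractf scaleR_sum_right sum.inter_filter if_distrib[of "(*) _"] cong: if_cong)
  also have "norm \<dots> \<le> (\<Sum>g\<in>J. norm (c g) * (2 / \<bar>\<nu> g\<bar>) / T)"
  proof (rule sum_norm_le)
    fix g assume "g \<in> J"
    have "norm (integral {\<xi>..\<xi>+T} (\<lambda>t. cis (\<nu> g * t)) /\<^sub>R T - (if \<nu> g = 0 then 1 else 0)) \<le> 2 / \<bar>\<nu> g\<bar> / T"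
    proof (cases "\<nu> g = 0")
      case True then show ?thesis using T by (simp add: scaleR_conv_of_real)
    next
      case False
      then show ?thesis using integral_cis_bound[OF False, of T \<xi>] T by (simp add: field_simps)
    qed
    then show "norm (c g * (integral {\<xi>..\<xi>+T} (\<lambda>t. cis (\<nu> g * t)) /\<^sub>R T - (if \<nu> g = 0 then 1 else 0)))
       \<le> norm (c g) * (2 / \<bar>\<nu> g\<bar>) / T"
      unfolding norm_mult by (metis mult_left_mono norm_ge_zero times_divide_eq_right)
  qed
  also have "\<dots> = C / T" by (simp add: C_def sum_divide_distrib)
  finally show "norm (integral {\<xi>..\<xi>+T} (\<lambda>t. \<Sum>g\<in>J. c g * cis (\<nu> g * t)) /\<^sub>R T - (\<Sum>g | g \<in> J \<and> \<nu> g = 0. c g)) \<le> C / T" .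
qed

lemma real_trig_sum_mean:
  fixes w :: "'i \<Rightarrow> real" and p :: "real \<Rightarrow> real"
  assumes J: "finite J" and p: "\<And>t. complex_of_real (p t) = (\<Sum>g\<in>J. of_real (w g) * cis (\<nu> g * t))"
  obtains C where "continuous_on UNIV p" "C \<ge> 0" "\<And>\<xi> T. T > 0 \<Longrightarrow>
     \<bar>integral {\<xi>..\<xi>+T} p / T - (\<Sum>g | g \<in> J \<and> \<nu> g = 0. w g)\<bar> \<le> C / T"
proof -
  obtain C where C: "C \<ge> 0" "\<And>\<xi> T. T > 0 \<Longrightarrow>
    norm (integral {\<xi>..\<xi>+T} (\<lambda>t. \<Sum>g\<in>J. of_real (w g) * cis (\<nu> g * t)) /\<^sub>R T - (\<Sum>g | g \<in> J \<and> \<nu> g = 0. complex_of_real (w g))) \<le> C / T"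
    using trig_sum_mean[OF J, of "\<lambda>g. of_real (w g)" \<nu>] by blast
  have "p = (\<lambda>t. Re (\<Sum>g\<in>J. of_real (w g) * cis (\<nu> g * t)))"
    using p by (metis Re_complex_of_real)
  moreover have "continuous_on UNIV (\<lambda>t. Re (\<Sum>g\<in>J. of_real (w g) * cis (\<nu> g * t)))"
    by (intro continuous_intros)
  ultimately have pc: "continuous_on UNIV p" by simp
  show thesis
  proof (rule that[OF pc C(1)])
    fix \<xi> T :: real assume T: "T > 0"
    have "p integrable_on {\<xi>..\<xi>+T}"
      by (intro integrable_continuous_real continuous_on_subset[OF pc]) auto
    then have "integral {\<xi>..\<xi>+T} (\<lambda>t. complex_of_real (p t)) = of_real (integral {\<xi>..\<xi>+T} p)"
      by (intro integral_unique has_integral_of_real integrable_integral)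
    then have "complex_of_real (integral {\<xi>..\<xi>+T} p / T - (\<Sum>g | g \<in> J \<and> \<nu> g = 0. w g)) =
        integral {\<xi>..\<xi>+T} (\<lambda>t. \<Sum>g\<in>J. of_real (w g) * cis (\<nu> g * t)) /\<^sub>R T - (\<Sum>g | g \<in> J \<and> \<nu> g = 0. of_real (w g))"
      unfolding p by (simp add: scaleR_conv_of_real field_simps)
    then show "\<bar>integral {\<xi>..\<xi>+T} p / T - (\<Sum>g | g \<in> J \<and> \<nu> g = 0. w g)\<bar> \<le> C / T"
      using C(2)[OF T, of \<xi>] by (metis norm_of_real)
  qed
qed

lemma norm_cis_minus_one_sq: "(norm (cis x - 1))\<^sup>2 = 2 - 2 * cos x"
proof -
  have "(norm (cis x - 1))\<^sup>2 = (cos x - 1)\<^sup>2 + (sin x)\<^sup>2"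
    by (simp add: cmod_power2)
  also have "\<dots> = 2 - 2 * cos x" using sin_cos_squared_add[of x] by (simp add: power2_eq_square algebra_simps)
  finally show ?thesis .
qed

lemma fejer_factor:
  fixes x :: real
  shows "complex_of_real (((1 + cos x) / 2) ^ m) =
    (\<Sum>k\<le>2*m. of_real (real ((2*m) choose k) / 4 ^ m) * cis ((real k - real m) * x))"
proof -
  have e: "complex_of_real ((1 + cos x) / 2) = cis (-x) * (cis x + 1)^2 / 4"
  proof -
    have "cis (-x) * (cis x + 1)^2 = cis x + 2 + cis (-x)"
      by (simp add: power2_eq_square algebra_simps cis_mult)
    then show ?thesis by (auto simp: complex_eq_iff field_simps)
  qed
  have "complex_of_real (((1 + cos x) / 2) ^ m) = cis (-x)^m * (cis x + 1)^(2*m) / 4^m"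
    unfolding of_real_power e by (simp add: power_divide power_mult_distrib power_mult)
  also have "(cis x + 1)^(2*m) = (\<Sum>k\<le>2*m. of_nat ((2*m) choose k) * cis x ^ k)"
    by (subst binomial_ring) simp
  also have "cis (-x)^m * (\<Sum>k\<le>2*m. of_nat ((2*m) choose k) * cis x ^ k) / 4^m
     = (\<Sum>k\<le>2*m. of_real (real ((2*m) choose k) / 4 ^ m) * cis ((real k - real m) * x))"
    unfolding sum_distrib_left sum_divide_distrib
  proof (rule sum.cong)
    fix k
    have "cis (-x)^m * cis x ^ k = cis ((real k - real m) * x)"
      unfolding Complex.DeMoivre cis_mult by (rule arg_cong[where f=cis]) (simp add: algebra_simps)
    then show "cis (-x)^m * (of_nat ((2*m) choose k) * cis x ^ k) / 4^m
        = of_real (real ((2*m) choose k) / 4 ^ m) * cis ((real k - real m) * x)"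
      by (simp add: mult.left_commute)
  qed simp
  finally show ?thesis .
qed

lemma group_closure_sum_int:
  assumes "finite I" "\<And>\<mu>. \<mu> \<in> I \<Longrightarrow> \<mu> \<in> S"
  shows "(\<Sum>\<mu>\<in>I. (real (a \<mu>) - real (b \<mu>)) * \<mu>) \<in> group_closure S"
  using assms
proof (induction I rule: finite_induct)
  case (insert \<mu> I)
  have "real (a \<mu>) * \<mu> - real (b \<mu>) * \<mu> \<in> group_closure S"
    by (intro group_closure.diff group_closure_scalar_mult_left group_closure.base) (use insert in auto)
  moreover have "(\<Sum>\<mu>\<in>I. (real (a \<mu>) - real (b \<mu>)) * \<mu>) \<in> group_closure S"
    using insert by auto
  ultimately have "(real (a \<mu>) * \<mu> - real (b \<mu>) * \<mu>) + (\<Sum>\<mu>\<in>I. (real (a \<mu>) - real (b \<mu>)) * \<mu>) \<in> group_closure S"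
    by (rule group_closure_add)
  then show ?case using insert by (simp add: left_diff_distrib)
qed simp

lemma group_closure_mono: "x \<in> group_closure S \<Longrightarrow> S \<subseteq> S' \<Longrightarrow> x \<in> group_closure S'"
  by (induction rule: group_closure.induct) (auto intro: group_closure.intros)

text \<open>
  The kernel is the product over \<open>\<mu> \<in> I\<close> of the \<open>m\<close>-th powers of \<open>(1 + cos (\<mu> t)) / 2\<close>, divided by its mean. Away from the
  Bohr set one factor is at most \<open>q ^ m\<close> with \<open>q < 1\<close>. The coefficients are nonnegative, so the mean is at least
  the coefficient of the zero choice of exponents, hence at least \<open>(2 m + 1) ^ (- card I)\<close>, whatever the rational
  relations in \<open>I\<close> are. The exponential gain wins over the polynomial loss when \<open>m\<close> is large. The index \<open>g\<close>
  of a term selects a power of \<open>cis (\<mu> t)\<close> for each \<open>\<mu> \<in> I\<close>.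
\<close>
lemma fejer_kernel:
  fixes I :: "real set"
  assumes "finite I" "0 < \<delta>" "\<delta> \<le> 1" "0 < \<epsilon>"
  obtains J :: "(real \<Rightarrow> nat) set" and w :: "(real \<Rightarrow> nat) \<Rightarrow> real" and \<nu> :: "(real \<Rightarrow> nat) \<Rightarrow> real" and p :: "real \<Rightarrow> real"
  where "finite J" "\<And>g. g \<in> J \<Longrightarrow> \<nu> g \<in> group_closure I"
    "\<And>t. complex_of_real (p t) = (\<Sum>g\<in>J. of_real (w g) * cis (\<nu> g * t))"
    "(\<Sum>g | g \<in> J \<and> \<nu> g = 0. w g) = 1"
    "\<And>t. p t \<ge> 0"
    "\<And>t \<mu>. \<mu> \<in> I \<Longrightarrow> norm (cis (\<mu> * t) - 1) \<ge> \<delta> \<Longrightarrow> p t \<le> \<epsilon>"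
proof -
  define q where "q = 1 - \<delta>\<^sup>2 / 4"
  have "\<delta>\<^sup>2 \<le> 1" using assms by (simp add: power_le_one)
  then have q: "0 < q" "q < 1" using assms by (auto simp: q_def)
  define n where "n = card I"
  have "(\<lambda>m. q ^ m * (2 * real m + 1) ^ n) \<longlonglongrightarrow> 0"
    using q by real_asymp
  then have "eventually (\<lambda>m. q ^ m * (2 * real m + 1) ^ n < \<epsilon>) sequentially"
    using assms(4) by (auto elim: order_tendstoD)
  then obtain m where m: "q ^ m * (2 * real m + 1) ^ n < \<epsilon>"
    by (auto simp: eventually_sequentially)
  define J where "J = PiE I (\<lambda>_. {..2*m})"
  define u where "u g = (\<Prod>\<mu>\<in>I. real ((2*m) choose g \<mu>) / 4^m)" for g
  define \<nu> where "\<nu> g = (\<Sum>\<mu>\<in>I. (real (g \<mu>) - real m) * \<mu>)" for g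
  define P where "P t = (\<Prod>\<mu>\<in>I. ((1 + cos (\<mu> * t)) / 2) ^ m)" for t
  have finJ: "finite J" unfolding J_def using assms(1) by (intro finite_PiE) auto
  have P: "complex_of_real (P t) = (\<Sum>g\<in>J. of_real (u g) * cis (\<nu> g * t))" for t
  proof -
    have cs: "(\<Prod>\<mu>\<in>I. cis (a \<mu>)) = cis (\<Sum>\<mu>\<in>I. a \<mu>)" for a
      using assms(1) by (induction I rule: finite_induct) (auto simp: cis_mult)
    have "complex_of_real (P t) = (\<Prod>\<mu>\<in>I. (\<Sum>k\<le>2*m. of_real (real ((2*m) choose k) / 4 ^ m) * cis ((real k - real m) * (\<mu> * t))))"
      unfolding P_def of_real_prod fejer_factor ..
    also have "\<dots> = (\<Sum>g\<in>J. \<Prod>\<mu>\<in>I. of_real (real ((2*m) choose (g \<mu>)) / 4 ^ m) * cis ((real (g \<mu>) - real m) * (\<mu> * t)))"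
      unfolding J_def using assms(1) by (intro prod_sum_PiE) auto
    also have "\<dots> = (\<Sum>g\<in>J. of_real (u g) * cis (\<nu> g * t))"
      unfolding prod.distrib cs u_def \<nu>_def of_real_prod sum_distrib_right mult.assoc ..
    finally show ?thesis .
  qed
  define M where "M = (\<Sum>g | g \<in> J \<and> \<nu> g = 0. u g)"
  have u0: "u g \<ge> 0" for g unfolding u_def by (intro prod_nonneg) auto
  have M: "M \<ge> 1 / (2 * real m + 1) ^ n"
  proof -
    \<comment> \<open>The middle binomial term of each factor: a constant term of the product.\<close>
    define g0 where "g0 = (\<lambda>\<mu>. if \<mu> \<in> I then m else undefined)"
    have g0: "g0 \<in> {g. g \<in> J \<and> \<nu> g = 0}"
      by (auto simp: g0_def J_def \<nu>_def PiE_def extensional_def)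
    have lb: "real ((2*m) choose m) / 4^m \<ge> 1 / (2 * real m + 1)"
    proof -
      have "4 ^ m = (\<Sum>k\<le>2*m. (2*m) choose k)" using choose_row_sum[of "2*m"] by (simp add: power_mult)
      also have "\<dots> \<le> (\<Sum>k\<le>2*m. (2*m) choose m)" by (intro sum_mono binomial_maximum')
      finally have "real (4 ^ m) \<le> real ((2*m+1) * ((2*m) choose m))" by (simp only: of_nat_le_iff) simp
      then show ?thesis by (simp add: field_simps)
    qed
    have "1 / (2 * real m + 1) ^ n = (\<Prod>\<mu>\<in>I. 1 / (2 * real m + 1))" by (simp add: n_def power_one_over)
    also have "\<dots> \<le> (\<Prod>\<mu>\<in>I. real ((2*m) choose m) / 4^m)" by (intro prod_mono) (use lb in auto)
    also have "\<dots> = u g0" by (simp add: u_def g0_def)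
    also have "\<dots> \<le> M" unfolding M_def using finJ g0 u0 by (intro member_le_sum) auto
    finally show ?thesis .
  qed
  have M0: "M > 0" using M by (rule less_le_trans[rotated]) auto
  have fac: "0 \<le> (1 + cos x) / 2" "(1 + cos x) / 2 \<le> 1" for x :: real
  proof -
    have nn: "0 \<le> (1 + y) / 2" if "-1 \<le> y" for y :: real using that by simp
    show "0 \<le> (1 + cos x) / 2" by (rule nn[OF cos_ge_minus_one])
    have "(1 + y) / 2 \<le> 1" if "y \<le> 1" for y :: real using that by simp
    from this[OF cos_le_one] show "(1 + cos x) / 2 \<le> 1" .
  qed
  show thesis
  proof (rule that[of J \<nu> "\<lambda>t. P t / M" "\<lambda>g. u g / M"])
    show "\<nu> g \<in> group_closure I" for g
      unfolding \<nu>_def using assms(1) by (rule group_closure_sum_int) auto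
    show "complex_of_real (P t / M) = (\<Sum>g\<in>J. of_real (u g / M) * cis (\<nu> g * t))" for t
      by (simp add: P sum_divide_distrib)
    show "(\<Sum>g | g \<in> J \<and> \<nu> g = 0. u g / M) = 1"
      using M0 by (simp add: M_def flip: sum_divide_distrib)
    show "P t / M \<ge> 0" for t using M0 fac by (auto simp: P_def intro!: divide_nonneg_pos prod_nonneg)
    fix t \<mu> assume \<mu>: "\<mu> \<in> I" "\<delta> \<le> cmod (cis (\<mu> * t) - 1)"
    have "\<delta>\<^sup>2 \<le> 2 - 2 * cos (\<mu> * t)"
      using \<mu>(2) assms(2) by (subst norm_cis_minus_one_sq[symmetric]) (intro power_mono, auto)
    then have le_q: "(1 + cos (\<mu> * t)) / 2 \<le> q" by (simp add: q_def)
    have "P t = ((1 + cos (\<mu> * t)) / 2) ^ m * (\<Prod>\<mu>\<in>I-{\<mu>}. ((1 + cos (\<mu> * t)) / 2) ^ m)"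
      unfolding P_def using assms(1) \<mu>(1) by (rule prod.remove)
    also have "\<dots> \<le> q ^ m * 1"
      using le_q fac by (intro mult_mono power_mono prod_le_1 prod_nonneg) (use q in \<open>auto intro!: power_le_one zero_le_power\<close>)
    finally have "P t \<le> q ^ m" by simp
    then have "P t / M \<le> q ^ m / M" using M0 by (intro divide_right_mono) auto
    also have "\<dots> \<le> q ^ m / (1 / (2 * real m + 1) ^ n)"
      using M q by (intro divide_left_mono) (simp_all add: M0)
    also have "\<dots> < \<epsilon>" using m by simp
    finally show "P t / M \<le> \<epsilon>" by simp
  qed (fact finJ)
qed

section \<open>Bogolyubov's theorem for syndetic sets of integers\<close>

lemma common_convergent_subseq:
  fixes f :: "'i \<Rightarrow> nat \<Rightarrow> 'a::heine_borel"
  assumes "finite J" "\<And>g. g \<in> J \<Longrightarrow> bounded (range (f g))"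
  obtains r :: "nat \<Rightarrow> nat" and l :: "'i \<Rightarrow> 'a" where "strict_mono r" "\<And>g. g \<in> J \<Longrightarrow> (\<lambda>m. f g (r m)) \<longlonglongrightarrow> l g"
proof -
  have "\<exists>r::nat\<Rightarrow>nat. \<exists>l. strict_mono r \<and> (\<forall>g\<in>J. (\<lambda>m. f g (r m)) \<longlonglongrightarrow> l g)"
    using assms
  proof (induction J rule: finite_induct)
    case empty
    show ?case by (intro exI[of _ id]) (auto simp: strict_mono_def)
  next
    case (insert h J)
    then obtain r l where r: "strict_mono (r::nat\<Rightarrow>nat)" "\<forall>g\<in>J. (\<lambda>m. f g (r m)) \<longlonglongrightarrow> l g" by auto
    have "bounded (range (\<lambda>m. f h (r m)))"
      using insert.prems[of h] by (rule bounded_subset) auto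
    then obtain l' r' where r': "strict_mono (r'::nat\<Rightarrow>nat)" "((\<lambda>m. f h (r m)) \<circ> r') \<longlonglongrightarrow> l'"
      using bounded_imp_convergent_subsequence by blast
    show ?case
    proof (intro exI conjI ballI)
      show "strict_mono (r \<circ> r')" using r(1) r'(1) by (rule strict_mono_o)
      fix g assume "g \<in> insert h J"
      then show "(\<lambda>m. f g ((r \<circ> r') m)) \<longlonglongrightarrow> (if g = h then l' else l g)"
        using r' r(2) LIMSEQ_subseq_LIMSEQ[of "\<lambda>m. f g (r m)" "l g" r'] by (auto simp: o_def)
    qed
  qed
  then show ?thesis using that by auto
qed

lemma sum_roots_of_unity:
  fixes y :: int and M :: nat
  assumes "\<bar>y\<bar> < int M"
  shows "(\<Sum>r<M. cis (2 * pi * (real r * of_int y) / real M)) = (if y = 0 then of_nat M else 0)"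
proof (cases "y = 0")
  case False
  have M: "M > 0" using assms by auto
  define z where "z = cis (2 * pi * of_int y / real M)"
  have "z \<noteq> 1"
  proof
    assume "z = 1"
    then have "cos (2 * pi * of_int y / real M) = 1" by (simp add: z_def complex_eq_iff)
    then obtain n :: int where "2 * pi * of_int y / real M = of_int n * 2 * pi"
      using cos_one_2pi_int by blast
    then have "of_int y = (of_int (n * int M) :: real)" using M by (simp add: field_simps)
    then have "y = n * int M" by (simp only: of_int_eq_iff)
    then have "int M dvd y" by simp
    then show False using assms False zdvd_imp_le[of "int M" "\<bar>y\<bar>"] by simp
  qed
  have "(\<Sum>r<M. cis (2 * pi * (real r * of_int y) / real M)) = (\<Sum>r<M. z ^ r)"
    by (simp add: z_def Complex.DeMoivre mult_ac)
  also have "\<dots> = (z ^ M - 1) / (z - 1)" using \<open>z \<noteq> 1\<close> by (rule geometric_sum)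
  also have "z ^ M = 1" using M by (simp add: z_def Complex.DeMoivre)
  finally show ?thesis using False by simp
qed simp

text \<open>
  Let \<open>H\<close> be the Fourier transform of \<open>B\<close> in the cyclic group of order \<open>M = 4 K\<close>. As \<open>B\<close> lies in an interval of length
  \<open>K\<close> and \<open>\<bar>x\<bar> < 2 K\<close>, a relation \<open>x = a + b - c - d\<close> modulo \<open>M\<close> is one in the integers, so that \<open>x\<close> is not
  represented iff the sum of \<open>\<bar>H r\<bar>^4 cis (- 2 \<pi> r x / M)\<close> vanishes. The large Fourier coefficients are few by
  Parseval's identity and, if the cosines are nonnegative there, contribute at least the term \<open>(card B)^4\<close> of \<open>r = 0\<close>. The small ones
  contribute at most half of that. It matters for the limit that the number of frequencies depends only on the gap \<open>g\<close>.
\<close>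
lemma bogolyubov_finite:
  fixes B :: "int set" and K g :: nat
  assumes B: "B \<subseteq> {0..<int K}" and dens: "K \<le> g * card B" and K: "K > 0"
  obtains e :: "nat \<Rightarrow> nat" where "\<And>i. e i < 4 * K"
    "\<And>x::int. \<bar>x\<bar> < 2 * int K \<Longrightarrow> (\<forall>i<32*g\<^sup>2. 0 \<le> cos (2 * pi * (real (e i) * of_int x) / real (4 * K)))
       \<Longrightarrow> \<exists>a\<in>B. \<exists>b\<in>B. \<exists>c\<in>B. \<exists>d\<in>B. x = a + b - c - d"
proof -
  define M where "M = 4 * K"
  define E where "E r y = cis (2 * pi * (real r * of_int y) / real M)" for r and y :: int
  define H where "H r = (\<Sum>n\<in>B. E r n)" for r
  define b where "b = real (card B)"
  have finB: "finite B" using B finite_subset by blast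
  have b0: "b > 0" using dens K by (auto simp: b_def intro!: Nat.gr0I)
  have g0: "g > 0" using dens K by (auto intro!: Nat.gr0I)
  have MK: "real M \<le> 4 * real g * b"
    using dens unfolding M_def b_def by (metis (mono_tags, opaque_lifting) mult.assoc mult_le_mono2 of_nat_le_iff of_nat_mult of_nat_numeral)
  have E_add: "E r (x + y) = E r x * E r y" for r x y
    by (simp add: E_def cis_mult add_divide_distrib ring_distribs)
  have E_neg: "E r (-x) = cnj (E r x)" for r x
    by (simp add: E_def cis_cnj)
  have E_sum: "(\<Sum>r<M. E r y) = (if y = 0 then of_nat M else 0)" if "\<bar>y\<bar> < int M" for y
    unfolding E_def using that by (rule sum_roots_of_unity)
  have HH: "H r * H r = (\<Sum>p\<in>B\<times>B. E r (fst p + snd p))" for r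
    by (simp add: H_def sum_product sum.cartesian_product E_add split_beta)
  have parseval: "(\<Sum>r<M. (norm (H r))\<^sup>2) = real M * b"
  proof -
    have "complex_of_real (\<Sum>r<M. (norm (H r))\<^sup>2) = (\<Sum>r<M. \<Sum>n\<in>B. \<Sum>n'\<in>B. E r (n - n'))"
      unfolding of_real_sum complex_norm_square H_def cnj_sum sum_product
      by (simp only: diff_conv_add_uminus E_add E_neg)
    also have "\<dots> = (\<Sum>n\<in>B. \<Sum>n'\<in>B. \<Sum>r<M. E r (n - n'))"
      by (subst sum.swap, intro sum.cong refl, subst sum.swap, rule refl)
    also have "\<dots> = (\<Sum>n\<in>B. \<Sum>n'\<in>B. if n' = n then of_nat M else 0)"
    proof (intro sum.cong refl)
      fix n n' assume "n \<in> B" "n' \<in> B"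
      then have "n \<in> {0..<int K}" "n' \<in> {0..<int K}" using B by blast+
      then have "\<bar>n - n'\<bar> < int M" by (auto simp: M_def)
      then show "(\<Sum>r<M. E r (n - n')) = (if n' = n then of_nat M else 0)" using E_sum by auto
    qed
    also have "\<dots> = complex_of_real (real M * b)"
      using finB by (simp add: b_def)
    finally show ?thesis by (simp only: of_real_eq_iff)
  qed
  \<comment> \<open>The threshold makes the sum over the complement of \<open>R\<close> at most half of the term \<open>r = 0\<close>.\<close>
  define R where "R = {r. r < M \<and> (norm (H r))\<^sup>2 \<ge> b\<^sup>2 / (8 * real g)}"
  have finR: "finite R" by (simp add: R_def)
  have H0: "H 0 = of_real b" by (simp add: H_def E_def b_def)
  have "card R \<le> 32 * g\<^sup>2"
  proof -
    have "real (card R) * (b\<^sup>2 / (8 * real g)) = (\<Sum>r\<in>R. b\<^sup>2 / (8 * real g))" by simp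
    also have "\<dots> \<le> (\<Sum>r\<in>R. (norm (H r))\<^sup>2)" by (intro sum_mono) (simp add: R_def)
    also have "\<dots> \<le> (\<Sum>r<M. (norm (H r))\<^sup>2)" by (intro sum_mono2) (auto simp: R_def)
    also have "\<dots> \<le> 4 * real g * b * b" unfolding parseval using MK b0 by (intro mult_right_mono) auto
    finally have "real (card R) * b\<^sup>2 \<le> 32 * (real g)\<^sup>2 * b\<^sup>2" using g0 by (simp add: field_simps power2_eq_square)
    then have "real (card R) \<le> 32 * (real g)\<^sup>2" using b0 by simp
    also have "\<dots> = real (32 * g\<^sup>2)" by simp
    finally show ?thesis by (simp only: of_nat_le_iff)
  qed
  obtain e0 where e0: "bij_betw e0 {0..<card R} R" using finR ex_bij_betw_nat_finite by blast
  define e where "e i = (if i < card R then e0 i else 0)" for i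
  have e_R: "\<exists>i<32*g\<^sup>2. e i = r" if "r \<in> R" for r
  proof -
    have "r \<in> e0 ` {0..<card R}" using e0 that by (simp add: bij_betw_def)
    then obtain i where "i < card R" "e0 i = r" by auto
    then show ?thesis using \<open>card R \<le> 32 * g\<^sup>2\<close> by (intro exI[of _ i]) (auto simp: e_def)
  qed
  show thesis
  proof
    show "e i < 4 * K" for i
      using e0 K by (auto simp: e_def bij_betw_def R_def M_def)
    fix x :: int
    assume x: "\<bar>x\<bar> < 2 * int K" and pos: "\<forall>i<32*g\<^sup>2. 0 \<le> cos (2 * pi * (real (e i) * of_int x) / real (4 * K))"
    have posR: "0 \<le> Re (E r (-x))" if "r \<in> R" for r
      using pos e_R[OF that] by (auto simp: E_def M_def)
    show "\<exists>a\<in>B. \<exists>b\<in>B. \<exists>c\<in>B. \<exists>d\<in>B. x = a + b - c - d"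
    proof (rule ccontr)
      assume neg: "\<not> ?thesis"
      have "(\<Sum>r<M. complex_of_real ((norm (H r))\<^sup>2 ^ 2) * E r (-x)) = (\<Sum>r<M. \<Sum>p\<in>B\<times>B. \<Sum>q\<in>B\<times>B. E r (fst p + snd p - (fst q + snd q) - x))"
      proof (intro sum.cong refl)
        fix r
        have "complex_of_real ((norm (H r))\<^sup>2 ^ 2) = (complex_of_real ((norm (H r))\<^sup>2))\<^sup>2" by (rule of_real_power)
        also have "\<dots> = (H r * H r) * cnj (H r * H r)"
          unfolding complex_norm_square by (simp add: power2_eq_square mult_ac)
        finally have "complex_of_real ((norm (H r))\<^sup>2 ^ 2) = (H r * H r) * cnj (H r * H r)" .
        then show "complex_of_real ((norm (H r))\<^sup>2 ^ 2) * E r (-x) = (\<Sum>p\<in>B\<times>B. \<Sum>q\<in>B\<times>B. E r (fst p + snd p - (fst q + snd q) - x))"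
          by (simp only: HH cnj_sum sum_distrib_left sum_distrib_right mult.assoc
              diff_conv_add_uminus E_add E_neg minus_add_distrib complex_cnj_mult) (rule sum.swap)
      qed
      also have "\<dots> = (\<Sum>p\<in>B\<times>B. \<Sum>q\<in>B\<times>B. \<Sum>r<M. E r (fst p + snd p - (fst q + snd q) - x))"
        by (subst sum.swap, intro sum.cong refl, subst sum.swap, rule refl)
      also have "\<dots> = 0"
      proof (rule sum.neutral, rule ballI, rule sum.neutral, rule ballI)
        fix p q assume "p \<in> B \<times> B" "q \<in> B \<times> B"
        then obtain a b c d where pq: "p = (a,b)" "q = (c,d)" "a \<in> B" "b \<in> B" "c \<in> B" "d \<in> B" by auto
        then have "0 \<le> a" "a < K" "0 \<le> b" "b < K" "0 \<le> c" "c < K" "0 \<le> d" "d < K" using B by auto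
        then have "\<bar>a + b - (c + d) - x\<bar> < int M" using x by (auto simp: M_def)
        moreover have "a + b - (c + d) - x \<noteq> 0" using neg pq by force
        ultimately show "(\<Sum>r<M. E r (fst p + snd p - (fst q + snd q) - x)) = 0"
          using E_sum pq by auto
      qed
      finally have "Re (\<Sum>r<M. complex_of_real ((norm (H r))\<^sup>2 ^ 2) * E r (-x)) = 0" by simp
      then have zero: "(\<Sum>r<M. (norm (H r))\<^sup>2 ^ 2 * Re (E r (-x))) = 0" by simp
      have M0: "M > 0" using K by (simp add: M_def)
      have "0 \<in> R" using b0 g0 M0 by (simp add: R_def H0 field_simps)
      have "(\<Sum>r<M. (norm (H r))\<^sup>2 ^ 2 * Re (E r (-x))) \<ge> (\<Sum>r<M. (if r = 0 then b^4 else 0) - b\<^sup>2 / (8 * real g) * (norm (H r))\<^sup>2 * (if r \<in> R then 0 else 1))"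
      proof (rule sum_mono)
        fix r assume "r \<in> {..<M}"
        consider "r = 0" | "r \<in> R" "r \<noteq> 0" | "r \<notin> R" "r \<noteq> 0" by auto
        then show "(if r = 0 then b^4 else 0) - b\<^sup>2 / (8 * real g) * (norm (H r))\<^sup>2 * (if r \<in> R then 0 else 1)
           \<le> (norm (H r))\<^sup>2 ^ 2 * Re (E r (-x))"
        proof cases
          case 1 then show ?thesis using \<open>0 \<in> R\<close> by (simp add: H0 E_def)
        next
          case 2 then show ?thesis using posR[of r] by simp
        next
          case 3
          then have "(norm (H r))\<^sup>2 \<le> b\<^sup>2 / (8 * real g)" using \<open>r \<in> {..<M}\<close> by (auto simp: R_def)
          then have "(norm (H r))\<^sup>2 * (norm (H r))\<^sup>2 \<le> b\<^sup>2 / (8 * real g) * (norm (H r))\<^sup>2"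
            by (intro mult_right_mono) auto
          moreover have "- ((norm (H r))\<^sup>2 ^ 2) \<le> (norm (H r))\<^sup>2 ^ 2 * Re (E r (-x))"
            using mult_left_mono[of "-1" "Re (E r (-x))" "(norm (H r))\<^sup>2 ^ 2"] by (simp add: E_def)
          ultimately show ?thesis using 3 by (simp add: power2_eq_square)
        qed
      qed
      moreover have "(\<Sum>r<M. (if r = 0 then b^4 else 0)) = b^4" using M0 by simp
      ultimately have "b^4 \<le> (\<Sum>r<M. b\<^sup>2 / (8 * real g) * (norm (H r))\<^sup>2 * (if r \<in> R then 0 else 1))"
        unfolding zero sum_subtractf by linarith
      also have "\<dots> \<le> (\<Sum>r<M. b\<^sup>2 / (8 * real g) * (norm (H r))\<^sup>2)"
        by (rule sum_mono) auto
      also have "\<dots> = b\<^sup>2 / (8 * real g) * (real M * b)"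
        by (simp only: parseval flip: sum_distrib_left)
      also have "\<dots> \<le> b\<^sup>2 / (8 * real g) * (4 * real g * b * b)"
        using MK b0 by (intro mult_left_mono mult_right_mono) auto
      also have "\<dots> = b^4 / 2"
        using g0 by (simp add: power4_eq_xxxx power2_eq_square)
      finally have "b^4 \<le> b^4 / 2" .
      then show False using b0 by simp
    qed
  qed
qed

text \<open>
  The finite statement is applied to \<open>A \<inter> {0..<K}\<close> with \<open>K\<close> tending to infinity; a subsequence of the tuples of
  frequencies converges. Strict positivity of the cosines at the limit frequencies gives positivity at late stages.
\<close>
lemma bogolyubov_int:
  fixes A :: "int set" and g :: nat
  assumes syn: "\<And>z. \<exists>n\<in>A. z \<le> n \<and> n < z + int g"
  obtains \<Theta> :: "real set" where "finite \<Theta>"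
    "\<And>x::int. (\<forall>\<theta>\<in>\<Theta>. 0 < cos (\<theta> * of_int x)) \<Longrightarrow> \<exists>a\<in>A. \<exists>b\<in>A. \<exists>c\<in>A. \<exists>d\<in>A. x = a + b - c - d"
proof -
  have g0: "g > 0" using syn[of 0] by auto
  define k where "k = 32 * g\<^sup>2"
  define K where "K m = g * Suc m" for m
  define B where "B m = A \<inter> {0..<int (K m)}" for m
  have dens: "K m \<le> g * card (B m)" for m
  proof -
    obtain s where s: "\<And>z. s z \<in> A \<and> z \<le> s z \<and> s z < z + int g" using syn by metis
    have "inj_on (\<lambda>i. s (int g * int i)) {..<Suc m}"
    proof (rule linorder_inj_onI)
      fix i j :: nat assume "i < j"
      then have "int g * int i + int g \<le> int g * int j"
        by (metis Suc_leI distrib_left mult.right_neutral mult_left_mono of_nat_0_le_iff of_nat_Suc of_nat_le_iff add.commute)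
      then show "s (int g * int i) \<noteq> s (int g * int j)" using s[of "int g * int i"] s[of "int g * int j"] by auto
    qed auto
    moreover have "(\<lambda>i. s (int g * int i)) ` {..<Suc m} \<subseteq> B m"
    proof safe
      fix i :: nat assume "i < Suc m"
      then have "int g * int i + int g \<le> int g * int (Suc m)"
        by (metis Suc_leI distrib_left mult.right_neutral mult_left_mono of_nat_0_le_iff of_nat_Suc of_nat_le_iff add.commute)
      moreover have "0 \<le> int g * int i" by simp
      ultimately have "0 \<le> s (int g * int i)" "s (int g * int i) < int g * int (Suc m)"
        using s[of "int g * int i"] by linarith+
      then show "s (int g * int i) \<in> B m" using s unfolding B_def K_def by (simp del: mult_Suc_right of_nat_Suc)
    qed
    ultimately have "card {..<Suc m} \<le> card (B m)" by (intro card_inj_on_le) (auto simp: B_def)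
    then show ?thesis by (simp add: K_def del: mult_Suc_right)
  qed
  have "\<exists>e. \<forall>m. (\<forall>i. e m i < 4 * K m) \<and> (\<forall>x::int. \<bar>x\<bar> < 2 * int (K m) \<longrightarrow>
      (\<forall>i<k. 0 \<le> cos (2 * pi * (real (e m i) * of_int x) / real (4 * K m))) \<longrightarrow>
      (\<exists>a\<in>B m. \<exists>b\<in>B m. \<exists>c\<in>B m. \<exists>d\<in>B m. x = a + b - c - d))"
  proof (rule choice, rule allI)
    fix m
    have "B m \<subseteq> {0..<int (K m)}" by (auto simp: B_def)
    moreover have "K m > 0" using g0 by (simp add: K_def)
    ultimately show "\<exists>e. (\<forall>i. e i < 4 * K m) \<and> (\<forall>x::int. \<bar>x\<bar> < 2 * int (K m) \<longrightarrow>
      (\<forall>i<k. 0 \<le> cos (2 * pi * (real (e i) * of_int x) / real (4 * K m))) \<longrightarrow>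
      (\<exists>a\<in>B m. \<exists>b\<in>B m. \<exists>c\<in>B m. \<exists>d\<in>B m. x = a + b - c - d))"
      using bogolyubov_finite[OF _ dens, of m] unfolding k_def by metis
  qed
  then obtain e where e: "\<And>m i. e m i < 4 * K m" and eB: "\<And>m x. \<lbrakk>\<bar>x\<bar> < 2 * int (K m);
      \<forall>i<k. 0 \<le> cos (2 * pi * (real (e m i) * of_int x) / real (4 * K m))\<rbrakk> \<Longrightarrow>
      \<exists>a\<in>B m. \<exists>b\<in>B m. \<exists>c\<in>B m. \<exists>d\<in>B m. x = a + b - c - d" by metis
  define th where "th i m = 2 * pi * real (e m i) / real (4 * K m)" for i m
  have "bounded (range (th i))" for i
  proof (rule boundedI)
    fix y assume "y \<in> range (th i)"
    then obtain m where y: "y = th i m" by auto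
    have "real (e m i) / real (4 * K m) \<le> 1" using e[of m i] by (simp add: divide_simps)
    then have "2 * pi * (real (e m i) / real (4 * K m)) \<le> 2 * pi * 1" by (intro mult_left_mono) auto
    then show "norm y \<le> 2 * pi" by (simp add: y th_def)
  qed
  then obtain r :: "nat \<Rightarrow> nat" and l where r: "strict_mono r" and l: "\<And>i. i \<in> {..<k} \<Longrightarrow> (\<lambda>m. th i (r m)) \<longlonglongrightarrow> l i"
    by (rule common_convergent_subseq[of "{..<k}" th, rotated]) auto
  show thesis
  proof
    show "finite (l ` {..<k})" by simp
    fix x :: int assume x: "\<forall>\<theta>\<in>l ` {..<k}. 0 < cos (\<theta> * of_int x)"
    have "eventually (\<lambda>m. 0 < cos (th i (r m) * of_int x)) sequentially" if "i < k" for i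
    proof -
      have "(\<lambda>m. cos (th i (r m) * of_int x)) \<longlonglongrightarrow> cos (l i * of_int x)"
        using l that by (intro tendsto_intros) auto
      then show ?thesis using x that by (intro order_tendstoD) auto
    qed
    then have "eventually (\<lambda>m. \<forall>i\<in>{..<k}. 0 < cos (th i (r m) * of_int x)) sequentially"
      by (intro eventually_ball_finite) auto
    moreover have "eventually (\<lambda>m. nat \<bar>x\<bar> \<le> m) sequentially" by (rule eventually_ge_at_top)
    ultimately have "eventually (\<lambda>m. (\<forall>i\<in>{..<k}. 0 < cos (th i (r m) * of_int x)) \<and> nat \<bar>x\<bar> \<le> m) sequentially"
      by (rule eventually_conj)
    then obtain m where m: "\<forall>i<k. 0 < cos (th i (r m) * of_int x)" "nat \<bar>x\<bar> \<le> m"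
      by (auto simp: eventually_sequentially)
    have "m \<le> r m" using r by (rule seq_suble)
    also have "r m < K (r m)" using g0 by (cases g) (auto simp: K_def)
    finally have "\<bar>x\<bar> < 2 * int (K (r m))" using m(2) by linarith
    moreover have "\<forall>i<k. 0 \<le> cos (2 * pi * (real (e (r m) i) * of_int x) / real (4 * K (r m)))"
    proof safe
      fix i assume "i < k"
      moreover have "2 * pi * (real (e (r m) i) * of_int x) / real (4 * K (r m)) = th i (r m) * of_int x"
        by (simp add: th_def)
      ultimately show "0 \<le> cos (2 * pi * (real (e (r m) i) * of_int x) / real (4 * K (r m)))"
        using m(1) by (simp only: less_imp_le)
    qed
    ultimately have "\<exists>a\<in>B (r m). \<exists>b\<in>B (r m). \<exists>c\<in>B (r m). \<exists>d\<in>B (r m). x = a + b - c - d" by (rule eB)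
    then show "\<exists>a\<in>A. \<exists>b\<in>A. \<exists>c\<in>A. \<exists>d\<in>A. x = a + b - c - d" by (auto simp: B_def)
  qed
qed

section \<open>Almost periodic seminorms and their continuous characters\<close>

text \<open>
  These are the seminorms for which the completion of the line is a compact group; its characters
  restrict to the \<open>N\<close>-continuous characters of the line, given below by their frequencies.
\<close>
definition ap_seminorm :: "(real \<Rightarrow> real) \<Rightarrow> bool" where
  "ap_seminorm N \<longleftrightarrow> N 0 = 0 \<and> (\<forall>x. N (-x) = N x) \<and> (\<forall>x y. N (x + y) \<le> N x + N y) \<and>
     isCont N 0 \<and> (\<forall>\<epsilon>>0. relatively_dense {t. N t < \<epsilon>})"

definition bohr_set :: "real set \<Rightarrow> real \<Rightarrow> real set" where
  "bohr_set I \<delta> = {t. \<forall>\<mu>\<in>I. norm (cis (\<mu> * t) - 1) < \<delta>}"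

definition continuous_chars :: "(real \<Rightarrow> real) \<Rightarrow> real set" where
  "continuous_chars N = {\<mu>. \<forall>\<tau> :: nat \<Rightarrow> real. (\<lambda>j. N (\<tau> j)) \<longlonglongrightarrow> 0 \<longrightarrow> (\<lambda>j. cis (\<mu> * \<tau> j)) \<longlonglongrightarrow> 1}"

lemma cis_close_to_one:
  assumes "\<eta> > 0"
  obtains \<delta> where "\<delta> > 0" "\<And>y. norm (cis (2 * pi * y) - 1) < \<delta> \<Longrightarrow> \<exists>n::int. \<bar>y - of_int n\<bar> < \<eta>"
proof -
  have "isCont Ln 1" by (rule continuous_at_Ln) auto
  moreover have "2 * pi * \<eta> > 0" using assms by simp
  ultimately have "\<exists>\<delta>>0. \<forall>z. dist z 1 < \<delta> \<longrightarrow> dist (Ln z) (Ln 1) < 2 * pi * \<eta>"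
    unfolding continuous_at_eps_delta by blast
  then obtain \<delta> where \<delta>: "\<delta> > 0" "\<And>z. dist z 1 < \<delta> \<Longrightarrow> norm (Ln z) < 2 * pi * \<eta>"
    by auto
  show thesis
  proof (rule that[OF \<delta>(1)])
    fix y assume y: "norm (cis (2 * pi * y) - 1) < \<delta>"
    define a where "a = Arg (cis (2 * pi * y))"
    have "\<bar>a\<bar> \<le> norm (Ln (cis (2 * pi * y)))"
      unfolding a_def by (subst Arg_eq_Im_Ln) (auto intro: abs_Im_le_cmod)
    also have "\<dots> < 2 * pi * \<eta>" by (rule \<delta>) (use y in \<open>simp add: dist_norm\<close>)
    finally have a: "\<bar>a\<bar> < 2 * pi * \<eta>" .
    have "cis a = cis (2 * pi * y)" unfolding a_def by (subst cis_Arg) auto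
    then obtain n :: int where "2 * pi * y = a + 2 * pi * n"
      using sin_cos_eq_iff[of "2*pi*y" a] by (auto simp: complex_eq_iff)
    then have "2 * pi * (y - of_int n) = a" by (simp add: algebra_simps)
    then have "2 * pi * \<bar>y - of_int n\<bar> < 2 * pi * \<eta>" using a by (auto simp flip: abs_mult) (simp add: abs_mult)
    then show "\<exists>n::int. \<bar>y - of_int n\<bar> < \<eta>" by (auto simp: mult_less_cancel_left_pos)
  qed
qed

lemma integral_shift_diff_bound:
  fixes G :: "real \<Rightarrow> complex"
  assumes G: "continuous_on UNIV G" and b: "\<And>x. norm (G x) \<le> b" and "T \<ge> 0"
  shows "norm (integral {x..x+T} G - integral {y..y+T} G) \<le> 2 * b * \<bar>x - y\<bar>"
proof -
  have *: "norm (integral {x..x+T} G - integral {y..y+T} G) \<le> 2 * b * (y - x)" if "x \<le> y" for x y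
  proof -
    have i: "G integrable_on {u..v}" for u v
      by (intro integrable_continuous_real continuous_on_subset[OF G]) auto
    have 1: "integral {x..y} G + integral {y..y+T} G = integral {x..y+T} G"
      using that assms by (intro Henstock_Kurzweil_Integration.integral_combine i) auto
    have 2: "integral {x..x+T} G + integral {x+T..y+T} G = integral {x..y+T} G"
      using that assms by (intro Henstock_Kurzweil_Integration.integral_combine i) auto
    have e: "integral {x..x+T} G - integral {y..y+T} G = integral {x..y} G - integral {x+T..y+T} G"
      using arg_cong2[OF 1 2, of "(-)"] by (simp add: algebra_simps)
    have B: "norm (integral {u..v} G) \<le> b * (v - u)" if "u \<le> v" for u v
      using integral_bound[OF that continuous_on_subset[OF G] b] by auto
    show ?thesis unfolding e
      using norm_triangle_ineq4[of "integral {x..y} G" "integral {x+T..y+T} G"] B[of x y] B[of "x+T" "y+T"] that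
      by (auto simp: algebra_simps)
  qed
  show ?thesis
    using *[of x y] *[of y x] by (cases "x \<le> y") (auto simp: norm_minus_commute abs_real_def)
qed

context
  fixes N :: "real \<Rightarrow> real"
  assumes N: "ap_seminorm N"
begin

lemma ap_zero: "N 0 = 0" and ap_minus: "N (-x) = N x" and ap_add: "N (x + y) \<le> N x + N y"
  and ap_isCont_0: "isCont N 0" and ap_rel_dense: "\<epsilon> > 0 \<Longrightarrow> relatively_dense {t. N t < \<epsilon>}"
  using N unfolding ap_seminorm_def by auto

lemma ap_diff: "N (x - y) \<le> N x + N y"
  using ap_add[of x "-y"] by (simp add: ap_minus)

lemma ap_nonneg: "N x \<ge> 0"
  using ap_diff[of x x] by (simp add: ap_zero)

lemma ap_small:
  assumes "\<epsilon> > 0"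
  obtains h where "h > 0" "\<And>s. \<bar>s\<bar> < h \<Longrightarrow> N s < \<epsilon>"
proof -
  obtain h where h: "h > 0" "\<And>s. \<bar>s\<bar> < h \<Longrightarrow> \<bar>N s\<bar> < \<epsilon>"
    using ap_isCont_0 assms unfolding continuous_at_real_range by (auto simp: ap_zero)
  show thesis by (rule that[OF h(1)]) (use h(2) in force)
qed

lemma ap_abs_diff: "\<bar>N x - N y\<bar> \<le> N (x - y)"
  using ap_add[of y "x - y"] ap_add[of x "y - x"] ap_minus[of "x - y"] by (simp add: abs_le_iff)

lemma ap_continuous: "continuous_on S N"
proof -
  have "isCont N x" for x
    unfolding isCont_def LIM_eq
  proof safe
    fix r :: real assume "r > 0"
    then obtain s where s: "s > 0" "\<And>h. \<bar>h\<bar> < s \<Longrightarrow> N h < r"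
      using ap_small by blast
    then show "\<exists>s>0. \<forall>y. y \<noteq> x \<and> norm (y - x) < s \<longrightarrow> norm (N y - N x) < r"
      using ap_abs_diff by (intro exI[of _ s]) (auto intro: le_less_trans)
  qed
  then show ?thesis by (simp add: continuous_at_imp_continuous_on)
qed

lemma ap_bounded: obtains b where "b > 0" "\<And>x. N x \<le> b"
proof -
  obtain a where a: "a > 0" "\<And>\<xi>. {\<xi>..\<xi> + a} \<inter> {t. N t < 1} \<noteq> {}"
    using ap_rel_dense[of 1] by (auto simp: relatively_dense_def)
  have "compact (N ` {-a..0})" by (intro compact_continuous_image ap_continuous) auto
  then obtain c where c: "\<And>x. x \<in> {-a..0} \<Longrightarrow> N x \<le> c"
    by (meson bounded_imp_bdd_above bdd_above.E compact_imp_bounded image_eqI)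
  show thesis
  proof
    show "c + 1 > 0" using c[of 0] a(1) by (simp add: ap_zero)
    fix x
    obtain e where e: "x \<le> e" "e \<le> x + a" "N e < 1" using a(2)[of x] by auto
    then have "N (x - e) \<le> c" by (intro c) auto
    then show "N x \<le> c + 1" using ap_add[of e "x - e"] e by auto
  qed
qed

text \<open>
  On a fine lattice \<open>h \<int>\<close> the ball of radius \<open>2 \<epsilon>'\<close> is syndetic, and sums of four of its points lie in the ball of radius \<open>8 \<epsilon>'\<close>,
  so Bogolyubov's theorem applies. Adding the frequency \<open>2 \<pi> / h\<close> forces a real \<open>t\<close> in the Bohr set to be close to
  the lattice, where continuity of the seminorm and of the other characters takes over.
\<close>
lemma ball_contains_bohr_set:
  assumes "\<epsilon> > 0"
  obtains I \<delta> where "finite I" "0 < \<delta>" "\<delta> \<le> 1" "bohr_set I \<delta> \<subseteq> {t. N t < \<epsilon>}"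
proof -
  define \<epsilon>' where "\<epsilon>' = \<epsilon> / 9"
  have \<epsilon>': "\<epsilon>' > 0" using assms by (simp add: \<epsilon>'_def)
  obtain h0 where h0: "h0 > 0" "\<And>s. \<bar>s\<bar> < h0 \<Longrightarrow> N s < \<epsilon>'"
    using ap_small[OF \<epsilon>'] by blast
  define h where "h = h0 / 2"
  have h: "h > 0" "\<And>s. \<bar>s\<bar> \<le> h \<Longrightarrow> N s < \<epsilon>'" using h0 by (auto simp: h_def)
  define A where "A = {n::int. N (h * of_int n) < 2 * \<epsilon>'}"
  obtain a where a: "a > 0" "\<And>\<xi>. {\<xi>..\<xi> + a} \<inter> {t. N t < \<epsilon>'} \<noteq> {}"
    using ap_rel_dense[OF \<epsilon>'] by (auto simp: relatively_dense_def)
  define g where "g = nat \<lceil>a / h\<rceil> + 1"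
  have syn: "\<exists>n\<in>A. z \<le> n \<and> n < z + int g" for z
  proof -
    obtain e where e: "h * of_int z \<le> e" "e \<le> h * of_int z + a" "N e < \<epsilon>'" using a(2)[of "h * of_int z"] by auto
    define n where "n = \<lfloor>e / h\<rfloor>"
    have "of_int z \<le> e / h" "e / h \<le> of_int z + a / h" using e h by (auto simp: field_simps)
    then have "z \<le> n" "n < z + int g" unfolding n_def g_def by linarith+
    moreover have "n \<in> A"
    proof -
      have "of_int n \<le> e / h" "e / h < of_int n + 1" unfolding n_def by linarith+
      then have "\<bar>e - h * of_int n\<bar> \<le> h" using h by (auto simp: field_simps)
      then have "N (e - h * of_int n) < \<epsilon>'" by (rule h)
      then show ?thesis using ap_diff[of e "e - h * of_int n"] e by (simp add: A_def)
    qed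
    ultimately show ?thesis by blast
  qed
  obtain \<Theta> :: "real set" where \<Theta>: "finite \<Theta>"
    "\<And>x::int. (\<forall>\<theta>\<in>\<Theta>. 0 < cos (\<theta> * of_int x)) \<Longrightarrow> \<exists>a\<in>A. \<exists>b\<in>A. \<exists>c\<in>A. \<exists>d\<in>A. x = a + b - c - d"
    using bogolyubov_int[of A g, OF syn] by blast
  obtain C where C: "C > 0" "\<And>\<theta>. \<theta> \<in> \<Theta> \<Longrightarrow> \<bar>\<theta>\<bar> \<le> C"
    using finite_imp_bounded[OF \<Theta>(1)] by (auto simp: bounded_pos)
  define \<eta> where "\<eta> = min 1 (1 / (2 * C))"
  have \<eta>: "\<eta> > 0" "\<eta> \<le> 1" "C * \<eta> \<le> 1 / 2" using C by (auto simp: \<eta>_def min_def field_simps)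
  obtain \<delta> where \<delta>: "\<delta> > 0" "\<And>y. norm (cis (2 * pi * y) - 1) < \<delta> \<Longrightarrow> \<exists>n::int. \<bar>y - of_int n\<bar> < \<eta>"
    using cis_close_to_one[OF \<eta>(1)] by blast
  show thesis
  proof
    define I where "I = insert (2 * pi / h) ((\<lambda>\<theta>. \<theta> / h) ` \<Theta>)"
    show "finite I" using \<Theta> by (simp add: I_def)
    show "0 < min \<delta> 1" "min \<delta> 1 \<le> 1" using \<delta> by auto
    show "bohr_set I (min \<delta> 1) \<subseteq> {t. N t < \<epsilon>}"
    proof safe
      fix t assume t: "t \<in> bohr_set I (min \<delta> 1)"
      have "norm (cis (2 * pi * (t / h)) - 1) < \<delta>" using t by (auto simp: bohr_set_def I_def)
      then obtain n :: int where n: "\<bar>t / h - of_int n\<bar> < \<eta>" using \<delta>(2) by blast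
      have "0 < cos (\<theta> * of_int n)" if "\<theta> \<in> \<Theta>" for \<theta>
      proof -
        have "norm (cis (\<theta> * (t / h)) - 1) < 1" using t that by (auto simp: bohr_set_def I_def)
        then have "(norm (cis (\<theta> * (t / h)) - 1))\<^sup>2 < 1" by (simp add: power_less_one_iff abs_square_less_1)
        then have 1: "cos (\<theta> * (t / h)) > 1 / 2" by (simp add: norm_cis_minus_one_sq)
        have 2: "\<bar>cos x - cos y\<bar> \<le> \<bar>x - y\<bar>" for x y :: real
        proof -
          have "norm (cos x - cos y) \<le> 1 * norm (x - y)"
            by (rule field_differentiable_bound[of UNIV cos "\<lambda>x. - sin x"]) (auto intro!: derivative_eq_intros)
          then show ?thesis by simp
        qed
        have "\<bar>\<theta> * of_int n - \<theta> * (t / h)\<bar> = \<bar>\<theta>\<bar> * \<bar>t / h - of_int n\<bar>"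
          by (metis abs_minus_commute abs_mult right_diff_distrib)
        also have "\<dots> \<le> C * \<eta>" using C that n by (intro mult_mono) auto
        finally show ?thesis using 1 2[of "\<theta> * of_int n" "\<theta> * (t / h)"] \<eta>(3) by linarith
      qed
      then obtain a b c d where A: "a \<in> A" "b \<in> A" "c \<in> A" "d \<in> A" "n = a + b - c - d" using \<Theta>(2) by blast
      have "h * of_int n = (h * a + h * b) - (h * c + h * d)" unfolding A(5) by (simp add: algebra_simps)
      then have "N (h * of_int n) \<le> (N (h * a) + N (h * b)) + (N (h * c) + N (h * d))"
        using ap_diff[of "h * a + h * b" "h * c + h * d"] ap_add[of "h*a" "h*b"] ap_add[of "h*c" "h*d"] by simp
      also have "\<dots> < 8 * \<epsilon>'" using A by (auto simp: A_def)
      finally have 1: "N (h * of_int n) < 8 * \<epsilon>'" .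
      have "\<bar>t / h - of_int n\<bar> \<le> 1" using n \<eta> by linarith
      then have "\<bar>t - h * of_int n\<bar> \<le> h" using h by (simp add: abs_le_iff field_simps)
      then have "N (t - h * of_int n) < \<epsilon>'" by (rule h)
      then show "N t < \<epsilon>" using 1 ap_add[of "h * of_int n" "t - h * of_int n"] by (simp add: \<epsilon>'_def)
    qed
  qed
qed

text \<open>
  Let \<open>p\<close> be a Fejer kernel for a Bohr set on which \<open>N\<close> is small. Since \<open>N (t + \<tau>) - N t\<close> differs from \<open>N \<tau>\<close> by at
  most \<open>2 N t\<close>, the mean of \<open>(N (t + \<tau>) - N t) p t\<close> is close to \<open>N \<tau>\<close>. The same mean is a trigonometric sum in \<open>\<tau>\<close>:
  the term of frequency \<open>\<nu> g\<close> is a multiple of \<open>(cis (- \<nu> g \<tau>) - 1) * l g\<close>, where \<open>l g\<close> is a Fourier coefficient of \<open>N\<close>. If \<open>l g\<close> is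
  not zero, then \<open>\<bar>cis (\<nu> g \<tau>) - 1\<bar>\<close> is bounded by a multiple of \<open>N \<tau>\<close>, so \<open>\<nu> g\<close> belongs to a continuous character. Only the
  finitely many frequencies of \<open>p\<close> are involved, so it suffices to take the coefficients along a subsequence of intervals
  for which these means converge.
\<close>
lemma ball_contains_char_bohr_set:
  assumes "\<epsilon> > 0"
  obtains I \<delta> where "finite I" "I \<subseteq> continuous_chars N" "0 < \<delta>" "\<delta> \<le> 1" "bohr_set I \<delta> \<subseteq> {t. N t < \<epsilon>}"
proof -
  obtain b where b: "b > 0" "\<And>x. N x \<le> b" using ap_bounded by blast
  have nb: "norm (complex_of_real (N x)) \<le> b" for x using b ap_nonneg by simp
  obtain I0 \<delta>0 where I0: "finite I0" "0 < \<delta>0" "\<delta>0 \<le> 1" "bohr_set I0 \<delta>0 \<subseteq> {t. N t < \<epsilon> / 8}"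
    using ball_contains_bohr_set[of "\<epsilon>/8"] assms by auto
  obtain J :: "(real \<Rightarrow> nat) set" and w :: "(real \<Rightarrow> nat) \<Rightarrow> real"
      and \<nu> :: "(real \<Rightarrow> nat) \<Rightarrow> real" and p :: "real \<Rightarrow> real"
    where J: "finite J" and \<nu>: "\<And>g. g \<in> J \<Longrightarrow> \<nu> g \<in> group_closure I0"
    and p: "\<And>t. complex_of_real (p t) = (\<Sum>g\<in>J. of_real (w g) * cis (\<nu> g * t))"
    and w1: "(\<Sum>g | g \<in> J \<and> \<nu> g = 0. w g) = 1"
    and p0: "\<And>t. p t \<ge> 0"
    and psmall: "\<And>t \<mu>. \<mu> \<in> I0 \<Longrightarrow> norm (cis (\<mu> * t) - 1) \<ge> \<delta>0 \<Longrightarrow> p t \<le> \<epsilon> / (8 * b)"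
    by (rule fejer_kernel[of I0 "\<delta>0" "\<epsilon> / (8 * b)"]) (use I0 assms b(1) in auto)
  obtain C where pc: "continuous_on UNIV p" and C: "C \<ge> 0" "\<And>\<xi> T. T > 0 \<Longrightarrow>
     \<bar>integral {\<xi>..\<xi>+T} p / T - (\<Sum>g | g \<in> J \<and> \<nu> g = 0. w g)\<bar> \<le> C / T"
    using real_trig_sum_mean[OF J p] by blast
  define c where "c g m = integral {0..real (Suc m)} (\<lambda>t. of_real (N t) * cis (\<nu> g * t)) /\<^sub>R real (Suc m)" for g m
  have cb: "norm (c g m) \<le> b" for g m
  proof -
    have "norm (integral {0..real (Suc m)} (\<lambda>t. of_real (N t) * cis (\<nu> g * t))) \<le> b * (real (Suc m) - 0)"
      using nb by (intro integral_bound) (auto simp: norm_mult intro!: continuous_intros ap_continuous)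
    then show ?thesis by (simp add: c_def divide_simps)
  qed
  obtain r l where r: "strict_mono (r::nat\<Rightarrow>nat)" and l: "\<And>g. g \<in> J \<Longrightarrow> (\<lambda>m. c g (r m)) \<longlonglongrightarrow> l g"
  proof (rule common_convergent_subseq[OF J, of c])
    show "bounded (range (c g))" for g using cb by (auto intro!: boundedI)
  qed (rule that)
  define T where "T m = real (Suc (r m))" for m
  have T: "T m > 0" for m by (simp add: T_def)
  have Tinf: "filterlim T at_top sequentially"
    unfolding T_def using r
    by (intro filterlim_compose[OF filterlim_real_sequentially] filterlim_compose[OF filterlim_Suc] filterlim_subseq)
  have lim: "(\<lambda>m. integral {0..T m} (\<lambda>t. of_real (N (t + \<tau>) - N t) * cis (\<nu> g * t)) /\<^sub>R T m)
       \<longlonglongrightarrow> (cis (- \<nu> g * \<tau>) - 1) * l g" if "g \<in> J" for g \<tau>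
  proof -
    define G where "G t = of_real (N t) * cis (\<nu> g * t)" for t
    have G: "continuous_on S G" for S unfolding G_def by (intro continuous_intros ap_continuous)
    have Gb: "norm (G x) \<le> b" for x using nb by (simp add: G_def norm_mult)
    have Gi: "G integrable_on {u..v}" for u v by (intro integrable_continuous_real G)
    have "integral {0..T m} (\<lambda>t. of_real (N (t + \<tau>) - N t) * cis (\<nu> g * t)) /\<^sub>R T m =
       (cis (- \<nu> g * \<tau>) - 1) * c g (r m) + cis (- \<nu> g * \<tau>) * ((integral {\<tau>..\<tau>+T m} G - integral {0..0+T m} G) /\<^sub>R T m)" for m
    proof -
      have sh: "(\<lambda>t. cis (- \<nu> g * \<tau>) * (G \<circ> (+) \<tau>) t) integrable_on {0..T m}"
        unfolding o_def by (intro integrable_continuous_real continuous_intros continuous_on_compose2[OF G[of UNIV]]) auto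
      have "integral {0..T m} (\<lambda>t. of_real (N (t + \<tau>) - N t) * cis (\<nu> g * t)) =
        integral {0..T m} (\<lambda>t. cis (- \<nu> g * \<tau>) * (G \<circ> (+) \<tau>) t - G t)"
        by (intro integral_cong) (simp add: G_def cis_mult algebra_simps)
      also have "\<dots> = cis (- \<nu> g * \<tau>) * integral {0..T m} (G \<circ> (+) \<tau>) - integral {0..T m} G"
        unfolding integral_diff[OF sh Gi] integral_mult_right ..
      also have "integral {0..T m} (G \<circ> (+) \<tau>) = integral {\<tau>..\<tau>+T m} G"
        using integral_shift_Icc_real[of 0 "T m" G \<tau>] by (simp add: add.commute)
      finally have "integral {0..T m} (\<lambda>t. of_real (N (t + \<tau>) - N t) * cis (\<nu> g * t)) =
        (cis (- \<nu> g * \<tau>) - 1) * integral {0..T m} G + cis (- \<nu> g * \<tau>) * (integral {\<tau>..\<tau>+T m} G - integral {0..0+T m} G)"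
        by (simp add: algebra_simps)
      then show ?thesis by (simp add: c_def G_def[abs_def] T_def scaleR_right_distrib del: of_nat_Suc)
    qed
    moreover have "(\<lambda>m. (integral {\<tau>..\<tau>+T m} G - integral {0..0+T m} G) /\<^sub>R T m) \<longlonglongrightarrow> 0"
    proof (rule Lim_null_comparison)
      show "\<forall>\<^sub>F m in sequentially. norm ((integral {\<tau>..\<tau>+T m} G - integral {0..0+T m} G) /\<^sub>R T m) \<le> 2 * b * \<bar>\<tau>\<bar> / T m"
      proof (rule always_eventually, rule allI)
        fix m
        have "norm (integral {\<tau>..\<tau>+T m} G - integral {0..0+T m} G) \<le> 2 * b * \<bar>\<tau>\<bar>"
          using integral_shift_diff_bound[OF G Gb, of "T m" \<tau> 0] T[of m] by simp
        then show "norm ((integral {\<tau>..\<tau>+T m} G - integral {0..0+T m} G) /\<^sub>R T m) \<le> 2 * b * \<bar>\<tau>\<bar> / T m"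
          using T[of m] by (simp add: divide_simps)
      qed
      show "(\<lambda>m. 2 * b * \<bar>\<tau>\<bar> / T m) \<longlonglongrightarrow> 0"
        by (intro tendsto_divide_0[OF tendsto_const] filterlim_at_top_imp_at_infinity Tinf)
    qed
    then have "(\<lambda>m. (cis (- \<nu> g * \<tau>) - 1) * c g (r m) + cis (- \<nu> g * \<tau>) * ((integral {\<tau>..\<tau>+T m} G - integral {0..0+T m} G) /\<^sub>R T m))
       \<longlonglongrightarrow> (cis (- \<nu> g * \<tau>) - 1) * l g + cis (- \<nu> g * \<tau>) * 0"
      by (intro tendsto_intros l that)
    ultimately show ?thesis by simp
  qed
  have cis_minus: "norm (cis (- x) - 1) = norm (cis x - 1)" for x
    using complex_mod_cnj[of "cis x - 1"] by (simp add: cis_cnj)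
  have char_bound: "norm (cis (\<nu> g * \<tau>) - 1) * norm (l g) \<le> N \<tau>" if "g \<in> J" for g \<tau>
  proof -
    have "norm (integral {0..T m} (\<lambda>t. of_real (N (t + \<tau>) - N t) * cis (\<nu> g * t)) /\<^sub>R T m) \<le> N \<tau>" for m
    proof -
      have "norm (integral {0..T m} (\<lambda>t. of_real (N (t + \<tau>) - N t) * cis (\<nu> g * t))) \<le> N \<tau> * (T m - 0)"
      proof (rule integral_bound)
        show "continuous_on {0..T m} (\<lambda>t. of_real (N (t + \<tau>) - N t) * cis (\<nu> g * t))"
          by (intro continuous_intros continuous_on_compose2[OF ap_continuous[of UNIV]]) auto
        show "norm (complex_of_real (N (t + \<tau>) - N t) * cis (\<nu> g * t)) \<le> N \<tau>" for t
          using ap_abs_diff[of "t + \<tau>" t] by (simp add: norm_mult del: of_real_diff)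
      qed (use T[of m] in simp)
      then show ?thesis using T[of m] by (simp add: divide_simps)
    qed
    then have "norm ((cis (- \<nu> g * \<tau>) - 1) * l g) \<le> N \<tau>"
      by (intro LIMSEQ_le_const2[OF tendsto_norm[OF lim[OF that]]]) auto
    then show ?thesis using cis_minus[of "\<nu> g * \<tau>"] by (simp add: norm_mult)
  qed
  define I where "I = \<nu> ` {g \<in> J. l g \<noteq> 0}"
  define S where "S = (\<Sum>g\<in>J. \<bar>w g\<bar> * norm (l g))"
  have S0: "S \<ge> 0" unfolding S_def by (intro sum_nonneg) auto
  define \<delta> where "\<delta> = min 1 (\<epsilon> / (2 * (1 + S)))"
  have main: "N \<tau> \<le> norm (\<Sum>g\<in>J. of_real (w g) * ((cis (- \<nu> g * \<tau>) - 1) * l g)) + \<epsilon> / 2" for \<tau>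
  proof -
    have "(\<lambda>m. integral {0..T m} p / T m - 1) \<longlonglongrightarrow> 0"
    proof (rule Lim_null_comparison)
      show "\<forall>\<^sub>F m in sequentially. norm (integral {0..T m} p / T m - 1) \<le> C / T m"
        using C(2)[OF T, of 0] w1 by simp
      show "(\<lambda>m. C / T m) \<longlonglongrightarrow> 0"
        by (intro tendsto_divide_0[OF tendsto_const] filterlim_at_top_imp_at_infinity Tinf)
    qed
    then have mean: "(\<lambda>m. integral {0..T m} p / T m) \<longlonglongrightarrow> 1" by (simp add: LIM_zero_iff)
    define D where "D t = (N (t + \<tau>) - N t) * p t" for t
    have Dc: "continuous_on X D" for X
      unfolding D_def by (intro continuous_intros ap_continuous continuous_on_subset[OF pc] continuous_on_compose2[OF ap_continuous[of UNIV]]) auto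
    have Di: "D integrable_on {u..v}" and pI: "p integrable_on {u..v}" for u v
      by (intro integrable_continuous_real Dc continuous_on_subset[OF pc] subset_UNIV)+
    have "(\<lambda>m. complex_of_real (integral {0..T m} D / T m)) \<longlonglongrightarrow> (\<Sum>g\<in>J. of_real (w g) * ((cis (- \<nu> g * \<tau>) - 1) * l g))"
    proof -
      have "complex_of_real (integral {0..T m} D / T m) =
        (\<Sum>g\<in>J. of_real (w g) * (integral {0..T m} (\<lambda>t. of_real (N (t + \<tau>) - N t) * cis (\<nu> g * t)) /\<^sub>R T m))" for m
      proof -
        have "complex_of_real (integral {0..T m} D) = integral {0..T m} (\<lambda>t. complex_of_real (D t))"
          by (intro integral_unique[symmetric] has_integral_of_real integrable_integral Di)
        also have "\<dots> = integral {0..T m} (\<lambda>t. \<Sum>g\<in>J. of_real (w g) * (of_real (N (t + \<tau>) - N t) * cis (\<nu> g * t)))"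
          unfolding D_def of_real_mult p sum_distrib_left by (simp add: mult_ac)
        also have "\<dots> = (\<Sum>g\<in>J. of_real (w g) * integral {0..T m} (\<lambda>t. of_real (N (t + \<tau>) - N t) * cis (\<nu> g * t)))"
          by (subst integral_sum[OF J])
            (auto intro!: integrable_continuous_real continuous_intros ap_continuous continuous_on_compose2[OF ap_continuous[of UNIV]])
        finally have eq: "complex_of_real (integral {0..T m} D) = (\<Sum>g\<in>J. of_real (w g) * integral {0..T m} (\<lambda>t. of_real (N (t + \<tau>) - N t) * cis (\<nu> g * t)))" .
        have "complex_of_real (integral {0..T m} D / T m) = complex_of_real (integral {0..T m} D) /\<^sub>R T m"
          by (simp add: scaleR_conv_of_real divide_inverse mult.commute)
        then show ?thesis by (simp only: eq scaleR_sum_right mult_scaleR_right)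
      qed
      moreover have "(\<lambda>m. \<Sum>g\<in>J. of_real (w g) * (integral {0..T m} (\<lambda>t. of_real (N (t + \<tau>) - N t) * cis (\<nu> g * t)) /\<^sub>R T m))
         \<longlonglongrightarrow> (\<Sum>g\<in>J. of_real (w g) * ((cis (- \<nu> g * \<tau>) - 1) * l g))"
        by (intro tendsto_sum tendsto_mult_left lim)
      ultimately show ?thesis by (simp only:)
    qed
    from tendsto_Re[OF this]
    have Dlim: "(\<lambda>m. integral {0..T m} D / T m) \<longlonglongrightarrow> Re (\<Sum>g\<in>J. of_real (w g) * ((cis (- \<nu> g * \<tau>) - 1) * l g))"
      by (simp only: Re_complex_of_real)
    have ineq: "N \<tau> * (integral {0..T m} p / T m) \<le> integral {0..T m} D / T m + \<epsilon>/4 * (integral {0..T m} p / T m) + \<epsilon>/4" for m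
    proof -
      have "integral {0..T m} (\<lambda>t. N \<tau> * p t) \<le> integral {0..T m} (\<lambda>t. D t + \<epsilon>/4 * p t + \<epsilon>/4)"
      proof (rule integral_le)
        fix t
        have "N \<tau> \<le> N (t + \<tau>) + N t" using ap_diff[of "t + \<tau>" t] by simp
        then have "N \<tau> * p t \<le> (N (t + \<tau>) + N t) * p t" using p0 by (rule mult_right_mono)
        moreover have "2 * N t * p t \<le> \<epsilon>/4 * p t + \<epsilon>/4"
        proof (cases "t \<in> bohr_set I0 \<delta>0")
          case True
          then have "N t \<le> \<epsilon> / 8" using I0(4) by auto
          then have "2 * N t * p t \<le> \<epsilon>/4 * p t" using p0 by (intro mult_right_mono) auto
          then show ?thesis using assms by simp
        next
          case False
          then have "p t \<le> \<epsilon> / (8 * b)" using psmall by (auto simp: bohr_set_def not_less)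
          then have "2 * N t * p t \<le> 2 * b * (\<epsilon> / (8 * b))" using b ap_nonneg p0 by (intro mult_mono) auto
          also have "\<dots> = \<epsilon>/4" using b by simp
          finally have "2 * N t * p t \<le> \<epsilon>/4" .
          moreover have "0 \<le> \<epsilon>/4 * p t" using p0[of t] assms by simp
          ultimately show ?thesis by linarith
        qed
        moreover have "(N (t + \<tau>) + N t) * p t = D t + 2 * N t * p t" by (simp add: D_def left_diff_distrib distrib_right)
        ultimately show "N \<tau> * p t \<le> D t + \<epsilon>/4 * p t + \<epsilon>/4" by linarith
      qed (intro integrable_add integrable_on_mult_right integrable_const_ivl Di pI)+
      also have "integral {0..T m} (\<lambda>t. D t + \<epsilon>/4 * p t + \<epsilon>/4) = integral {0..T m} D + \<epsilon>/4 * integral {0..T m} p + \<epsilon>/4 * T m"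
      proof -
        have 1: "(\<lambda>t. \<epsilon>/4 * p t) integrable_on {0..T m}" by (intro integrable_on_mult_right pI)
        have 2: "(\<lambda>t. D t + \<epsilon>/4 * p t) integrable_on {0..T m}" using Di 1 by (rule integrable_add)
        show ?thesis
          using T[of m] integral_add[OF 2 integrable_const_ivl, of "\<epsilon>/4"] integral_add[OF Di 1] by simp
      qed
      finally have "N \<tau> * integral {0..T m} p \<le> integral {0..T m} D + \<epsilon>/4 * integral {0..T m} p + \<epsilon>/4 * T m" by simp
      then have "N \<tau> * integral {0..T m} p / T m \<le> (integral {0..T m} D + \<epsilon>/4 * integral {0..T m} p + \<epsilon>/4 * T m) / T m"
        using T[of m] by (intro divide_right_mono) auto
      then show ?thesis using T[of m] by (simp add: add_divide_distrib)
    qed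
    define z where "z = (\<Sum>g\<in>J. of_real (w g) * ((cis (- \<nu> g * \<tau>) - 1) * l g))"
    have "N \<tau> * 1 \<le> Re z + \<epsilon>/4 * 1 + \<epsilon>/4"
    proof (rule LIMSEQ_le)
      show "(\<lambda>m. N \<tau> * (integral {0..T m} p / T m)) \<longlonglongrightarrow> N \<tau> * 1"
        by (rule tendsto_mult_left[OF mean])
      show "(\<lambda>m. integral {0..T m} D / T m + \<epsilon>/4 * (integral {0..T m} p / T m) + \<epsilon>/4) \<longlonglongrightarrow> Re z + \<epsilon>/4 * 1 + \<epsilon>/4"
        unfolding z_def by (intro tendsto_add tendsto_mult_left tendsto_const mean Dlim)
    qed (use ineq in blast)
    then show ?thesis using complex_Re_le_cmod[of z] unfolding z_def[symmetric] by linarith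
  qed
  show thesis
  proof
    show "finite I" using J by (simp add: I_def)
    show "I \<subseteq> continuous_chars N"
    proof
      fix \<mu> assume "\<mu> \<in> I"
      then obtain g where g: "g \<in> J" "l g \<noteq> 0" "\<mu> = \<nu> g" by (auto simp: I_def)
      show "\<mu> \<in> continuous_chars N"
        unfolding continuous_chars_def
      proof safe
        fix \<tau> :: "nat \<Rightarrow> real" assume lim0: "(\<lambda>j. N (\<tau> j)) \<longlonglongrightarrow> 0"
        have "(\<lambda>j. cis (\<mu> * \<tau> j) - 1) \<longlonglongrightarrow> 0"
        proof (rule Lim_null_comparison)
          show "\<forall>\<^sub>F j in sequentially. norm (cis (\<mu> * \<tau> j) - 1) \<le> N (\<tau> j) / norm (l g)"
            using char_bound[OF g(1)] g by (intro always_eventually allI) (simp add: pos_le_divide_eq)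
          show "(\<lambda>j. N (\<tau> j) / norm (l g)) \<longlonglongrightarrow> 0" by (rule tendsto_divide_zero[OF lim0])
        qed
        then show "(\<lambda>j. cis (\<mu> * \<tau> j)) \<longlonglongrightarrow> 1" by (rule LIM_zero_cancel)
      qed
    qed
    have "0 < \<epsilon> / (2 * (1 + S))" using assms S0 by simp
    then show "0 < \<delta>" "\<delta> \<le> 1" by (simp_all add: \<delta>_def)
    show "bohr_set I \<delta> \<subseteq> {t. N t < \<epsilon>}"
    proof safe
      fix \<tau> assume \<tau>: "\<tau> \<in> bohr_set I \<delta>"
      have "norm (\<Sum>g\<in>J. of_real (w g) * ((cis (- \<nu> g * \<tau>) - 1) * l g)) \<le> (\<Sum>g\<in>J. \<bar>w g\<bar> * norm (l g) * \<delta>)"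
      proof (rule sum_norm_le)
        fix g assume "g \<in> J"
        then have "norm (cis (\<nu> g * \<tau>) - 1) \<le> \<delta>" if "l g \<noteq> 0"
          using \<tau> that by (auto simp: bohr_set_def I_def intro: less_imp_le)
        then have "norm (l g) * norm (cis (\<nu> g * \<tau>) - 1) \<le> norm (l g) * \<delta>"
          by (cases "l g = 0") (auto intro: mult_left_mono)
        then have "\<bar>w g\<bar> * (norm (l g) * norm (cis (\<nu> g * \<tau>) - 1)) \<le> \<bar>w g\<bar> * (norm (l g) * \<delta>)"
          by (rule mult_left_mono) simp
        moreover have "norm (of_real (w g) * ((cis (- \<nu> g * \<tau>) - 1) * l g)) = \<bar>w g\<bar> * (norm (l g) * norm (cis (\<nu> g * \<tau>) - 1))"
          using cis_minus[of "\<nu> g * \<tau>"] unfolding norm_mult by simp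
        ultimately show "norm (of_real (w g) * ((cis (- \<nu> g * \<tau>) - 1) * l g)) \<le> \<bar>w g\<bar> * norm (l g) * \<delta>"
          by (simp only: mult.assoc)
      qed
      also have "\<dots> = S * \<delta>" by (simp add: S_def sum_distrib_right)
      also have "\<dots> \<le> S * (\<epsilon> / (2 * (1 + S)))" unfolding \<delta>_def using S0 by (intro mult_left_mono) auto
      also have "\<dots> < \<epsilon> / 2" 
      proof -
        have "S / (1 + S) < 1" using S0 by simp
        then have "S / (1 + S) * (\<epsilon> / 2) < 1 * (\<epsilon> / 2)" using assms by (intro mult_strict_right_mono) auto
        then show ?thesis by (simp add: mult.commute)
      qed
      finally have "norm (\<Sum>g\<in>J. of_real (w g) * ((cis (- \<nu> g * \<tau>) - 1) * l g)) + \<epsilon> / 2 < \<epsilon> / 2 + \<epsilon> / 2"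
        by (rule add_strict_right_mono)
      then show "N \<tau> < \<epsilon>" using main[of \<tau>] unfolding field_sum_of_halves by (rule le_less_trans[rotated])
    qed
  qed
qed

end

text \<open>The Fejer kernel has mean close to \<open>1\<close> on every long interval, but is at most \<open>1 / 2\<close> off the Bohr set.\<close>
lemma bohr_set_relatively_dense:
  assumes "finite I" "\<delta> > 0"
  shows "relatively_dense (bohr_set I \<delta>)"
proof -
  obtain J :: "(real \<Rightarrow> nat) set" and w :: "(real \<Rightarrow> nat) \<Rightarrow> real"
      and \<nu> :: "(real \<Rightarrow> nat) \<Rightarrow> real" and p :: "real \<Rightarrow> real"
    where J: "finite J" and \<nu>: "\<And>g. g \<in> J \<Longrightarrow> \<nu> g \<in> group_closure I"
    and p: "\<And>t. complex_of_real (p t) = (\<Sum>g\<in>J. of_real (w g) * cis (\<nu> g * t))"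
    and w1: "(\<Sum>g | g \<in> J \<and> \<nu> g = 0. w g) = 1"
    and p0: "\<And>t. p t \<ge> 0"
    and psmall: "\<And>t \<mu>. \<mu> \<in> I \<Longrightarrow> norm (cis (\<mu> * t) - 1) \<ge> min \<delta> 1 \<Longrightarrow> p t \<le> 1 / 2"
    by (rule fejer_kernel[of I "min \<delta> 1" "1 / 2"]) (use assms in auto)
  obtain C where pc: "continuous_on UNIV p" and C: "C \<ge> 0" "\<And>\<xi> T. T > 0 \<Longrightarrow>
     \<bar>integral {\<xi>..\<xi>+T} p / T - (\<Sum>g | g \<in> J \<and> \<nu> g = 0. w g)\<bar> \<le> C / T"
    using real_trig_sum_mean[OF J p] by blast
  define T where "T = 4 * C + 1"
  have T: "T > 0" "C / T < 1 / 2" using C(1) by (auto simp: T_def field_simps)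
  show ?thesis
    unfolding relatively_dense_def
  proof (intro exI conjI allI notI)
    show "T > 0" by fact
    fix \<xi> assume empty: "{\<xi>..\<xi> + T} \<inter> bohr_set I \<delta> = {}"
    have "p t \<le> 1 / 2" if "t \<in> {\<xi>..\<xi>+T}" for t
    proof -
      have "t \<notin> bohr_set I \<delta>" using that empty by blast
      then obtain \<mu> where "\<mu> \<in> I" "norm (cis (\<mu> * t) - 1) \<ge> \<delta>" by (auto simp: bohr_set_def not_less)
      then show ?thesis using psmall[of \<mu> t] by auto
    qed
    then have "integral {\<xi>..\<xi>+T} p \<le> integral {\<xi>..\<xi>+T} (\<lambda>_. 1 / 2)"
      by (intro integral_le integrable_continuous_real continuous_on_subset[OF pc]) auto
    then have "integral {\<xi>..\<xi>+T} p / T \<le> 1 / 2" using T by (simp add: field_simps)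
    moreover have "\<bar>integral {\<xi>..\<xi>+T} p / T - 1\<bar> \<le> C / T" using C(2)[OF T(1), of \<xi>] w1 by simp
    ultimately show False using T(2) by linarith
  qed
qed

text \<open>
  If \<open>\<mu>\<close> is outside the group generated by \<open>I\<close>, then \<open>p t * cis (\<mu> t)\<close> has mean \<open>0\<close> for every Fejer kernel \<open>p\<close> for
  \<open>I\<close>, because none of its frequencies vanishes. But its real part is at least \<open>p t / 2 - 1 / 4\<close>: on the Bohr set the cosine is at least \<open>1 / 2\<close>,
  and off it \<open>p t \<le> 1 / 6\<close>. As \<open>p\<close> has mean \<open>1\<close>, this is a contradiction.
\<close>
lemma char_near_one_on_bohr_set_in_group_closure:
  assumes I: "finite I" and \<delta>: "0 < \<delta>" and near: "\<And>t. t \<in> bohr_set I \<delta> \<Longrightarrow> norm (cis (\<mu> * t) - 1) < 1"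
  shows "\<mu> \<in> group_closure I"
proof (rule ccontr)
  assume notin: "\<mu> \<notin> group_closure I"
  obtain J :: "(real \<Rightarrow> nat) set" and w :: "(real \<Rightarrow> nat) \<Rightarrow> real"
      and \<nu> :: "(real \<Rightarrow> nat) \<Rightarrow> real" and p :: "real \<Rightarrow> real"
    where J: "finite J" and \<nu>: "\<And>g. g \<in> J \<Longrightarrow> \<nu> g \<in> group_closure I"
    and p: "\<And>t. complex_of_real (p t) = (\<Sum>g\<in>J. of_real (w g) * cis (\<nu> g * t))"
    and w1: "(\<Sum>g | g \<in> J \<and> \<nu> g = 0. w g) = 1"
    and p0: "\<And>t. p t \<ge> 0"
    and psmall: "\<And>t \<mu>. \<mu> \<in> I \<Longrightarrow> norm (cis (\<mu> * t) - 1) \<ge> min \<delta> 1 \<Longrightarrow> p t \<le> 1 / 6"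
    by (rule fejer_kernel[of I "min \<delta> 1" "1 / 6"]) (use I \<delta> in auto)
  obtain C where pc: "continuous_on UNIV p" and C: "C \<ge> 0" "\<And>\<xi> T. T > 0 \<Longrightarrow>
     \<bar>integral {\<xi>..\<xi>+T} p / T - (\<Sum>g | g \<in> J \<and> \<nu> g = 0. w g)\<bar> \<le> C / T"
    using real_trig_sum_mean[OF J p] by blast
  obtain C' where C': "C' \<ge> 0" "\<And>\<xi> T. T > 0 \<Longrightarrow>
    norm (integral {\<xi>..\<xi>+T} (\<lambda>t. \<Sum>g\<in>J. of_real (w g) * cis ((\<nu> g + \<mu>) * t)) /\<^sub>R T - (\<Sum>g | g \<in> J \<and> \<nu> g + \<mu> = 0. of_real (w g))) \<le> C' / T"
    using trig_sum_mean[OF J, of "\<lambda>g. of_real (w g)" "\<lambda>g. \<nu> g + \<mu>"] by blast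
  have no_zero: "{g. g \<in> J \<and> \<nu> g + \<mu> = 0} = {}"
  proof -
    have "\<nu> g + \<mu> \<noteq> 0" if "g \<in> J" for g
    proof
      assume "\<nu> g + \<mu> = 0"
      then have "\<mu> = - \<nu> g" by simp
      then show False using notin \<nu>[OF that] by simp
    qed
    then show ?thesis by auto
  qed
  have pcis: "(\<Sum>g\<in>J. of_real (w g) * cis ((\<nu> g + \<mu>) * t)) = of_real (p t) * cis (\<mu> * t)" for t
    unfolding p sum_distrib_right by (simp add: mult.assoc cis_mult distrib_right)
  define T where "T = 4 * (C + C') + 1"
  have T: "T > 0" "(C + C') / T < 1 / 4" using C(1) C'(1) by (auto simp: T_def field_simps)
  define Q where "Q t = complex_of_real (p t) * cis (\<mu> * t)" for t
  have Qi: "Q integrable_on {0..T}"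
    unfolding Q_def by (intro integrable_continuous_real continuous_intros continuous_on_subset[OF pc] subset_UNIV)
  have pi: "p integrable_on {0..T}"
    by (intro integrable_continuous_real continuous_on_subset[OF pc] subset_UNIV)
  have Qsmall: "norm (integral {0..T} Q / T) \<le> C' / T"
    using C'(2)[OF T(1), of 0] unfolding no_zero pcis Q_def[symmetric]
    by (simp add: scaleR_conv_of_real divide_inverse mult.commute)
  have "integral {0..T} (\<lambda>t. 1 / 2 * p t - 1 / 4) \<le> integral {0..T} (\<lambda>t. Re (Q t))"
  proof (rule integral_le)
    show "(\<lambda>t. 1 / 2 * p t - 1 / 4) integrable_on {0..T}"
      by (intro integrable_continuous_real continuous_intros continuous_on_subset[OF pc] subset_UNIV)
    show "(\<lambda>t. Re (Q t)) integrable_on {0..T}"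
      unfolding Q_def by (intro integrable_continuous_real continuous_intros continuous_on_subset[OF pc] subset_UNIV)
    fix t
    show "1 / 2 * p t - 1 / 4 \<le> Re (Q t)"
    proof (cases "t \<in> bohr_set I \<delta>")
      case True
      then have "(norm (cis (\<mu> * t) - 1))\<^sup>2 < 1" using near by (simp add: power_less_one_iff abs_square_less_1)
      then have "1 / 2 \<le> cos (\<mu> * t)" by (simp add: norm_cis_minus_one_sq)
      then have "1 / 2 * p t \<le> cos (\<mu> * t) * p t" using p0 by (rule mult_right_mono)
      then show ?thesis by (simp add: Q_def mult.commute)
    next
      case False
      then obtain \<mu>' where "\<mu>' \<in> I" "norm (cis (\<mu>' * t) - 1) \<ge> \<delta>" by (auto simp: bohr_set_def not_less)
      then have "p t \<le> 1 / 6" using psmall[of \<mu>' t] by auto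
      moreover have "- 1 * p t \<le> cos (\<mu> * t) * p t" using p0 by (intro mult_right_mono) auto
      ultimately show ?thesis by (simp add: Q_def mult.commute)
    qed
  qed
  moreover have "integral {0..T} (\<lambda>t. 1 / 2 * p t - 1 / 4) = 1 / 2 * integral {0..T} p - 1 / 4 * T"
    using T(1) by (subst integral_diff) (auto intro!: integrable_on_mult_right pi)
  moreover have "integral {0..T} (\<lambda>t. Re (Q t)) = Re (integral {0..T} Q)"
    using integral_linear[OF Qi bounded_linear_Re] by (simp add: o_def)
  ultimately have "(1 / 2 * integral {0..T} p - 1 / 4 * T) / T \<le> Re (integral {0..T} Q) / T"
    using T(1) by (intro divide_right_mono) auto
  then have "1 / 2 * (integral {0..T} p / T) - 1 / 4 \<le> Re (integral {0..T} Q / T)"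
    using T(1) by (simp add: diff_divide_distrib)
  also have "\<dots> \<le> C' / T" using Qsmall complex_Re_le_cmod order_trans by blast
  finally have "1 / 2 * (integral {0..T} p / T) - 1 / 4 \<le> C' / T" .
  moreover have "\<bar>integral {0..T} p / T - 1\<bar> \<le> C / T" using C(2)[OF T(1), of 0] w1 by simp
  moreover have "C / T + C' / T < 1 / 4" using T(2) by (simp add: add_divide_distrib)
  moreover have "0 \<le> C / T" using C T by simp
  ultimately show False by linarith
qed

lemma common_bohr_set:
  fixes N :: "nat \<Rightarrow> real \<Rightarrow> real"
  assumes N: "\<And>k. k \<in> X \<Longrightarrow> ap_seminorm (N k)" and "finite X" and "\<epsilon> > 0"
  obtains I \<delta> where "finite I" "I \<subseteq> (\<Union>k\<in>X. continuous_chars (N k))" "0 < \<delta>"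
    "bohr_set I \<delta> \<subseteq> {t. \<forall>k\<in>X. N k t < \<epsilon>}"
proof -
  have "\<exists>I \<delta>. finite I \<and> I \<subseteq> continuous_chars (N k) \<and> 0 < \<delta> \<and> bohr_set I \<delta> \<subseteq> {t. N k t < \<epsilon>}" if "k \<in> X" for k
    using ball_contains_char_bohr_set[OF N[OF that] \<open>\<epsilon> > 0\<close>] by metis
  then obtain I \<delta> where I: "\<And>k. k \<in> X \<Longrightarrow> finite (I k) \<and> I k \<subseteq> continuous_chars (N k) \<and> 0 < \<delta> k \<and> bohr_set (I k) (\<delta> k) \<subseteq> {t. N k t < \<epsilon>}"
    by metis
  show thesis
  proof
    show "finite (\<Union>k\<in>X. I k)" using I \<open>finite X\<close> by auto
    show "(\<Union>k\<in>X. I k) \<subseteq> (\<Union>k\<in>X. continuous_chars (N k))" using I by blast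
    show "0 < Min (insert 1 (\<delta> ` X))" using I \<open>finite X\<close> by auto
    show "bohr_set (\<Union>k\<in>X. I k) (Min (insert 1 (\<delta> ` X))) \<subseteq> {t. \<forall>k\<in>X. N k t < \<epsilon>}"
    proof safe
      fix t k assume t: "t \<in> bohr_set (\<Union>k\<in>X. I k) (Min (insert 1 (\<delta> ` X)))" and k: "k \<in> X"
      have "Min (insert 1 (\<delta> ` X)) \<le> \<delta> k" using k \<open>finite X\<close> by (intro Min_le) auto
      then have "t \<in> bohr_set (I k) (\<delta> k)" using t k by (fastforce simp: bohr_set_def)
      then show "N k t < \<epsilon>" using I[OF k] by auto
    qed
  qed
qed

text \<open>
  Continuity with respect to all \<open>N k\<close> together means that the character is near \<open>1\<close> wherever finitely many \<open>N k\<close> are small.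
  A Bohr set with frequencies in their groups of continuous characters lies in this region.
\<close>
lemma continuous_char_in_group_closure:
  fixes N :: "nat \<Rightarrow> real \<Rightarrow> real"
  assumes N: "\<And>k. ap_seminorm (N k)"
    and cont: "\<And>\<tau> :: nat \<Rightarrow> real. (\<And>k. (\<lambda>j. N k (\<tau> j)) \<longlonglongrightarrow> 0) \<Longrightarrow> (\<lambda>j. cis (\<mu> * \<tau> j)) \<longlonglongrightarrow> 1"
  shows "\<mu> \<in> group_closure (\<Union>k. continuous_chars (N k))"
proof -
  have "\<exists>n. \<forall>t. (\<forall>k\<in>{..n}. N k t < 1 / real (Suc n)) \<longrightarrow> norm (cis (\<mu> * t) - 1) < 1"
  proof (rule ccontr)
    assume "\<not> ?thesis"
    then have "\<forall>n. \<exists>t. (\<forall>k\<in>{..n}. N k t < 1 / real (Suc n)) \<and> \<not> norm (cis (\<mu> * t) - 1) < 1" by blast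
    from choice[OF this] obtain \<tau> where "\<forall>n. (\<forall>k\<in>{..n}. N k (\<tau> n) < 1 / real (Suc n)) \<and> \<not> norm (cis (\<mu> * \<tau> n) - 1) < 1"
      by blast
    then have \<tau>: "\<And>n k. k \<le> n \<Longrightarrow> N k (\<tau> n) < 1 / real (Suc n)" "\<And>n. norm (cis (\<mu> * \<tau> n) - 1) \<ge> 1"
      by (auto simp: not_less)
    have "(\<lambda>j. N k (\<tau> j)) \<longlonglongrightarrow> 0" for k
    proof (rule Lim_null_comparison)
      show "\<forall>\<^sub>F j in sequentially. norm (N k (\<tau> j)) \<le> 1 / real (Suc j)"
        using eventually_ge_at_top[of k]
      proof eventually_elim
        case (elim j)
        then show ?case using \<tau>(1)[OF elim] ap_nonneg[OF N, of k "\<tau> j"] by simp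
      qed
      show "(\<lambda>j. 1 / real (Suc j)) \<longlonglongrightarrow> 0" using lim_1_over_n filterlim_sequentially_Suc[of "\<lambda>n. 1 / real n"] by blast
    qed
    then have "(\<lambda>j. cis (\<mu> * \<tau> j)) \<longlonglongrightarrow> 1" by (rule cont)
    then have "\<forall>\<^sub>F j in sequentially. dist (cis (\<mu> * \<tau> j)) 1 < 1" by (rule tendstoD) simp
    then show False using \<tau>(2) by (auto simp: eventually_sequentially dist_norm not_less[symmetric])
  qed
  then obtain n where n: "\<And>t. (\<forall>k\<in>{..n}. N k t < 1 / real (Suc n)) \<Longrightarrow> norm (cis (\<mu> * t) - 1) < 1"
    by blast
  obtain I \<delta> where I: "finite I" "I \<subseteq> (\<Union>k\<in>{..n}. continuous_chars (N k))" "0 < \<delta>"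
    "bohr_set I \<delta> \<subseteq> {t. \<forall>k\<in>{..n}. N k t < 1 / real (Suc n)}"
    by (rule common_bohr_set[of "{..n}" N "1 / real (Suc n)"]) (auto intro: N)
  have "\<mu> \<in> group_closure I"
    using I n by (intro char_near_one_on_bohr_set_in_group_closure[of I \<delta>]) auto
  then show ?thesis by (rule group_closure_mono) (use I(2) in auto)
qed

section \<open>Measurable functions\<close>

lemma measurable_lebesgue_shift [measurable]: "(\<lambda>t::real. t + \<tau>) \<in> lebesgue \<rightarrow>\<^sub>M lebesgue"
  using lebesgue_affine_measurable[where c="\<lambda>_::real. 1" and t=\<tau>] by (simp add: add.commute)

lemma AE_lebesgue_shift:
  fixes P :: "real \<Rightarrow> bool"
  assumes "AE t in lebesgue. P t"
  shows "AE t in lebesgue. P (t + \<tau>)"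
proof -
  have "{t. \<not> P t} \<in> null_sets lebesgue" using assms by (simp add: completion.AE_iff_null_sets)
  then have "negligible ((+) (-\<tau>) ` {t. \<not> P t})" by (intro negligible_translation) (simp add: negligible_iff_null_sets)
  moreover have "(+) (-\<tau>) ` {t. \<not> P t} = {t. \<not> P (t + \<tau>)}" by (force simp: image_iff)
  ultimately show ?thesis by (simp add: completion.AE_iff_null_sets negligible_iff_null_sets)
qed

lemma elementary_comp: "elementary f \<Longrightarrow> elementary (\<lambda>t. F (f t))"
  unfolding elementary_def by (metis comp_apply)

lemma elementary_Pair:
  assumes "elementary f" "elementary g"
  shows "elementary (\<lambda>t. (f t, g t))"
proof -
  obtain x T where T: "disjoint_family (T :: nat \<Rightarrow> real set)" "\<And>j. T j \<in> sets lebesgue" "UNIV - (\<Union>j. T j) \<in> null_sets lebesgue"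
    "\<And>j t. t \<in> T j \<Longrightarrow> f t = x j" using assms(1) unfolding elementary_def by blast
  obtain y S where S: "disjoint_family (S :: nat \<Rightarrow> real set)" "\<And>j. S j \<in> sets lebesgue" "UNIV - (\<Union>j. S j) \<in> null_sets lebesgue"
    "\<And>j t. t \<in> S j \<Longrightarrow> g t = y j" using assms(2) unfolding elementary_def by blast
  define R where "R n = T (fst (prod_decode n)) \<inter> S (snd (prod_decode n))" for n
  have "UNIV - (\<Union>n. R n) \<in> null_sets lebesgue"
  proof (rule completion.complete2)
    show "UNIV - (\<Union>n. R n) \<subseteq> (UNIV - (\<Union>j. T j)) \<union> (UNIV - (\<Union>j. S j))"
    proof safe
      fix t i j assume t: "t \<notin> (\<Union>n. R n)" "t \<in> T i" "t \<in> S j"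
      then have "t \<in> R (prod_encode (i, j))" by (simp add: R_def)
      then show False using t by auto
    qed
    show "(UNIV - (\<Union>j. T j)) \<union> (UNIV - (\<Union>j. S j)) \<in> null_sets lebesgue" using T(3) S(3) by auto
  qed
  moreover have "disjoint_family R"
    unfolding disjoint_family_on_def
  proof safe
    fix m n t assume "m \<noteq> n" "t \<in> R m" "t \<in> R n"
    moreover from \<open>m \<noteq> n\<close> have "prod_decode m \<noteq> prod_decode n" using inj_prod_decode[of UNIV] by (auto dest: injD)
    ultimately show "t \<in> {}" using T(1) S(1) unfolding disjoint_family_on_def R_def by (metis Int_iff UNIV_I prod_eq_iff disjoint_iff)
  qed
  ultimately show ?thesis
    unfolding elementary_def using T S
    by (intro exI[of _ "\<lambda>n. (x (fst (prod_decode n)), y (snd (prod_decode n)))"] exI[of _ R]) (auto simp: R_def)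
qed

lemma elementary_measurable:
  fixes f :: "real \<Rightarrow> 'a::topological_space"
  assumes "elementary f" shows "f \<in> borel_measurable lebesgue"
proof (rule measurableI)
  obtain x T where T: "\<And>j::nat. T j \<in> sets lebesgue" "UNIV - (\<Union>j. T j) \<in> null_sets lebesgue"
    "\<And>j t. t \<in> T j \<Longrightarrow> f t = x j" using assms(1) unfolding elementary_def by blast
  fix B
  have "f -` B = (\<Union>j\<in>{j. x j \<in> B}. T j) \<union> (f -` B \<inter> (UNIV - (\<Union>j. T j)))"
    using T(3) by auto
  moreover have "f -` B \<inter> (UNIV - (\<Union>j. T j)) \<in> null_sets lebesgue" using T(2) by (rule completion.complete2[rotated]) auto
  then have "f -` B \<inter> (UNIV - (\<Union>j. T j)) \<in> sets lebesgue" by auto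
  moreover have "(\<Union>j\<in>{j. x j \<in> B}. T j) \<in> sets lebesgue" using T(1) by auto
  ultimately have "f -` B \<in> sets lebesgue" by (metis sets.Un)
  then show "f -` B \<inter> space lebesgue \<in> sets lebesgue" by simp
qed auto

lemma elementary_shift:
  assumes "elementary f" shows "elementary (\<lambda>t. f (t + \<tau>))"
proof -
  obtain x T where T: "disjoint_family (T :: nat \<Rightarrow> real set)" "\<And>j. T j \<in> sets lebesgue" "UNIV - (\<Union>j. T j) \<in> null_sets lebesgue"
    "\<And>j t. t \<in> T j \<Longrightarrow> f t = x j" using assms(1) unfolding elementary_def by blast
  define S where "S j = (\<lambda>t. t + \<tau>) -` T j" for j
  have "S j \<in> sets lebesgue" for j
    using measurable_sets[OF measurable_lebesgue_shift T(2), of \<tau> j] by (simp add: S_def)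
  moreover have "UNIV - (\<Union>j. S j) \<in> null_sets lebesgue"
  proof -
    have "AE t in lebesgue. t \<in> (\<Union>j. T j)" using T(3) by (auto simp: completion.AE_iff_null_sets Compl_eq_Diff_UNIV[symmetric] Compl_eq)
    then have "AE t in lebesgue. t + \<tau> \<in> (\<Union>j. T j)" by (rule AE_lebesgue_shift)
    then have "{t. t + \<tau> \<notin> (\<Union>j. T j)} \<in> null_sets lebesgue" by (simp add: completion.AE_iff_null_sets)
    moreover have "UNIV - (\<Union>j. S j) = {t. t + \<tau> \<notin> (\<Union>j. T j)}" by (auto simp: S_def)
    ultimately show ?thesis by simp
  qed
  moreover have "disjoint_family S" using T(1) by (auto simp: S_def disjoint_family_on_def)
  ultimately show ?thesis
    unfolding elementary_def using T(4)
    by (intro exI[of _ x] exI[of _ S]) (auto simp: S_def)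
qed

text \<open>
  Membership in \<open>M_class\<close> without essential suprema, whose use requires measurability of distances. That measurability is itself a
  consequence of the approximation property (\<open>ae_approximable_dist_measurable\<close>).
\<close>
definition ae_approximable :: "(real \<Rightarrow> 'a::metric_space) \<Rightarrow> bool" where
  "ae_approximable f \<longleftrightarrow> (\<forall>\<epsilon>>0. \<exists>g. elementary g \<and> (AE t in lebesgue. dist (f t) (g t) < \<epsilon>))"

lemma elementary_ae_approximable: "elementary g \<Longrightarrow> ae_approximable g"
  unfolding ae_approximable_def by (intro allI impI exI[of _ g]) auto

lemma ae_approximable_dist_measurable:
  assumes "ae_approximable f" "ae_approximable g"
  shows "(\<lambda>t. dist (f t) (g t)) \<in> borel_measurable lebesgue"
proof -
  have seq: "\<exists>F. \<forall>n. elementary (F n) \<and> (AE t in lebesgue. dist (f t) (F n t) < 1 / real (Suc n))" if "ae_approximable f" for f :: "real \<Rightarrow> 'a"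
  proof (rule choice, rule allI)
    fix n
    have "1 / real (Suc n) > 0" by simp
    then show "\<exists>F. elementary F \<and> (AE t in lebesgue. dist (f t) (F t) < 1 / real (Suc n))"
      using that unfolding ae_approximable_def by blast
  qed
  obtain F where F: "\<And>n. elementary (F n)" "\<And>n. AE t in lebesgue. dist (f t) (F n t) < 1 / real (Suc n)"
    using seq[OF assms(1)] by blast
  obtain G where G: "\<And>n. elementary (G n)" "\<And>n. AE t in lebesgue. dist (g t) (G n t) < 1 / real (Suc n)"
    using seq[OF assms(2)] by blast
  have [measurable]: "(\<lambda>t. dist (F n t) (G n t)) \<in> borel_measurable lebesgue" for n
    using elementary_measurable[OF elementary_comp[OF elementary_Pair[OF F(1) G(1)], of "case_prod dist"]] by simp
  have "AE t in lebesgue. lim (\<lambda>n. dist (F n t) (G n t)) = dist (f t) (g t)"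
  proof -
    have "AE t in lebesgue. \<forall>n. dist (f t) (F n t) < 1 / real (Suc n) \<and> dist (g t) (G n t) < 1 / real (Suc n)"
      using F(2) G(2) by (simp add: AE_all_countable)
    then show ?thesis
    proof (rule AE_mp, intro AE_I2 impI)
      fix t assume t: "\<forall>n. dist (f t) (F n t) < 1 / real (Suc n) \<and> dist (g t) (G n t) < 1 / real (Suc n)"
      have inv: "(\<lambda>n. 1 / real (Suc n)) \<longlonglongrightarrow> 0" using LIMSEQ_inverse_real_of_nat by (simp add: inverse_eq_divide)
      have conv: "F' \<longlonglongrightarrow> f'" if "\<And>n. dist f' (F' n) < 1 / real (Suc n)" for f' :: 'a and F'
      proof (rule metric_LIMSEQ_I)
        fix r :: real assume "r > 0"
        then obtain no where "\<forall>n\<ge>no. 1 / real (Suc n) < r" using order_tendstoD(2)[OF inv] by (auto simp: eventually_sequentially)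
        then show "\<exists>no. \<forall>n\<ge>no. dist (F' n) f' < r" using that by (metis dist_commute order_less_trans)
      qed
      have "(\<lambda>n. dist (F n t) (G n t)) \<longlonglongrightarrow> dist (f t) (g t)"
        by (intro tendsto_dist conv) (use t in auto)
      then show "lim (\<lambda>n. dist (F n t) (G n t)) = dist (f t) (g t)" by (rule limI)
    qed
  qed
  moreover have "(\<lambda>t. lim (\<lambda>n. dist (F n t) (G n t))) \<in> borel_measurable lebesgue" by measurable
  ultimately show ?thesis by (rule borel_measurable_AE[rotated])
qed

lemma M_class_iff_ae_approximable: "f \<in> M_class \<longleftrightarrow> ae_approximable f"
proof
  assume f: "f \<in> M_class"
  show "ae_approximable f"
    unfolding ae_approximable_def
  proof safe
    fix \<epsilon> :: real assume "\<epsilon> > 0"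
    then obtain g where g: "elementary g" "esssup lebesgue (\<lambda>t. ereal (dist (f t) (g t))) < ereal \<epsilon>"
      using f by (auto simp: M_class_def)
    have "AE t in lebesgue. ereal (dist (f t) (g t)) \<le> esssup lebesgue (\<lambda>t. ereal (dist (f t) (g t)))"
      by (rule esssup_AE)
    then have "AE t in lebesgue. dist (f t) (g t) < \<epsilon>"
    proof eventually_elim
      case (elim t)
      then have "ereal (dist (f t) (g t)) < ereal \<epsilon>" using g(2) by (rule le_less_trans)
      then show ?case by simp
    qed
    with g(1) show "\<exists>g. elementary g \<and> (AE t in lebesgue. dist (f t) (g t) < \<epsilon>)" by blast
  qed
next
  assume f: "ae_approximable f"
  show "f \<in> M_class"
    unfolding M_class_def
  proof safe
    fix \<epsilon> :: real assume "\<epsilon> > 0"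
    then obtain g where g: "elementary g" "AE t in lebesgue. dist (f t) (g t) < \<epsilon> / 2"
      using f unfolding ae_approximable_def by (meson half_gt_zero)
    have "(\<lambda>t. dist (f t) (g t)) \<in> borel_measurable lebesgue"
      using f elementary_ae_approximable[OF g(1)] by (rule ae_approximable_dist_measurable)
    then have "esssup lebesgue (\<lambda>t. ereal (dist (f t) (g t))) \<le> ereal (\<epsilon> / 2)"
    proof (intro esssup_I)
      show "AE t in lebesgue. ereal (dist (f t) (g t)) \<le> ereal (\<epsilon> / 2)"
        using g(2) by eventually_elim simp
    qed simp
    also have "\<dots> < ereal \<epsilon>" using \<open>\<epsilon> > 0\<close> by simp
    finally show "\<exists>g. elementary g \<and> esssup lebesgue (\<lambda>t. ereal (dist (f t) (g t))) < ereal \<epsilon>"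
      using g(1) by blast
  qed
qed

lemma M_class_dist_measurable: "f \<in> M_class \<Longrightarrow> g \<in> M_class \<Longrightarrow> (\<lambda>t. dist (f t) (g t)) \<in> borel_measurable lebesgue"
  by (simp add: M_class_iff_ae_approximable ae_approximable_dist_measurable)

lemma M_class_shift:
  assumes "f \<in> M_class" shows "(\<lambda>t. f (t + \<tau>)) \<in> M_class"
  unfolding M_class_iff_ae_approximable ae_approximable_def
proof safe
  fix \<epsilon> :: real assume "\<epsilon> > 0"
  then obtain g where "elementary g" "AE t in lebesgue. dist (f t) (g t) < \<epsilon>"
    using assms unfolding M_class_iff_ae_approximable ae_approximable_def by blast
  then have "elementary (\<lambda>t. g (t + \<tau>))" "AE t in lebesgue. dist (f (t + \<tau>)) (g (t + \<tau>)) < \<epsilon>"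
    using AE_lebesgue_shift[of "\<lambda>t. dist (f t) (g t) < \<epsilon>"] elementary_shift by auto
  then show "\<exists>g. elementary g \<and> (AE t in lebesgue. dist (f (t + \<tau>)) (g t) < \<epsilon>)"
    by (intro exI[of _ "\<lambda>t. g (t + \<tau>)"] conjI)
qed

text \<open>If \<open>g j\<close> is elementary and close to \<open>f j\<close>, then the function equal to \<open>g j\<close> on \<open>T j\<close> is elementary
  with respect to the intersections of \<open>T j\<close> with the pieces of \<open>g j\<close>.\<close>
lemma M_class_piecewise_sum:
  assumes T: "disjoint_family T" "\<And>j. T j \<in> sets lebesgue" "UNIV - (\<Union>j. T j) \<in> null_sets lebesgue"
    and f: "\<And>j. f j \<in> M_class" and F: "piecewise_sum f T F"
  shows "F \<in> M_class"
  unfolding M_class_iff_ae_approximable ae_approximable_def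
proof safe
  fix \<epsilon> :: real assume "\<epsilon> > 0"
  then have "\<forall>j. \<exists>g. elementary g \<and> (AE t in lebesgue. dist (f j t) (g t) < \<epsilon>)"
    using f unfolding M_class_iff_ae_approximable ae_approximable_def by blast
  from choice[OF this] obtain g where g: "\<And>j. elementary (g j)" "\<And>j. AE t in lebesgue. dist (f j t) (g j t) < \<epsilon>" by blast
  obtain x S where S: "\<And>j. disjoint_family (S j :: nat \<Rightarrow> real set)" "\<And>j i. S j i \<in> sets lebesgue" "\<And>j. UNIV - (\<Union>i. S j i) \<in> null_sets lebesgue"
    "\<And>j i t. t \<in> S j i \<Longrightarrow> g j t = x j i"
  proof -
    have "\<forall>j. \<exists>x (S :: nat \<Rightarrow> real set). disjoint_family S \<and> (\<forall>i. S i \<in> sets lebesgue) \<and> UNIV - (\<Union>i. S i) \<in> null_sets lebesgue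
        \<and> (\<forall>i. \<forall>t\<in>S i. g j t = x i)" using g(1) unfolding elementary_def by blast
    then show thesis using that by metis
  qed
  define J where "J t = (THE j. t \<in> T j)" for t
  have J: "J t = j" if "t \<in> T j" for t j
    unfolding J_def using that T(1) by (intro the_equality) (auto simp: disjoint_family_on_def)
  define G where "G t = g (J t) t" for t
  define R where "R n = T (fst (prod_decode n)) \<inter> S (fst (prod_decode n)) (snd (prod_decode n))" for n
  have "elementary G"
    unfolding elementary_def
  proof (intro exI conjI allI ballI)
    show "disjoint_family R"
      unfolding disjoint_family_on_def
    proof safe
      fix m n t assume mn: "m \<noteq> n" "t \<in> R m" "t \<in> R n"
      from \<open>m \<noteq> n\<close> have "prod_decode m \<noteq> prod_decode n" using inj_prod_decode[of UNIV] by (auto dest: injD)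
      moreover have "fst (prod_decode m) = fst (prod_decode n)" 
        using J[of t "fst (prod_decode m)"] J[of t "fst (prod_decode n)"] mn(2,3) by (simp add: R_def)
      ultimately have "snd (prod_decode m) \<noteq> snd (prod_decode n)" by (simp add: prod_eq_iff)
      then show "t \<in> {}" using mn(2,3) S(1)[of "fst (prod_decode n)"] \<open>fst (prod_decode m) = _\<close>
        unfolding disjoint_family_on_def R_def by (metis Int_iff UNIV_I disjoint_iff)
    qed
    show "R n \<in> sets lebesgue" for n using T(2) S(2) by (simp add: R_def sets.Int)
    show "UNIV - (\<Union>n. R n) \<in> null_sets lebesgue"
    proof (rule completion.complete2)
      show "UNIV - (\<Union>n. R n) \<subseteq> (UNIV - (\<Union>j. T j)) \<union> (\<Union>j. UNIV - (\<Union>i. S j i))"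
      proof safe
        fix t j assume t: "t \<notin> (\<Union>n. R n)" "t \<notin> (\<Union>j. UNIV - (\<Union>i. S j i))" "t \<in> T j"
        then obtain i where "t \<in> S j i" by auto
        then have "t \<in> R (prod_encode (j, i))" using t by (simp add: R_def)
        then show False using t by auto
      qed
      show "(UNIV - (\<Union>j. T j)) \<union> (\<Union>j. UNIV - (\<Union>i. S j i)) \<in> null_sets lebesgue" using T(3) S(3) by (intro null_sets.Un null_sets_UN') auto
    qed
    show "G t = x (fst (prod_decode n)) (snd (prod_decode n))" if "t \<in> R n" for n t
      using that J[of t "fst (prod_decode n)"] S(4)[of t "fst (prod_decode n)" "snd (prod_decode n)"] by (simp add: R_def G_def)
  qed
  moreover have "AE t in lebesgue. dist (F t) (G t) < \<epsilon>"
  proof -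
    have "AE t in lebesgue. \<forall>j. dist (f j t) (g j t) < \<epsilon>" using g(2) by (simp add: AE_all_countable)
    moreover have "AE t in lebesgue. \<forall>j. t \<in> T j \<longrightarrow> F t = f j t" using F by (simp add: piecewise_sum_def)
    moreover have "AE t in lebesgue. t \<in> (\<Union>j. T j)" using T(3) by (auto simp: completion.AE_iff_null_sets Compl_eq_Diff_UNIV[symmetric] Compl_eq)
    ultimately show ?thesis by eventually_elim (auto simp: G_def J)
  qed
  ultimately show "\<exists>g. elementary g \<and> (AE t in lebesgue. dist (F t) (g t) < \<epsilon>)" by blast
qed

text \<open>
  A form of Lusin's theorem at one scale \<open>\<epsilon>\<close>. An elementary approximation is constant on each of finitely many disjoint
  closed sets that almost exhaust the interval, hence uniformly continuous on their union.
\<close>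
lemma M_class_almost_uniformly_continuous:
  fixes f :: "real \<Rightarrow> 'a::complete_space"
  assumes f: "f \<in> M_class" and "\<epsilon> > 0" "e > 0"
  obtains K \<delta> where "K \<subseteq> {a..b}" "K \<in> sets lebesgue" "measure lebesgue ({a..b} - K) < e" "\<delta> > 0"
    "\<And>s t. s \<in> K \<Longrightarrow> t \<in> K \<Longrightarrow> \<bar>s - t\<bar> < \<delta> \<Longrightarrow> dist (f s) (f t) < \<epsilon>"
proof -
  obtain g where g: "elementary g" "AE t in lebesgue. dist (f t) (g t) < \<epsilon> / 3"
    using f \<open>\<epsilon> > 0\<close> unfolding M_class_iff_ae_approximable ae_approximable_def by (metis divide_pos_pos zero_less_numeral)
  obtain x T where T: "disjoint_family (T :: nat \<Rightarrow> real set)" "\<And>j. T j \<in> sets lebesgue" "UNIV - (\<Union>j. T j) \<in> null_sets lebesgue"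
    "\<And>j t. t \<in> T j \<Longrightarrow> g t = x j" using g(1) unfolding elementary_def by blast
  define Z where "Z = {t. \<not> dist (f t) (g t) < \<epsilon> / 3}"
  have Z: "Z \<in> null_sets lebesgue" using g(2) by (simp add: Z_def completion.AE_iff_null_sets)
  define U where "U j = {a..b} \<inter> T j - Z" for j
  have U: "U j \<in> sets lebesgue" for j unfolding U_def
    by (intro sets.Diff sets.Int T(2) null_setsD2[OF Z]) simp
  define V where "V n = {a..b} - (\<Union>j<n. U j)" for n
  have V: "V n \<in> lmeasurable" for n unfolding V_def
    by (intro fmeasurable_Diff sets.finite_UN U) auto
  have "(\<lambda>n. emeasure lebesgue (V n)) \<longlonglongrightarrow> emeasure lebesgue (\<Inter>n. V n)"
  proof (rule Lim_emeasure_decseq)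
    show "range V \<subseteq> sets lebesgue" using V by auto
    show "decseq V" by (auto simp: decseq_def V_def)
    show "emeasure lebesgue (V n) \<noteq> \<infinity>" for n using fmeasurableD2[OF V] by simp
  qed
  moreover have "emeasure lebesgue (\<Inter>n. V n) = 0"
  proof -
    have "(\<Inter>n. V n) \<subseteq> Z \<union> (UNIV - (\<Union>j. T j))"
    proof (intro subsetI, rule ccontr)
      fix t assume t: "t \<in> (\<Inter>n. V n)" "t \<notin> Z \<union> (UNIV - (\<Union>j. T j))"
      then obtain j where j: "t \<in> T j" by auto
      from t(1) have "t \<in> V (Suc j)" by blast
      with t j show False by (auto simp: V_def U_def)
    qed
    then have "(\<Inter>n. V n) \<in> null_sets lebesgue" by (rule completion.complete2) (intro null_sets.Un Z T(3))
    then show ?thesis by auto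
  qed
  ultimately have "eventually (\<lambda>n. emeasure lebesgue (V n) < ennreal (e / 2)) sequentially"
    using \<open>e > 0\<close> by (intro order_tendstoD(2)) auto
  then obtain n where n: "emeasure lebesgue (V n) < ennreal (e / 2)" by (auto simp: eventually_sequentially)
  have "\<forall>j. \<exists>K. closed K \<and> K \<subseteq> U j \<and> U j - K \<in> lmeasurable \<and> emeasure lebesgue (U j - K) < ennreal (e / (2 * real (Suc n)))"
  proof
    fix j
    have "e / (2 * real (Suc n)) > 0" using \<open>e > 0\<close> by simp
    from sets_lebesgue_inner_closed[OF U this] show "\<exists>K. closed K \<and> K \<subseteq> U j \<and> U j - K \<in> lmeasurable \<and> emeasure lebesgue (U j - K) < ennreal (e / (2 * real (Suc n)))"
      by metis
  qed
  then obtain K where K: "\<And>j. closed (K j)" "\<And>j. K j \<subseteq> U j" "\<And>j. U j - K j \<in> lmeasurable"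
    "\<And>j. emeasure lebesgue (U j - K j) < ennreal (e / (2 * real (Suc n)))" by metis
  define C where "C = (\<Union>j<n. K j)"
  have C: "closed C" unfolding C_def using K(1) by auto
  have Csub: "C \<subseteq> {a..b}" using K(2) by (fastforce simp: C_def U_def)
  have "compact C" using compact_Int_closed[OF compact_Icc C, of a b] Csub by (simp add: Int_absorb1)
  have "continuous_on C g"
    unfolding C_def
  proof (rule continuous_on_closed_Union)
    fix j
    show "continuous_on (K j) g"
      by (rule continuous_on_eq[OF continuous_on_const[of _ "x j"]]) (use K(2)[of j] T(4) in \<open>auto simp: U_def\<close>)
  qed (use K(1) in auto)
  then have "uniformly_continuous_on C g" using \<open>compact C\<close> by (rule compact_uniformly_continuous)
  then obtain \<delta> where \<delta>: "\<delta> > 0" "\<And>s t. s \<in> C \<Longrightarrow> t \<in> C \<Longrightarrow> dist s t < \<delta> \<Longrightarrow> dist (g s) (g t) < \<epsilon> / 3"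
    using \<open>\<epsilon> > 0\<close> unfolding uniformly_continuous_on_def by (metis divide_pos_pos zero_less_numeral)
  show thesis
  proof
    show "C \<subseteq> {a..b}" by fact
    show "C \<in> sets lebesgue" using C by (simp add: borel_closed)
    show "\<delta> > 0" by fact
    show "measure lebesgue ({a..b} - C) < e"
    proof -
      have L: "(\<Union>j<n. U j - K j) \<in> lmeasurable" using K(3) by (intro fmeasurable.finite_UN) auto
      have m: "measure lebesgue (U j - K j) \<le> e / (2 * real (Suc n))" for j
        using K(3)[of j] K(4)[of j] \<open>e > 0\<close> by (simp add: emeasure_eq_measure2 ennreal_less_iff less_imp_le)
      have "{a..b} - C \<subseteq> V n \<union> (\<Union>j<n. U j - K j)" by (auto simp: V_def C_def)
      then have "measure lebesgue ({a..b} - C) \<le> measure lebesgue (V n \<union> (\<Union>j<n. U j - K j))"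
        using V L C by (intro measure_mono_fmeasurable) (auto intro!: borel_closed fmeasurable.Un)
      also have "\<dots> \<le> measure lebesgue (V n) + measure lebesgue (\<Union>j<n. U j - K j)"
        using V L by (intro measure_Un_le) auto
      also have "measure lebesgue (\<Union>j<n. U j - K j) \<le> (\<Sum>j<n. measure lebesgue (U j - K j))"
        using K(3) by (intro measure_UNION_le) auto
      also have "\<dots> \<le> (\<Sum>j<n. e / (2 * real (Suc n)))" by (intro sum_mono m)
      also have "\<dots> \<le> e / 2" using \<open>e > 0\<close> by (simp add: field_simps)
      finally have "measure lebesgue ({a..b} - C) \<le> measure lebesgue (V n) + e / 2" by simp
      moreover have "measure lebesgue (V n) < e / 2" using n V[of n] \<open>e > 0\<close> by (simp add: emeasure_eq_measure2 ennreal_less_iff)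
      ultimately show ?thesis by simp
    qed
    fix s t assume st: "s \<in> C" "t \<in> C" "\<bar>s - t\<bar> < \<delta>"
    have "dist (f u) (g u) < \<epsilon> / 3" if "u \<in> C" for u
      using that K(2) unfolding C_def U_def Z_def by blast
    then show "dist (f s) (f t) < \<epsilon>"
      using st \<delta>(2)[of s t] dist_triangle_third[of "f s" "g s" \<epsilon> "g t" "f t"] by (auto simp: dist_real_def dist_commute)
  qed
qed

section \<open>Averages over windows\<close>

definition bounded_density :: "(real \<Rightarrow> real) \<Rightarrow> bool" where
  "bounded_density h \<longleftrightarrow> h \<in> borel_measurable lebesgue \<and> (\<forall>t. 0 \<le> h t) \<and> (\<exists>B. \<forall>t. h t \<le> B)"

definition window :: "real \<Rightarrow> (real \<Rightarrow> real) \<Rightarrow> real \<Rightarrow> real" where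
  "window l h \<xi> = (LINT t:{\<xi>..\<xi> + l}|lebesgue. h t)"

definition window_sup :: "real \<Rightarrow> (real \<Rightarrow> real) \<Rightarrow> real" where
  "window_sup l h = (SUP \<xi>\<in>UNIV. 1 / l * (LINT t:{\<xi>..\<xi> + l}|lebesgue. h t))"

lemma bounded_density_add: "bounded_density h \<Longrightarrow> bounded_density k \<Longrightarrow> bounded_density (\<lambda>t. h t + k t)"
  unfolding bounded_density_def by (auto intro!: borel_measurable_add) (meson add_mono)

lemma bounded_density_zero: "bounded_density (\<lambda>_. 0)"
  by (auto simp: bounded_density_def)

lemma bounded_density_sum: "(\<And>i. i \<in> I \<Longrightarrow> bounded_density (h i)) \<Longrightarrow> bounded_density (\<lambda>t. \<Sum>i\<in>I. h i t)"
  by (induction I rule: infinite_finite_induct) (auto intro: bounded_density_add simp: bounded_density_zero)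

lemma bounded_density_shift: "bounded_density h \<Longrightarrow> bounded_density (\<lambda>t. h (t + \<tau>))"
  unfolding bounded_density_def using measurable_compose[OF measurable_lebesgue_shift] by blast

lemma bounded_density_set_integrable:
  assumes h: "bounded_density h"
  shows "set_integrable lebesgue {a..b} h"
proof -
  obtain B where B: "\<And>t. h t \<le> B" using h by (auto simp: bounded_density_def)
  have hm: "h \<in> borel_measurable lebesgue" using h by (simp add: bounded_density_def)
  have "integrable lebesgue (\<lambda>t. indicator {a..b} t * B :: real)"
    by (intro integrable_mult_left lmeasurable_iff_integrable[THEN iffD1]) simp
  then show ?thesis
    unfolding set_integrable_def
  proof (rule Bochner_Integration.integrable_bound)
    show "AE t in lebesgue. norm (indicat_real {a..b} t *\<^sub>R h t) \<le> norm (indicat_real {a..b} t * B)"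
      using h B by (intro AE_I2) (auto simp: bounded_density_def indicator_def intro: order_trans[OF B abs_ge_self])
    show "(\<lambda>t. indicat_real {a..b} t *\<^sub>R h t) \<in> borel_measurable lebesgue"
      by (intro borel_measurable_scaleR borel_measurable_indicator hm) simp
  qed
qed

lemma window_mono_AE:
  assumes "bounded_density h" "bounded_density k" "AE t in lebesgue. h t \<le> k t"
  shows "window l h \<xi> \<le> window l k \<xi>"
  unfolding window_def set_lebesgue_integral_def
proof (rule integral_mono_AE)
  show "integrable lebesgue (\<lambda>t. indicat_real {\<xi>..\<xi>+l} t *\<^sub>R h t)" "integrable lebesgue (\<lambda>t. indicat_real {\<xi>..\<xi>+l} t *\<^sub>R k t)"
    using assms bounded_density_set_integrable unfolding set_integrable_def by blast+
  show "AE t in lebesgue. indicat_real {\<xi>..\<xi>+l} t *\<^sub>R h t \<le> indicat_real {\<xi>..\<xi>+l} t *\<^sub>R k t"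
    using assms(3) by eventually_elim (simp add: indicator_def)
qed

lemma window_add:
  assumes "bounded_density h" "bounded_density k"
  shows "window l (\<lambda>t. h t + k t) \<xi> = window l h \<xi> + window l k \<xi>"
  unfolding window_def using assms by (intro set_integral_add bounded_density_set_integrable)

lemma window_shift: "window l (\<lambda>t. h (t + \<tau>)) \<xi> = window l h (\<xi> + \<tau>)"
proof -
  have "window l h (\<xi> + \<tau>) = \<bar>1\<bar> *\<^sub>R (LINT t|lebesgue. indicat_real {\<xi>+\<tau>..\<xi>+\<tau>+l} (\<tau> + 1 * t) *\<^sub>R h (\<tau> + 1 * t))"
    unfolding window_def set_lebesgue_integral_def by (rule lebesgue_integral_real_affine) simp
  also have "\<dots> = window l (\<lambda>t. h (t + \<tau>)) \<xi>"
    unfolding window_def set_lebesgue_integral_def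
    by (auto intro!: Bochner_Integration.integral_cong simp: indicator_def add.commute)
  finally show ?thesis ..
qed

lemma window_nonneg: "bounded_density h \<Longrightarrow> 0 \<le> window l h \<xi>"
  unfolding window_def set_lebesgue_integral_def
  by (intro Bochner_Integration.integral_nonneg) (simp add: bounded_density_def)

lemma window_const: "l \<ge> 0 \<Longrightarrow> window l (\<lambda>_. c) \<xi> = l * c"
  unfolding window_def set_lebesgue_integral_def by simp

lemma window_sup_alt: "window_sup l h = (SUP \<xi>. window l h \<xi> / l)"
  by (simp add: window_sup_def window_def)

context
  fixes h :: "real \<Rightarrow> real" and l :: real
  assumes h: "bounded_density h" and l: "l > 0"
begin

lemma window_bdd: "bdd_above (range (\<lambda>\<xi>. window l h \<xi> / l))"
proof -
  obtain B where B: "\<And>t. h t \<le> B" using h by (auto simp: bounded_density_def)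
  moreover have "B \<ge> 0" using B[of 0] h by (meson bounded_density_def order_trans)
  ultimately have "window l h \<xi> \<le> window l (\<lambda>_. B) \<xi>" for \<xi>
    by (intro window_mono_AE h) (auto simp: bounded_density_def)
  then have "window l h \<xi> / l \<le> B" for \<xi> using l by (simp add: window_const field_simps)
  then show ?thesis by (intro bdd_aboveI[of _ B]) auto
qed

lemma window_le_window_sup: "window l h \<xi> \<le> l * window_sup l h"
proof -
  have "window l h \<xi> / l \<le> window_sup l h"
    unfolding window_sup_alt by (intro cSUP_upper window_bdd) simp
  then show ?thesis using l by (simp add: field_simps)
qed

lemma window_sup_nonneg: "0 \<le> window_sup l h"
  using window_le_window_sup[of 0] window_nonneg[OF h, of l 0] l by (metis mult_le_cancel_left_pos mult_zero_right order_trans)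

lemma window_sup_shift: "window_sup l (\<lambda>t. h (t + \<tau>)) = window_sup l h"
proof -
  have "range (\<lambda>\<xi>. window l h (\<xi> + \<tau>) / l) = range (\<lambda>\<xi>. window l h \<xi> / l)"
  proof safe
    fix \<xi>
    have "window l h \<xi> / l = window l h ((\<xi> - \<tau>) + \<tau>) / l" by simp
    then show "window l h \<xi> / l \<in> range (\<lambda>\<xi>. window l h (\<xi> + \<tau>) / l)" by blast
  qed auto
  then show ?thesis unfolding window_sup_alt window_shift by simp
qed

lemma window_mult_le: "window (real n * l) h \<xi> \<le> real n * (l * window_sup l h)"
proof (induction n)
  case 0
  obtain B where B: "\<And>t. h t \<le> B" using h by (auto simp: bounded_density_def)
  moreover have "B \<ge> 0" using B[of 0] h by (meson bounded_density_def order_trans)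
  ultimately have "window 0 h \<xi> \<le> window 0 (\<lambda>_. B) \<xi>"
    by (intro window_mono_AE h) (auto simp: bounded_density_def)
  then show ?case by (simp add: window_const)
next
  case (Suc n)
  have i: "integrable lebesgue (\<lambda>t. indicat_real {u..v} t *\<^sub>R h t)" for u v
    using bounded_density_set_integrable[OF h] unfolding set_integrable_def .
  have "window (real (Suc n) * l) h \<xi> \<le> (LINT t|lebesgue. indicat_real {\<xi>..\<xi>+real n * l} t *\<^sub>R h t + indicat_real {\<xi>+real n * l..\<xi>+real n * l+l} t *\<^sub>R h t)"
    unfolding window_def set_lebesgue_integral_def
    using h by (intro integral_mono i Bochner_Integration.integrable_add) (auto simp: indicator_def bounded_density_def algebra_simps)
  also have "\<dots> = window (real n * l) h \<xi> + window l h (\<xi> + real n * l)"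
    unfolding window_def set_lebesgue_integral_def by (intro Bochner_Integration.integral_add i)
  also have "\<dots> \<le> real n * (l * window_sup l h) + l * window_sup l h"
    using Suc window_le_window_sup by (rule add_mono)
  finally show ?case by (simp add: algebra_simps)
qed

text \<open>A window of length \<open>L\<close> is covered by consecutive windows of length \<open>l\<close> of total length at most \<open>L + l\<close>.
  So passing to longer windows essentially does not increase the largest average.\<close>
lemma window_sup_longer:
  assumes L: "L > 0"
  shows "window_sup L h \<le> (1 + l / L) * window_sup l h"
  unfolding window_sup_alt[of L]
proof (rule cSUP_least)
  fix \<xi>
  define n where "n = nat \<lceil>L / l\<rceil>"
  have "real n = of_int \<lceil>L / l\<rceil>" unfolding n_def using L l by simp
  then have n: "L / l \<le> real n" "real n \<le> L / l + 1" by linarith+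
  have nl: "L \<le> real n * l" "real n * l \<le> L + l" using n l by (auto simp: field_simps)
  have "window L h \<xi> \<le> window (real n * l) h \<xi>"
    unfolding window_def set_lebesgue_integral_def
    using h nl bounded_density_set_integrable[OF h] unfolding set_integrable_def
    by (intro integral_mono) (auto simp: indicator_def bounded_density_def)
  also have "\<dots> \<le> (real n * l) * window_sup l h" using window_mult_le by (simp add: mult.assoc)
  also have "\<dots> \<le> (L + l) * window_sup l h" using nl window_sup_nonneg by (intro mult_right_mono)
  finally show "window L h \<xi> / L \<le> (1 + l / L) * window_sup l h" using L by (simp add: field_simps)
qed simp

end

lemma window_sup_le: "l > 0 \<Longrightarrow> (\<And>\<xi>. window l h \<xi> \<le> l * c) \<Longrightarrow> window_sup l h \<le> c"
  unfolding window_sup_alt by (intro cSUP_least) (auto simp: field_simps)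

lemma window_sup_mono_AE:
  assumes "bounded_density h" "bounded_density k" "AE t in lebesgue. h t \<le> k t" "l > 0"
  shows "window_sup l h \<le> window_sup l k"
  using assms by (intro window_sup_le) (auto intro: order_trans[OF window_mono_AE window_le_window_sup])

lemma window_sup_add:
  assumes "bounded_density h" "bounded_density k" "l > 0"
  shows "window_sup l (\<lambda>t. h t + k t) \<le> window_sup l h + window_sup l k"
  using assms by (intro window_sup_le) (auto simp: window_add distrib_left intro: add_mono window_le_window_sup)

lemma window_sup_zero: "l > 0 \<Longrightarrow> window_sup l (\<lambda>_. 0) = 0"
  by (simp add: window_sup_alt window_const)

lemma window_sup_sum:
  assumes "\<And>i. i \<in> I \<Longrightarrow> bounded_density (h i)" "l > 0"
  shows "window_sup l (\<lambda>t. \<Sum>i\<in>I. h i t) \<le> (\<Sum>i\<in>I. window_sup l (h i))"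
  using assms(1)
proof (induction I rule: infinite_finite_induct)
  case (insert i I)
  then have "window_sup l (\<lambda>t. h i t + (\<Sum>i\<in>I. h i t)) \<le> window_sup l (h i) + window_sup l (\<lambda>t. \<Sum>i\<in>I. h i t)"
    using assms(2) by (intro window_sup_add bounded_density_sum) auto
  with insert show ?case by fastforce
qed (simp_all add: window_sup_zero assms(2))

lemma window_sup_eventually_small:
  assumes h: "bounded_density h" and small: "window_sup l h < c" and l: "l > 0"
  obtains L0 where "L0 > 0" "\<And>L. L \<ge> L0 \<Longrightarrow> window_sup L h < c"
proof -
  have "((\<lambda>L. (1 + l / L) * window_sup l h) \<longlongrightarrow> (1 + 0) * window_sup l h) at_top"
    by (intro tendsto_intros tendsto_divide_0[OF tendsto_const] filterlim_at_top_imp_at_infinity filterlim_ident)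
  then have "eventually (\<lambda>L. (1 + l / L) * window_sup l h < c) at_top"
    using small by (auto elim: order_tendstoD)
  then obtain L0 where L0: "\<And>L. L \<ge> L0 \<Longrightarrow> (1 + l / L) * window_sup l h < c"
    by (auto simp: eventually_at_top_linorder)
  show thesis
  proof (rule that)
    show "max L0 1 > 0" by simp
    fix L assume "L \<ge> max L0 1"
    then show "window_sup L h < c" using window_sup_longer[OF h l, of L] L0[of L] by auto
  qed
qed

text \<open>By the comparison of window lengths the largest averages converge to their infimum, which is therefore \<open>norm1 h\<close>.\<close>
lemma norm1_less_imp_window_sup:
  assumes h: "bounded_density h" and small: "norm1 h < c"
  obtains l where "l > 0" "window_sup l h < c"
proof -
  define s where "s = (INF l\<in>{0<..}. window_sup l h)"
  have bdd: "bdd_below ((\<lambda>l. window_sup l h) ` {0<..})"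
    by (intro bdd_belowI[of _ 0]) (auto intro: window_sup_nonneg[OF h])
  have s_le: "s \<le> window_sup l h" if "l > 0" for l
    unfolding s_def using that by (intro cINF_lower bdd) auto
  have less: "\<exists>l>0. window_sup l h < u" if "s < u" for u
    using that unfolding s_def by (subst (asm) cINF_less_iff) (auto intro: bdd)
  have "((\<lambda>l. window_sup l h) \<longlongrightarrow> s) at_top"
  proof (rule order_tendstoI)
    fix u assume "u < s"
    show "eventually (\<lambda>l. u < window_sup l h) at_top"
      using eventually_gt_at_top[of 0] 
    proof eventually_elim
      case (elim l)
      with \<open>u < s\<close> show ?case using s_le by (meson less_le_trans)
    qed
  next
    fix u assume "s < u"
    then obtain l where "l > 0" "window_sup l h < u" using less by blast
    then obtain L0 where "L0 > 0" "\<And>L. L \<ge> L0 \<Longrightarrow> window_sup L h < u"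
      using window_sup_eventually_small[OF h] by blast
    then show "eventually (\<lambda>l. window_sup l h < u) at_top" by (auto simp: eventually_at_top_linorder)
  qed
  moreover have "(\<lambda>l. window_sup l h) = (\<lambda>l. SUP \<xi>\<in>UNIV. 1 / l * (LINT t:{\<xi>..\<xi> + l}|lebesgue. \<bar>h t\<bar>))"
    using h by (simp add: window_sup_def bounded_density_def)
  ultimately have "norm1 h = s" unfolding norm1_def by (metis tendsto_Lim trivial_limit_at_top_linorder)
  then show thesis using less small that by blast
qed

section \<open>The seminorm of an equi-Weyl almost periodic function\<close>

lemma dist_trunc_nonneg: "0 \<le> dist_trunc x y" and dist_trunc_le_1: "dist_trunc x y \<le> 1"
  and dist_trunc_self: "dist_trunc x x = 0" and dist_trunc_commute: "dist_trunc x y = dist_trunc y x"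
  by (auto simp: dist_trunc_def dist_commute)

lemma dist_trunc_le_dist: "dist_trunc x y \<le> dist x y"
  by (simp add: dist_trunc_def)

lemma dist_trunc_triangle: "dist_trunc x z \<le> dist_trunc x y + dist_trunc y z"
  using dist_triangle[of x z y] unfolding dist_trunc_def by (smt (verit) zero_le_dist)

lemma bounded_density_dist_trunc:
  assumes "f \<in> M_class" "g \<in> M_class" shows "bounded_density (\<lambda>t. dist_trunc (f t) (g t))"
  unfolding bounded_density_def
proof (intro conjI exI allI)
  show "(\<lambda>t. dist_trunc (f t) (g t)) \<in> borel_measurable lebesgue"
    unfolding dist_trunc_def by (intro borel_measurable_min M_class_dist_measurable assms) simp
qed (rule dist_trunc_nonneg dist_trunc_le_1)+

definition shift_dist :: "(real \<Rightarrow> 'a::metric_space) \<Rightarrow> real \<Rightarrow> real \<Rightarrow> real" where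
  "shift_dist f \<tau> t = dist_trunc (f t) (f (t + \<tau>))"

lemma D_dist_shift_eq: "D_dist l f (\<lambda>t. f (t + \<tau>)) = window_sup l (shift_dist f \<tau>)"
  by (simp add: D_dist_def window_sup_def shift_dist_def)

lemma bounded_density_shift_dist: "f \<in> M_class \<Longrightarrow> bounded_density (shift_dist f \<tau>)"
  unfolding shift_dist_def by (intro bounded_density_dist_trunc M_class_shift)

lemma window_subset:
  assumes h: "bounded_density h" and "a \<le> \<xi>" "\<xi> + l \<le> a + L"
  shows "window l h \<xi> \<le> window L h a"
  unfolding window_def set_lebesgue_integral_def
  using assms bounded_density_set_integrable[OF h] unfolding set_integrable_def
  by (intro integral_mono) (auto simp: indicator_def bounded_density_def)

text \<open>
  Continuity of translations on a fixed interval: the distance is small unless \<open>t\<close> or \<open>t + h\<close> lies in the small set \<open>C\<close> outside which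
  \<open>f\<close> is nearly uniformly continuous. The interval is enlarged by \<open>1\<close> on both sides to make room for \<open>t + h\<close>.
\<close>
lemma window_shift_dist_small:
  assumes f: "f \<in> M_class" and "b \<ge> 0" "\<epsilon> > 0"
  obtains h0 where "h0 > 0" "\<And>h. \<bar>h\<bar> < h0 \<Longrightarrow> window b (shift_dist f h) 0 \<le> \<epsilon>"
proof -
  define \<epsilon>' where "\<epsilon>' = \<epsilon> / (2 * (b + 1))"
  have \<epsilon>': "\<epsilon>' > 0" "\<epsilon> / 4 > 0" using assms by (auto simp: \<epsilon>'_def)
  obtain K \<delta> where K: "K \<subseteq> {-1..b+1}" "K \<in> sets lebesgue" "measure lebesgue ({-1..b+1} - K) < \<epsilon> / 4" "\<delta> > 0"
    "\<And>s t. s \<in> K \<Longrightarrow> t \<in> K \<Longrightarrow> \<bar>s - t\<bar> < \<delta> \<Longrightarrow> dist (f s) (f t) < \<epsilon>'"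
    using M_class_almost_uniformly_continuous[OF f \<epsilon>', of "-1" "b+1"] by blast
  define C where "C = {-1..b+1} - K"
  have C: "C \<in> lmeasurable" unfolding C_def by (intro fmeasurable_Diff K(2)) simp
  have iC: "integrable lebesgue (indicat_real C)" using C by (simp add: lmeasurable_iff_integrable)
  show thesis
  proof
    show "min 1 \<delta> > 0" using K by simp
    fix h assume h: "\<bar>h\<bar> < min 1 \<delta>"
    have iCh: "integrable lebesgue (\<lambda>t. indicat_real C (h + 1 * t))"
      using iC by (subst lebesgue_integrable_real_affine_iff) auto
    have eCh: "(LINT t|lebesgue. indicat_real C (h + 1 * t)) = measure lebesgue C"
      using lebesgue_integral_real_affine[of 1 "indicat_real C" h] C by (simp add: fmeasurableD)
    have i0: "integrable lebesgue (\<lambda>t. indicat_real {0..b} t * \<epsilon>')"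
      by (intro integrable_mult_left lmeasurable_iff_integrable[THEN iffD1]) simp
    have "window b (shift_dist f h) 0 \<le> (LINT t|lebesgue. indicat_real {0..b} t * \<epsilon>' + indicat_real C t + indicat_real C (h + 1 * t))"
      unfolding window_def set_lebesgue_integral_def
    proof (rule integral_mono)
      show "integrable lebesgue (\<lambda>t. indicat_real {0..0+b} t *\<^sub>R shift_dist f h t)"
        using bounded_density_set_integrable[OF bounded_density_shift_dist[OF f]] unfolding set_integrable_def .
      show "integrable lebesgue (\<lambda>t. indicat_real {0..b} t * \<epsilon>' + indicat_real C t + indicat_real C (h + 1 * t))"
        by (intro Bochner_Integration.integrable_add i0 iC iCh)
      fix t
      show "indicat_real {0..0+b} t *\<^sub>R shift_dist f h t \<le> indicat_real {0..b} t * \<epsilon>' + indicat_real C t + indicat_real C (h + 1 * t)"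
      proof (cases "t \<in> {0..b}")
        case True
        show ?thesis
        proof (cases "t \<in> C \<or> t + h \<in> C")
          case True
          then have "1 \<le> indicat_real C t + indicat_real C (h + 1 * t)" by (auto simp: indicator_def add.commute)
          moreover have "indicat_real {0..0+b} t *\<^sub>R shift_dist f h t \<le> 1"
            by (simp add: indicator_def shift_dist_def dist_trunc_le_1)
          moreover have "indicat_real {0..b} t * \<epsilon>' \<ge> 0" using \<epsilon>' by simp
          ultimately show ?thesis by linarith
        next
          case False
          then have "t \<in> K" "t + h \<in> K" using \<open>t \<in> {0..b}\<close> h by (auto simp: C_def)
          then have "dist (f t) (f (t + h)) < \<epsilon>'" using K(5)[of t "t + h"] h by auto
          then have "shift_dist f h t \<le> \<epsilon>'" unfolding shift_dist_def using dist_trunc_le_dist order_trans less_imp_le by metis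
          then show ?thesis using \<open>t \<in> {0..b}\<close> by (simp add: indicator_def)
        qed
      qed auto
    qed
    also have "\<dots> = b * \<epsilon>' + measure lebesgue C + measure lebesgue C"
      using C assms(2) by (simp only: Bochner_Integration.integral_add[OF Bochner_Integration.integrable_add[OF i0 iC] iCh]
          Bochner_Integration.integral_add[OF i0 iC] eCh) (simp add: fmeasurableD)
    also have "\<dots> \<le> \<epsilon> / 2 + \<epsilon> / 4 + \<epsilon> / 4"
    proof -
      have "b * \<epsilon>' \<le> (b + 1) * \<epsilon>'" using \<epsilon>' by simp
      also have "\<dots> = \<epsilon> / 2"
      proof -
        have "c * (\<epsilon> / (2 * c)) = \<epsilon> / 2" if "c > 0" for c :: real using that by simp
        from this[of "b + 1"] show ?thesis unfolding \<epsilon>'_def using assms(2) by simp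
      qed
      finally show ?thesis using K(3) unfolding C_def by linarith
    qed
    finally show "window b (shift_dist f h) 0 \<le> \<epsilon>" by simp
  qed
qed

definition weyl_seminorm :: "(real \<Rightarrow> 'a::metric_space) \<Rightarrow> real \<Rightarrow> real" where
  "weyl_seminorm f \<tau> = (INF l\<in>{0<..}. window_sup l (shift_dist f \<tau>))"

context
  fixes f :: "real \<Rightarrow> 'a::complete_space"
  assumes f: "f \<in> M_class"
begin

lemma shift_dist_zero: "window_sup l (shift_dist f 0) = 0" if "l > 0"
  using window_sup_zero[OF that] by (simp add: shift_dist_def[abs_def] dist_trunc_self)

lemma shift_dist_minus: "window_sup l (shift_dist f (-\<tau>)) = window_sup l (shift_dist f \<tau>)" if "l > 0"
proof -
  have "window_sup l (\<lambda>t. shift_dist f (-\<tau>) (t + \<tau>)) = window_sup l (shift_dist f (-\<tau>))"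
    using bounded_density_shift_dist[OF f] that by (rule window_sup_shift)
  then show ?thesis by (simp add: shift_dist_def[abs_def] dist_trunc_commute)
qed

lemma shift_dist_add: "window_sup l (shift_dist f (\<tau> + \<sigma>)) \<le> window_sup l (shift_dist f \<tau>) + window_sup l (shift_dist f \<sigma>)" if "l > 0"
proof -
  have "window_sup l (shift_dist f (\<tau> + \<sigma>)) \<le> window_sup l (\<lambda>t. shift_dist f \<tau> t + shift_dist f \<sigma> (t + \<tau>))"
    using that dist_trunc_triangle
    by (intro window_sup_mono_AE bounded_density_add bounded_density_shift bounded_density_shift_dist f AE_I2)
      (auto simp: shift_dist_def add.assoc)
  also have "\<dots> \<le> window_sup l (shift_dist f \<tau>) + window_sup l (\<lambda>t. shift_dist f \<sigma> (t + \<tau>))"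
    using that by (intro window_sup_add bounded_density_shift bounded_density_shift_dist f)
  also have "window_sup l (\<lambda>t. shift_dist f \<sigma> (t + \<tau>)) = window_sup l (shift_dist f \<sigma>)"
    using that by (intro window_sup_shift bounded_density_shift_dist f)
  finally show ?thesis .
qed

lemma weyl_seminorm_bdd: "bdd_below ((\<lambda>l. window_sup l (shift_dist f \<tau>)) ` {0<..})"
  by (intro bdd_belowI[of _ 0]) (auto intro: window_sup_nonneg[OF bounded_density_shift_dist[OF f]])

lemma weyl_seminorm_le: "l > 0 \<Longrightarrow> weyl_seminorm f \<tau> \<le> window_sup l (shift_dist f \<tau>)"
  unfolding weyl_seminorm_def by (intro cINF_lower weyl_seminorm_bdd) auto

lemma weyl_seminorm_nonneg: "0 \<le> weyl_seminorm f \<tau>"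
  unfolding weyl_seminorm_def by (intro cINF_greatest) (auto intro: window_sup_nonneg[OF bounded_density_shift_dist[OF f]])

lemma weyl_seminorm_less_eventually:
  assumes "weyl_seminorm f \<tau> < c"
  shows "eventually (\<lambda>L. window_sup L (shift_dist f \<tau>) < c) at_top"
proof -
  obtain l where "l > 0" "window_sup l (shift_dist f \<tau>) < c"
    using assms unfolding weyl_seminorm_def by (subst (asm) cINF_less_iff) (auto intro: weyl_seminorm_bdd)
  then obtain L0 where "L0 > 0" "\<And>L. L \<ge> L0 \<Longrightarrow> window_sup L (shift_dist f \<tau>) < c"
    using window_sup_eventually_small[OF bounded_density_shift_dist[OF f]] by blast
  then show ?thesis by (auto simp: eventually_at_top_linorder)
qed

lemma weyl_seminorm_add: "weyl_seminorm f (\<tau> + \<sigma>) \<le> weyl_seminorm f \<tau> + weyl_seminorm f \<sigma>"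
proof (rule field_le_epsilon)
  fix e :: real assume "e > 0"
  then have less: "weyl_seminorm f x < weyl_seminorm f x + e / 2" for x by simp
  have "eventually (\<lambda>L. window_sup L (shift_dist f \<tau>) < weyl_seminorm f \<tau> + e / 2
      \<and> window_sup L (shift_dist f \<sigma>) < weyl_seminorm f \<sigma> + e / 2 \<and> 0 < L) at_top"
    by (intro eventually_conj weyl_seminorm_less_eventually less eventually_gt_at_top)
  then obtain L where L: "window_sup L (shift_dist f \<tau>) < weyl_seminorm f \<tau> + e / 2"
      "window_sup L (shift_dist f \<sigma>) < weyl_seminorm f \<sigma> + e / 2" "0 < L"
    unfolding eventually_at_top_linorder by blast
  then show "weyl_seminorm f (\<tau> + \<sigma>) \<le> weyl_seminorm f \<tau> + weyl_seminorm f \<sigma> + e"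
    using weyl_seminorm_le[of L "\<tau> + \<sigma>"] shift_dist_add[of L \<tau> \<sigma>] by linarith
qed

end

lemma W_class_M_class: "f \<in> W_class \<Longrightarrow> f \<in> M_class"
  by (simp add: W_class_def)

lemma W_class_relatively_dense:
  assumes "f \<in> W_class" "\<epsilon> > 0"
  obtains l a where "l > 0" "a > 0" "\<And>\<xi>. \<exists>\<tau>. \<xi> \<le> \<tau> \<and> \<tau> \<le> \<xi> + a \<and> window_sup l (shift_dist f \<tau>) < \<epsilon>"
proof -
  obtain l where "l > 0" "relatively_dense {\<tau>. window_sup l (shift_dist f \<tau>) < \<epsilon>}"
    using assms unfolding W_class_def D_dist_shift_eq by blast
  moreover then obtain a where "a > 0" "\<And>\<xi>. {\<xi>..\<xi>+a} \<inter> {\<tau>. window_sup l (shift_dist f \<tau>) < \<epsilon>} \<noteq> {}"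
    unfolding relatively_dense_def by blast
  ultimately show thesis by (intro that[of l a]) (auto simp: set_eq_iff)
qed

text \<open>
  An almost period \<open>\<tau>\<close> moves an arbitrary window into \<open>{0..a + l}\<close>, where translations are continuous; it is used twice, for
  \<open>t\<close> and for \<open>t + h\<close>.
\<close>
lemma W_class_shift_continuous:
  assumes f: "f \<in> W_class" and "\<epsilon> > 0"
  obtains l h0 where "l > 0" "h0 > 0" "\<And>h. \<bar>h\<bar> < h0 \<Longrightarrow> window_sup l (shift_dist f h) < \<epsilon>"
proof -
  note fM = W_class_M_class[OF f]
  note bd = bounded_density_shift_dist[OF fM]
  obtain l a where l: "l > 0" and a: "a > 0" and dense: "\<And>\<xi>. \<exists>\<tau>. \<xi> \<le> \<tau> \<and> \<tau> \<le> \<xi> + a \<and> window_sup l (shift_dist f \<tau>) < \<epsilon> / 4"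
    using W_class_relatively_dense[OF f, of "\<epsilon> / 4"] \<open>\<epsilon> > 0\<close> by auto
  obtain h0 where h0: "h0 > 0" "\<And>h. \<bar>h\<bar> < h0 \<Longrightarrow> window (a + l) (shift_dist f h) 0 \<le> l * (\<epsilon> / 4)"
    using window_shift_dist_small[OF fM, of "a + l" "l * (\<epsilon> / 4)"] l a \<open>\<epsilon> > 0\<close> by auto
  show thesis
  proof (rule that[OF l h0(1)])
    fix h assume h: "\<bar>h\<bar> < h0"
    have "window_sup l (shift_dist f h) \<le> 3 / 4 * \<epsilon>"
    proof (rule window_sup_le[OF l])
      fix \<xi>
      obtain \<tau> where \<tau>: "-\<xi> \<le> \<tau>" "\<tau> \<le> -\<xi> + a" "window_sup l (shift_dist f \<tau>) < \<epsilon> / 4" using dense[of "-\<xi>"] by auto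
      have "window l (shift_dist f h) \<xi> \<le> window l (\<lambda>t. shift_dist f \<tau> t + (shift_dist f h (t + \<tau>) + shift_dist f \<tau> (t + h))) \<xi>"
      proof (intro window_mono_AE bounded_density_add bounded_density_shift bd AE_I2)
        fix t
        have "dist_trunc (f t) (f (t + h)) \<le> dist_trunc (f t) (f (t + \<tau>)) + (dist_trunc (f (t + \<tau>)) (f (t + \<tau> + h)) + dist_trunc (f (t + \<tau> + h)) (f (t + h)))"
          using dist_trunc_triangle order_trans add_left_mono by metis
        then show "shift_dist f h t \<le> shift_dist f \<tau> t + (shift_dist f h (t + \<tau>) + shift_dist f \<tau> (t + h))"
          by (simp add: shift_dist_def dist_trunc_commute[of "f (t + h)"] add.assoc add.commute[of h])
      qed
      also have "\<dots> = window l (shift_dist f \<tau>) \<xi> + (window l (shift_dist f h) (\<xi> + \<tau>) + window l (shift_dist f \<tau>) (\<xi> + h))"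
        by (simp add: window_add window_shift bounded_density_add bounded_density_shift bd)
      also have "\<dots> \<le> l * (\<epsilon> / 4) + (l * (\<epsilon> / 4) + l * (\<epsilon> / 4))"
      proof -
        have "window l (shift_dist f \<tau>) x \<le> l * (\<epsilon> / 4)" for x
          using window_le_window_sup[OF bd l, of \<tau> x] \<tau>(3) l mult_left_mono[of "window_sup l (shift_dist f \<tau>)" "\<epsilon> / 4" l] by linarith
        moreover have "window l (shift_dist f h) (\<xi> + \<tau>) \<le> l * (\<epsilon> / 4)"
          using window_subset[OF bd, of 0 "\<xi> + \<tau>" l "a + l" h] h0(2)[OF h] \<tau> by linarith
        ultimately show ?thesis by (intro add_mono)
      qed
      finally show "window l (shift_dist f h) \<xi> \<le> l * (3 / 4 * \<epsilon>)" by (simp add: algebra_simps)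
    qed
    then show "window_sup l (shift_dist f h) < \<epsilon>" using \<open>\<epsilon> > 0\<close> by linarith
  qed
qed

lemma weyl_seminorm_ap_seminorm:
  assumes f: "f \<in> W_class" shows "ap_seminorm (weyl_seminorm f)"
proof -
  note fM = W_class_M_class[OF f]
  have zero: "weyl_seminorm f 0 = 0"
    using weyl_seminorm_le[OF fM, of 1 0] weyl_seminorm_nonneg[OF fM, of 0] shift_dist_zero[where f=f and l=1] fM by simp
  show ?thesis
    unfolding ap_seminorm_def
  proof (intro conjI allI impI)
    show "weyl_seminorm f 0 = 0" by (fact zero)
    show "weyl_seminorm f (-x) = weyl_seminorm f x" for x
      unfolding weyl_seminorm_def by (intro INF_cong refl shift_dist_minus[OF fM]) simp
    show "weyl_seminorm f (x + y) \<le> weyl_seminorm f x + weyl_seminorm f y" for x y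
      by (rule weyl_seminorm_add[OF fM])
    show "isCont (weyl_seminorm f) 0"
      unfolding continuous_at_eps_delta dist_real_def
    proof (intro allI impI)
      fix e :: real assume "e > 0"
      then obtain l h0 where "l > 0" "h0 > 0" "\<And>h. \<bar>h\<bar> < h0 \<Longrightarrow> window_sup l (shift_dist f h) < e"
        using W_class_shift_continuous[OF f] by blast
      then show "\<exists>d>0. \<forall>x'. \<bar>x' - 0\<bar> < d \<longrightarrow> \<bar>weyl_seminorm f x' - weyl_seminorm f 0\<bar> < e"
        using weyl_seminorm_le[OF fM] weyl_seminorm_nonneg[OF fM]
        by (intro exI[of _ h0]) (auto simp: zero intro: le_less_trans)
    qed
    fix \<epsilon> :: real assume "\<epsilon> > 0"
    then obtain l a where l: "l > 0" "a > 0" "\<And>\<xi>. \<exists>\<tau>. \<xi> \<le> \<tau> \<and> \<tau> \<le> \<xi> + a \<and> window_sup l (shift_dist f \<tau>) < \<epsilon>"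
      using W_class_relatively_dense[OF f] by blast
    have "{\<xi>..\<xi> + a} \<inter> {t. weyl_seminorm f t < \<epsilon>} \<noteq> {}" for \<xi>
    proof -
      obtain \<tau> where "\<xi> \<le> \<tau>" "\<tau> \<le> \<xi> + a" "window_sup l (shift_dist f \<tau>) < \<epsilon>" using l(3) by blast
      moreover then have "weyl_seminorm f \<tau> < \<epsilon>" using weyl_seminorm_le[OF fM l(1), of \<tau>] by linarith
      ultimately show ?thesis by auto
    qed
    then show "relatively_dense {t. weyl_seminorm f t < \<epsilon>}"
      unfolding relatively_dense_def using l(2) by blast
  qed
qed

text \<open>
  Every \<open>\<tau>\<close> is a sum of an almost period \<open>e\<close>, a point of a finite grid and a short translation \<open>r\<close>. For \<open>e\<close> and \<open>r\<close> the distance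
  is small for all long windows, with a common bound. If \<open>weyl_seminorm f \<tau>\<close> is small, then it is small at the grid
  point too, and for the finitely many grid points one length of windows suffices.
\<close>
lemma weyl_seminorm_uniform:
  assumes f: "f \<in> W_class" and "\<epsilon> > 0"
  obtains \<delta> where "\<delta> > 0" "eventually (\<lambda>L. \<forall>\<tau>. weyl_seminorm f \<tau> < \<delta> \<longrightarrow> window_sup L (shift_dist f \<tau>) < \<epsilon>) at_top"
proof -
  note fM = W_class_M_class[OF f]
  note bd = bounded_density_shift_dist[OF fM]
  note ap = weyl_seminorm_ap_seminorm[OF f]
  define \<eta> where "\<eta> = \<epsilon> / 8"
  have \<eta>: "\<eta> > 0" using \<open>\<epsilon> > 0\<close> by (simp add: \<eta>_def)
  obtain l a where l: "l > 0" "a > 0" "\<And>\<xi>. \<exists>\<tau>. \<xi> \<le> \<tau> \<and> \<tau> \<le> \<xi> + a \<and> window_sup l (shift_dist f \<tau>) < \<eta>"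
    using W_class_relatively_dense[OF f \<eta>] by blast
  obtain l' h0 where l': "l' > 0" "h0 > 0" "\<And>h. \<bar>h\<bar> < h0 \<Longrightarrow> window_sup l' (shift_dist f h) < \<eta>"
    using W_class_shift_continuous[OF f \<eta>] by blast
  have longer: "window_sup L (shift_dist f \<tau>) < 2 * \<eta>" if "L \<ge> k" "k > 0" "window_sup k (shift_dist f \<tau>) < \<eta>" for L k \<tau>
  proof -
    have "window_sup L (shift_dist f \<tau>) \<le> (1 + k / L) * window_sup k (shift_dist f \<tau>)"
      using that by (intro window_sup_longer bd) auto
    also have "\<dots> \<le> 2 * window_sup k (shift_dist f \<tau>)"
      using that by (intro mult_right_mono window_sup_nonneg bd) (auto simp: field_simps)
    finally show ?thesis using that by simp
  qed
  define q where "q = h0 / 2"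
  have q: "q > 0" "q < h0" using l' by (auto simp: q_def)
  define n where "n = nat \<lceil>a / q\<rceil>"
  have "eventually (\<lambda>L. \<forall>i\<in>{..n}. weyl_seminorm f (real i * q) < 3 * \<eta> \<longrightarrow> window_sup L (shift_dist f (real i * q)) < 3 * \<eta>) at_top"
    using weyl_seminorm_less_eventually[OF fM, of _ "3 * \<eta>"] by (intro eventually_ball_finite) (auto elim: eventually_mono)
  then have "eventually (\<lambda>L. \<forall>\<tau>. weyl_seminorm f \<tau> < \<eta> \<longrightarrow> window_sup L (shift_dist f \<tau>) < \<epsilon>) at_top"
    using eventually_ge_at_top[of l] eventually_ge_at_top[of l']
  proof (eventually_elim, intro allI impI)
    fix L \<tau>
    assume grid: "\<forall>i\<in>{..n}. weyl_seminorm f (real i * q) < 3 * \<eta> \<longrightarrow> window_sup L (shift_dist f (real i * q)) < 3 * \<eta>"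
      and L: "l \<le> L" "l' \<le> L" and \<tau>: "weyl_seminorm f \<tau> < \<eta>"
    obtain e where e: "\<tau> - a \<le> e" "e \<le> \<tau>" "window_sup l (shift_dist f e) < \<eta>" using l(3)[of "\<tau> - a"] by auto
    define i where "i = nat \<lfloor>(\<tau> - e) / q\<rfloor>"
    have "real i = of_int \<lfloor>(\<tau> - e) / q\<rfloor>" using e q by (simp add: i_def)
    then have i: "real i \<le> (\<tau> - e) / q" "(\<tau> - e) / q < real i + 1" by linarith+
    have "(\<tau> - e) / q \<le> a / q" using e q by (intro divide_right_mono) auto
    then have "i \<le> n" using i unfolding n_def by linarith
    define r where "r = \<tau> - e - real i * q"
    have r: "0 \<le> r" "r < h0" using i q by (auto simp: r_def field_simps)
    have Nr: "window_sup l' (shift_dist f r) < \<eta>" using r by (intro l') auto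
    have \<tau>_eq: "\<tau> = e + (real i * q + r)" and i_eq: "real i * q = (\<tau> - e) - r" by (auto simp: r_def)
    have "weyl_seminorm f (real i * q) \<le> weyl_seminorm f \<tau> + weyl_seminorm f e + weyl_seminorm f r"
      unfolding i_eq using ap_diff[OF ap, of "\<tau> - e" r] ap_diff[OF ap, of \<tau> e] by linarith
    also have "\<dots> < 3 * \<eta>"
      using \<tau> weyl_seminorm_le[OF fM l(1), of e] weyl_seminorm_le[OF fM l'(1), of r] e(3) Nr by linarith
    finally have "window_sup L (shift_dist f (real i * q)) < 3 * \<eta>" using grid \<open>i \<le> n\<close> by blast
    moreover have "window_sup L (shift_dist f e) < 2 * \<eta>" using L l e by (intro longer[of l]) auto
    moreover have "window_sup L (shift_dist f r) < 2 * \<eta>" using L l' Nr by (intro longer[of l']) auto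
    moreover have "L > 0" using L l by linarith
    ultimately show "window_sup L (shift_dist f \<tau>) < \<epsilon>"
      unfolding \<tau>_eq using shift_dist_add[OF fM \<open>L > 0\<close>, of e "real i * q + r"] shift_dist_add[OF fM \<open>L > 0\<close>, of "real i * q" r] \<eta>
      by (simp add: \<eta>_def)
  qed
  then show thesis using \<eta> that by blast
qed

lemma returning_imp_weyl_seminorm_tendsto:
  assumes f: "f \<in> M_class" and "returning f \<tau>"
  shows "(\<lambda>j. weyl_seminorm f (\<tau> j)) \<longlonglongrightarrow> 0"
proof (rule LIMSEQ_I)
  fix r :: real assume "r > 0"
  then obtain l j0 where l: "l > 0" "\<And>j. j \<ge> j0 \<Longrightarrow> window_sup l (shift_dist f (\<tau> j)) < r"
    using assms(2) unfolding returning_def D_dist_shift_eq by blast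
  have "norm (weyl_seminorm f (\<tau> j) - 0) < r" if "j \<ge> j0" for j
    using weyl_seminorm_le[OF f l(1), of "\<tau> j"] weyl_seminorm_nonneg[OF f, of "\<tau> j"] l(2)[OF that] by simp
  then show "\<exists>no. \<forall>n\<ge>no. norm (weyl_seminorm f (\<tau> n) - 0) < r" by blast
qed

lemma exp_ii_eq_cis: "exp (\<i> * complex_of_real x) = cis x"
  by (simp add: cis_conv_exp)

lemma continuous_chars_weyl_seminorm: "f \<in> M_class \<Longrightarrow> continuous_chars (weyl_seminorm f) \<subseteq> Mod f"
  unfolding continuous_chars_def Mod_def exp_ii_eq_cis using returning_imp_weyl_seminorm_tendsto by blast

section \<open>Piecewise sums\<close>

text \<open>
  If \<open>t \<in> T j\<close> and \<open>t + \<tau> \<notin> T j\<close>, then the indicator function of \<open>T j\<close> takes different values at these points, at the largest possible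
  truncated distance \<open>1\<close>.
\<close>
lemma shift_dist_piecewise_sum_le:
  fixes F :: "real \<Rightarrow> 'a::complete_space"
  assumes T: "\<And>j. (indicator (T j) :: real \<Rightarrow> real) \<in> M_class" "\<And>j. T j \<in> sets lebesgue"
    and f: "\<And>j. f j \<in> M_class" and F: "piecewise_sum f T F" and FM: "F \<in> M_class" and l: "l > 0"
  shows "window_sup l (shift_dist F \<tau>) \<le> (\<Sum>j\<le>n. window_sup l (shift_dist (f j) \<tau>))
     + (\<Sum>j\<le>n. window_sup l (shift_dist (indicator (T j) :: real \<Rightarrow> real) \<tau>)) + window_sup l (indicator (UNIV - (\<Union>j\<le>n. T j)))"
proof -
  define R where "R = UNIV - (\<Union>j\<le>n. T j)"
  have Rd: "bounded_density (indicator R)"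
    unfolding bounded_density_def R_def using T(2)
    by (intro conjI borel_measurable_indicator exI[of _ 1] sets.Diff sets.finite_UN) (auto simp: indicator_def)
  have fd: "bounded_density (\<lambda>t. \<Sum>j\<le>n. shift_dist (f j) \<tau> t)"
    by (intro bounded_density_sum bounded_density_shift_dist f)
  have Td: "bounded_density (\<lambda>t. \<Sum>j\<le>n. shift_dist (indicator (T j) :: real \<Rightarrow> real) \<tau> t)"
    by (intro bounded_density_sum bounded_density_shift_dist T)
  have "AE t in lebesgue. \<forall>j. t \<in> T j \<longrightarrow> F t = f j t" using F by (simp add: piecewise_sum_def)
  moreover have "AE t in lebesgue. \<forall>j. t + \<tau> \<in> T j \<longrightarrow> F (t + \<tau>) = f j (t + \<tau>)"
    by (rule AE_lebesgue_shift[OF calculation])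
  ultimately have "AE t in lebesgue. shift_dist F \<tau> t \<le>
      (\<Sum>j\<le>n. shift_dist (f j) \<tau> t) + (\<Sum>j\<le>n. shift_dist (indicator (T j) :: real \<Rightarrow> real) \<tau> t) + indicator R t"
  proof eventually_elim
    case (elim t)
    have nn: "0 \<le> (\<Sum>j\<le>n. shift_dist (f j) \<tau> t)" "0 \<le> (\<Sum>j\<le>n. shift_dist (indicator (T j) :: real \<Rightarrow> real) \<tau> t)"
      by (auto intro!: sum_nonneg simp: shift_dist_def dist_trunc_nonneg)
    have le1: "shift_dist F \<tau> t \<le> 1" by (simp add: shift_dist_def dist_trunc_le_1)
    show ?case
    proof (cases "t \<in> R")
      case True
      then show ?thesis using nn le1 by simp
    next
      case False
      then obtain j where j: "j \<le> n" "t \<in> T j" by (auto simp: R_def)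
      show ?thesis
      proof (cases "t + \<tau> \<in> T j")
        case True
        then have "shift_dist F \<tau> t = shift_dist (f j) \<tau> t" using elim j by (simp add: shift_dist_def)
        also have "\<dots> \<le> (\<Sum>j\<le>n. shift_dist (f j) \<tau> t)"
          using j by (intro member_le_sum) (auto simp: shift_dist_def dist_trunc_nonneg)
        finally show ?thesis using nn by (simp add: indicator_def)
      next
        case False
        then have "1 = shift_dist (indicator (T j) :: real \<Rightarrow> real) \<tau> t" using j by (simp add: shift_dist_def dist_trunc_def)
        also have "\<dots> \<le> (\<Sum>j\<le>n. shift_dist (indicator (T j) :: real \<Rightarrow> real) \<tau> t)"
          using j by (intro member_le_sum) (auto simp: shift_dist_def dist_trunc_nonneg)
        finally show ?thesis using nn le1 by (simp add: indicator_def)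
      qed
    qed
  qed
  then have "window_sup l (shift_dist F \<tau>) \<le> window_sup l (\<lambda>t.
      (\<Sum>j\<le>n. shift_dist (f j) \<tau> t) + (\<Sum>j\<le>n. shift_dist (indicator (T j) :: real \<Rightarrow> real) \<tau> t) + indicator R t)"
    using l by (intro window_sup_mono_AE bounded_density_shift_dist FM bounded_density_add fd Td Rd)
  also have "\<dots> \<le> window_sup l (\<lambda>t. \<Sum>j\<le>n. shift_dist (f j) \<tau> t)
      + window_sup l (\<lambda>t. \<Sum>j\<le>n. shift_dist (indicator (T j) :: real \<Rightarrow> real) \<tau> t) + window_sup l (indicator R)"
    using l by (intro order_trans[OF window_sup_add] add_mono window_sup_add bounded_density_add fd Td Rd order_refl)
  also have "\<dots> \<le> (\<Sum>j\<le>n. window_sup l (shift_dist (f j) \<tau>))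
     + (\<Sum>j\<le>n. window_sup l (shift_dist (indicator (T j) :: real \<Rightarrow> real) \<tau>)) + window_sup l (indicator R)"
    using l by (intro add_mono window_sup_sum bounded_density_shift_dist f T order_refl)
  finally show ?thesis by (simp add: R_def)
qed

text \<open>The seminorms of all \<open>f j\<close> and of all indicator functions of \<open>T j\<close>, interleaved in one sequence: these
  functions have values in different spaces, but their seminorms have the same type.\<close>
definition piece_seminorm :: "(nat \<Rightarrow> real \<Rightarrow> 'a::metric_space) \<Rightarrow> (nat \<Rightarrow> real set) \<Rightarrow> nat \<Rightarrow> real \<Rightarrow> real" where
  "piece_seminorm f T k = (if even k then weyl_seminorm (f (k div 2)) else weyl_seminorm (indicator (T (k div 2)) :: real \<Rightarrow> real))"

lemma shift_dist_piecewise_sum_small: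
  fixes F :: "real \<Rightarrow> 'a::complete_space"
  assumes T: "T \<in> MW UNIV" and f: "\<And>j. f j \<in> W_class" and F: "piecewise_sum f T F" and FM: "F \<in> M_class"
    and \<epsilon>: "\<epsilon> > 0"
  obtains m \<delta> L where "\<delta> > 0" "L > 0"
    "\<And>\<tau>. (\<forall>k\<in>{..m}. piece_seminorm f T k \<tau> < \<delta>) \<Longrightarrow> window_sup L (shift_dist F \<tau>) < \<epsilon>"
proof -
  let ?\<chi> = "\<lambda>j. indicator (T j) :: real \<Rightarrow> real"
  have Ts: "T j \<in> sets lebesgue" "?\<chi> j \<in> W_class" for j using T by (auto simp: MW_def W_sets_def)
  have "(\<lambda>N. norm1 (indicator (UNIV - (\<Union>j\<le>N. T j)))) \<longlonglongrightarrow> 0" using T by (simp add: MW_def)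
  then have "eventually (\<lambda>N. norm1 (indicator (UNIV - (\<Union>j\<le>N. T j))) < \<epsilon> / 2) sequentially"
    using \<epsilon> by (intro order_tendstoD) auto
  then obtain n where n: "norm1 (indicator (UNIV - (\<Union>j\<le>n. T j))) < \<epsilon> / 2" by (auto simp: eventually_sequentially)
  have Rd: "bounded_density (indicator (UNIV - (\<Union>j\<le>n. T j)))"
    unfolding bounded_density_def using Ts
    by (intro conjI borel_measurable_indicator exI[of _ 1] sets.Diff sets.finite_UN) (auto simp: indicator_def)
  obtain l where "l > 0" "window_sup l (indicator (UNIV - (\<Union>j\<le>n. T j))) < \<epsilon> / 2"
    using norm1_less_imp_window_sup[OF Rd n] by blast
  then obtain L0 where "L0 > 0" "\<And>L. L \<ge> L0 \<Longrightarrow> window_sup L (indicator (UNIV - (\<Union>j\<le>n. T j))) < \<epsilon> / 2"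
    using window_sup_eventually_small[OF Rd] by blast
  then have ev1: "eventually (\<lambda>L. window_sup L (indicator (UNIV - (\<Union>j\<le>n. T j))) < \<epsilon> / 2) at_top"
    by (auto simp: eventually_at_top_linorder)
  define \<eta> where "\<eta> = \<epsilon> / (4 * real (Suc n))"
  have \<eta>: "\<eta> > 0" using \<epsilon> by (simp add: \<eta>_def)
  have "\<forall>j. \<exists>\<delta>>0. eventually (\<lambda>L. \<forall>\<tau>. weyl_seminorm (f j) \<tau> < \<delta> \<longrightarrow> window_sup L (shift_dist (f j) \<tau>) < \<eta>) at_top"
  proof
    fix j
    obtain \<delta> where "\<delta> > 0" "eventually (\<lambda>L. \<forall>\<tau>. weyl_seminorm (f j) \<tau> < \<delta> \<longrightarrow> window_sup L (shift_dist (f j) \<tau>) < \<eta>) at_top"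
      by (rule weyl_seminorm_uniform[OF f \<eta>])
    then show "\<exists>\<delta>>0. eventually (\<lambda>L. \<forall>\<tau>. weyl_seminorm (f j) \<tau> < \<delta> \<longrightarrow> window_sup L (shift_dist (f j) \<tau>) < \<eta>) at_top"
      by (intro exI conjI)
  qed
  from choice[OF this] obtain \<delta>f where \<delta>f: "\<And>j. \<delta>f j > 0"
    "\<And>j. eventually (\<lambda>L. \<forall>\<tau>. weyl_seminorm (f j) \<tau> < \<delta>f j \<longrightarrow> window_sup L (shift_dist (f j) \<tau>) < \<eta>) at_top" by blast
  have "\<forall>j. \<exists>\<delta>>0. eventually (\<lambda>L. \<forall>\<tau>. weyl_seminorm (?\<chi> j) \<tau> < \<delta> \<longrightarrow> window_sup L (shift_dist (?\<chi> j) \<tau>) < \<eta>) at_top"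
  proof
    fix j
    obtain \<delta> where "\<delta> > 0" "eventually (\<lambda>L. \<forall>\<tau>. weyl_seminorm (?\<chi> j) \<tau> < \<delta> \<longrightarrow> window_sup L (shift_dist (?\<chi> j) \<tau>) < \<eta>) at_top"
      by (rule weyl_seminorm_uniform[OF Ts(2) \<eta>])
    then show "\<exists>\<delta>>0. eventually (\<lambda>L. \<forall>\<tau>. weyl_seminorm (?\<chi> j) \<tau> < \<delta> \<longrightarrow> window_sup L (shift_dist (?\<chi> j) \<tau>) < \<eta>) at_top"
      by (intro exI conjI)
  qed
  from choice[OF this] obtain \<delta>T where \<delta>T: "\<And>j. \<delta>T j > 0"
    "\<And>j. eventually (\<lambda>L. \<forall>\<tau>. weyl_seminorm (?\<chi> j) \<tau> < \<delta>T j \<longrightarrow> window_sup L (shift_dist (?\<chi> j) \<tau>) < \<eta>) at_top" by blast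
  have "eventually (\<lambda>L. \<forall>j\<in>{..n}. \<forall>\<tau>. weyl_seminorm (f j) \<tau> < \<delta>f j \<longrightarrow> window_sup L (shift_dist (f j) \<tau>) < \<eta>) at_top"
    using \<delta>f(2) by (intro eventually_ball_finite) auto
  moreover have "eventually (\<lambda>L. \<forall>j\<in>{..n}. \<forall>\<tau>. weyl_seminorm (?\<chi> j) \<tau> < \<delta>T j \<longrightarrow> window_sup L (shift_dist (?\<chi> j) \<tau>) < \<eta>) at_top"
    using \<delta>T(2) by (intro eventually_ball_finite) auto
  ultimately have "eventually (\<lambda>L. 0 < L \<and> window_sup L (indicator (UNIV - (\<Union>j\<le>n. T j))) < \<epsilon> / 2
     \<and> (\<forall>j\<in>{..n}. \<forall>\<tau>. weyl_seminorm (f j) \<tau> < \<delta>f j \<longrightarrow> window_sup L (shift_dist (f j) \<tau>) < \<eta>)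
     \<and> (\<forall>j\<in>{..n}. \<forall>\<tau>. weyl_seminorm (?\<chi> j) \<tau> < \<delta>T j \<longrightarrow> window_sup L (shift_dist (?\<chi> j) \<tau>) < \<eta>)) at_top"
    using ev1 eventually_gt_at_top[of 0] by eventually_elim blast
  from eventually_happens'[OF trivial_limit_at_top_linorder this]
  obtain L where L: "0 < L" "window_sup L (indicator (UNIV - (\<Union>j\<le>n. T j))) < \<epsilon> / 2"
     and Lf: "\<forall>j\<in>{..n}. \<forall>\<tau>. weyl_seminorm (f j) \<tau> < \<delta>f j \<longrightarrow> window_sup L (shift_dist (f j) \<tau>) < \<eta>"
     and LT: "\<forall>j\<in>{..n}. \<forall>\<tau>. weyl_seminorm (?\<chi> j) \<tau> < \<delta>T j \<longrightarrow> window_sup L (shift_dist (?\<chi> j) \<tau>) < \<eta>"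
    by (elim exE conjE) (rule that)
  define \<delta> where "\<delta> = Min (\<delta>f ` {..n} \<union> \<delta>T ` {..n})"
  show thesis
  proof (rule that[of \<delta> L "2 * n + 1"])
    show "\<delta> > 0" unfolding \<delta>_def using \<delta>f(1) \<delta>T(1) by (subst Min_gr_iff) auto
    show "L > 0" by fact
    fix \<tau> assume small: "\<forall>k\<in>{..2*n+1}. piece_seminorm f T k \<tau> < \<delta>"
    have "window_sup L (shift_dist (f j) \<tau>) \<le> \<eta>" if "j \<le> n" for j
    proof -
      have "\<delta> \<le> \<delta>f j" unfolding \<delta>_def using that by (intro Min_le) auto
      moreover have "weyl_seminorm (f j) \<tau> < \<delta>" using small[rule_format, of "2 * j"] that by (simp add: piece_seminorm_def)
      ultimately show ?thesis using Lf[rule_format, of j \<tau>] that by simp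
    qed
    then have "(\<Sum>j\<le>n. window_sup L (shift_dist (f j) \<tau>)) \<le> (\<Sum>j\<le>n. \<eta>)" by (intro sum_mono) simp
    moreover have "window_sup L (shift_dist (?\<chi> j) \<tau>) \<le> \<eta>" if "j \<le> n" for j
    proof -
      have "\<delta> \<le> \<delta>T j" unfolding \<delta>_def using that by (intro Min_le) auto
      moreover have "weyl_seminorm (?\<chi> j) \<tau> < \<delta>" using small[rule_format, of "2 * j + 1"] that by (simp add: piece_seminorm_def)
      ultimately show ?thesis using LT[rule_format, of j \<tau>] that by simp
    qed
    then have "(\<Sum>j\<le>n. window_sup L (shift_dist (?\<chi> j) \<tau>)) \<le> (\<Sum>j\<le>n. \<eta>)" by (intro sum_mono) simp
    moreover have "(\<Sum>j\<le>n. \<eta>) = \<epsilon> / 4"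
    proof -
      have "c * (\<epsilon> / (4 * c)) = \<epsilon> / 4" if "c \<noteq> 0" for c :: real using that by simp
      from this[of "real (Suc n)"] show ?thesis by (simp only: \<eta>_def sum_constant card_atMost)
    qed
    moreover have "window_sup L (shift_dist F \<tau>) \<le> (\<Sum>j\<le>n. window_sup L (shift_dist (f j) \<tau>))
     + (\<Sum>j\<le>n. window_sup L (shift_dist (?\<chi> j) \<tau>)) + window_sup L (indicator (UNIV - (\<Union>j\<le>n. T j)))"
      by (rule shift_dist_piecewise_sum_le[OF W_class_M_class[OF Ts(2)] Ts(1) W_class_M_class[OF f] F FM L(1)])
    ultimately show "window_sup L (shift_dist F \<tau>) < \<epsilon>" using L(2) by linarith
  qed
qed

theorem theorem1p1:
  fixes T :: "nat \<Rightarrow> real set"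
    and f :: "nat \<Rightarrow> real \<Rightarrow> 'u::complete_space"
    and F :: "real \<Rightarrow> 'u"
  assumes "T \<in> MW UNIV"
    and "\<And>j. f j \<in> W_class"
    and "piecewise_sum f T F"
  shows "F \<in> W_class \<and>
    Mod F \<subseteq> module_plus (module_Sum (\<lambda>j. Mod (f j))) (module_Sum (\<lambda>j. Mod_set (T j)))"
proof
  have Ts: "disjoint_family T" "\<And>j. T j \<in> sets lebesgue" "UNIV - (\<Union>j. T j) \<in> null_sets lebesgue"
    "\<And>j. (indicator (T j) :: real \<Rightarrow> real) \<in> W_class"
    using assms(1) by (auto simp: MW_def W_sets_def)
  have FM: "F \<in> M_class"
    by (rule M_class_piecewise_sum[OF Ts(1-3) _ assms(3)]) (rule W_class_M_class[OF assms(2)])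
  define N where "N = piece_seminorm f T"
  note small = shift_dist_piecewise_sum_small[OF assms(1) assms(2) assms(3) FM, folded N_def]
  have N: "ap_seminorm (N k)" for k
    using assms(2) Ts(4) by (simp add: N_def piece_seminorm_def weyl_seminorm_ap_seminorm)
  show "F \<in> W_class"
    unfolding W_class_def D_dist_shift_eq
  proof (intro CollectI conjI allI impI FM)
    fix \<epsilon> :: real assume \<epsilon>: "\<epsilon> > 0"
    obtain m \<delta> L where m: "\<delta> > 0" "L > 0"
      "\<And>\<tau>. (\<forall>k\<in>{..m}. N k \<tau> < \<delta>) \<Longrightarrow> window_sup L (shift_dist F \<tau>) < \<epsilon>"
      by (rule small[OF \<epsilon>]) blast
    obtain I \<delta>' where I: "finite I" "0 < \<delta>'" "bohr_set I \<delta>' \<subseteq> {t. \<forall>k\<in>{..m}. N k t < \<delta>}"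
      by (rule common_bohr_set[OF N finite_atMost m(1)])
    have "bohr_set I \<delta>' \<subseteq> {\<tau>. window_sup L (shift_dist F \<tau>) < \<epsilon>}" using I(3) m(3) by blast
    then have "relatively_dense {\<tau>. window_sup L (shift_dist F \<tau>) < \<epsilon>}"
      using bohr_set_relatively_dense[OF I(1,2)] unfolding relatively_dense_def by blast
    then show "\<exists>l>0. relatively_dense {\<tau>. window_sup l (shift_dist F \<tau>) < \<epsilon>}" using m(2) by blast
  qed
  show "Mod F \<subseteq> module_plus (module_Sum (\<lambda>j. Mod (f j))) (module_Sum (\<lambda>j. Mod_set (T j)))"
  proof
    fix \<mu> assume \<mu>: "\<mu> \<in> Mod F"
    have "\<mu> \<in> group_closure (\<Union>k. continuous_chars (N k))"
    proof (rule continuous_char_in_group_closure[OF N])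
      fix \<tau> :: "nat \<Rightarrow> real" assume lim: "\<And>k. (\<lambda>j. N k (\<tau> j)) \<longlonglongrightarrow> 0"
      have "returning F \<tau>"
        unfolding returning_def D_dist_shift_eq
      proof (intro allI impI)
        fix \<epsilon> :: real assume \<epsilon>: "\<epsilon> > 0"
        obtain m \<delta> L where m: "\<delta> > 0" "L > 0"
          "\<And>\<tau>. (\<forall>k\<in>{..m}. N k \<tau> < \<delta>) \<Longrightarrow> window_sup L (shift_dist F \<tau>) < \<epsilon>"
          by (rule small[OF \<epsilon>]) blast
        have "eventually (\<lambda>j. \<forall>k\<in>{..m}. N k (\<tau> j) < \<delta>) sequentially"
          using order_tendstoD(2)[OF lim m(1)] by (intro eventually_ball_finite) auto
        then show "\<exists>l>0. \<exists>j0. \<forall>j\<ge>j0. window_sup l (shift_dist F (\<tau> j)) < \<epsilon>"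
          using m(2,3) unfolding eventually_sequentially by blast
      qed
      then show "(\<lambda>j. cis (\<mu> * \<tau> j)) \<longlonglongrightarrow> 1" using \<mu> unfolding Mod_def exp_ii_eq_cis by blast
    qed
    then show "\<mu> \<in> module_plus (module_Sum (\<lambda>j. Mod (f j))) (module_Sum (\<lambda>j. Mod_set (T j)))"
      unfolding module_plus_def
    proof (rule group_closure_mono)
      have "continuous_chars (N k) \<subseteq> (\<Union>j. Mod (f j)) \<union> (\<Union>j. Mod_set (T j))" for k
        using continuous_chars_weyl_seminorm[OF W_class_M_class[OF assms(2)], of "k div 2"]
          continuous_chars_weyl_seminorm[OF W_class_M_class[OF Ts(4)], of "k div 2"]
        unfolding N_def piece_seminorm_def Mod_set_def by (cases "even k") auto
      then have "(\<Union>k. continuous_chars (N k)) \<subseteq> (\<Union>j. Mod (f j)) \<union> (\<Union>j. Mod_set (T j))"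
        by (rule UN_least)
      also have "\<dots> \<subseteq> module_Sum (\<lambda>j. Mod (f j)) \<union> module_Sum (\<lambda>j. Mod_set (T j))"
      proof (rule Un_mono)
        have base: "S \<subseteq> group_closure S" for S :: "real set" by (simp add: group_closure.base subsetI)
        show "(\<Union>j. Mod (f j)) \<subseteq> module_Sum (\<lambda>j. Mod (f j))"
          "(\<Union>j. Mod_set (T j)) \<subseteq> module_Sum (\<lambda>j. Mod_set (T j))"
          unfolding module_Sum_def by (rule base)+
      qed
      finally show "(\<Union>k. continuous_chars (N k)) \<subseteq> module_Sum (\<lambda>j. Mod (f j)) \<union> module_Sum (\<lambda>j. Mod_set (T j))" .
    qed
  qed
qed

end
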